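(* The following questions have negative answers both for the Krein system and for the Dirac equation. Explicitly: (Krein, Q1) There is $A\in L^2(\mathbb{R}^+)$ such that it is not true that for a.e. $\xi\in\mathbb{R}$ both limits $\lim_{x\to\infty}\mathfrak{A}(x,\xi,A)$ and $\lim_{x\to\infty}\mathfrak{B}(x,\xi,A)$ exist. (Krein, Q2) It is not true that for every $A\in L^2(\mathbb{R}^+)$ one has $\mathfrak{M}(\xi,A)<\infty$ for a.e. $\xi\in\mathbb{R}$, nor is it true that for every $A\in L^2(\mathbb{R}^+)$ one has $\mathfrak{M}_w(\xi,A)<\infty$ for a.e. $\xi\in\mathbb{R}$. Moreover, for every $\delta_0>0$ and for each choice of $\mathcal{M}\in\{\mathfrak{M},\mathfrak{M}_w\}$ there is no constant $K<\infty$ such that $|\{\xi\in\mathbb{R}:\mathcal{M}(\xi,A)\ge\lambda\}|\le K\|A\|_2/\lambda$ for all $\lambda>0$ and all $A\in L^2(\mathbb{R}^+)$ with $\|A\|_2\le\delta_0$. (Dirac, Q1) There is $q\in L^2(\mathbb{R})$ such that it is not true that for a.e. $\xi\in\mathbb{R}$ the limit of $a(\xi,q\cdot\chi_{T_1\le x\le T_2})$ as $T_1\to-\infty$, $T_2\to+\infty$ exists. (Dirac, Q2) It is not true that for every $q\in L^2(\mathbb{R})$ one has $\mathrm{M}(\xi,q)<\infty$ for a.e. $\xi\in\mathbb{R}$, nor is it true that for every $q\in L^2(\mathbb{R})$ one has $\mathrm{M}_w(\xi,q)<\infty$ for a.e. $\xi\in\mathbb{R}$. Moreover, for every $\delta_0>0$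 and for each choice of $\mathcal{M}\in\{\mathrm{M},\mathrm{M}_w\}$ there is no constant $K<\infty$ such that $|\{\xi\in\mathbb{R}:\mathcal{M}(\xi,q)\ge\lambda\}|\le K\|q\|_2/\lambda$ for all $\lambda>0$ and all $q\in L^2(\mathbb{R})$ with $\|q\|_2\le\delta_0$.
   Context: $\mathbb{R}^+=[0,\infty)$, $\mathbb{C}^+=\{k\in\mathbb{C}:\operatorname{Im}k>0\}$, $|E|$ is Lebesgue measure of $E\subset\mathbb{R}$, $\chi$ denotes a characteristic function. For $\xi\in\mathbb{R}$ let $S_\xi=\{k\in\mathbb{C}^+:|\operatorname{Re}k-\xi|<\operatorname{Im}k\}$ be the Stolz angle at $\xi$. Krein system. For complex-valued $A\in L^1_{\rm loc}(\mathbb{R}^+)$ and $k\in\mathbb{C}$, let $X(x,k,A)$ be the $2\times2$ fundamental matrix: $$\partial_xX=\begin{pmatrix} ik&-\overline{A(x)}\\-A(x)&0\end{pmatrix}X,\qquad X(0,k,A)=\begin{pmatrix}1&0\\0&1\end{pmatrix},\qquad x\ge0.$$ Define $\mathfrak{B}:=X_{21}$ and $\mathfrak{A}:=X_{22}$. For each $x$, $\mathfrak{A}(x,\cdot,A)$ is entire, satisfies $|\mathfrak{A}|\ge1$ on $\overline{\mathbb{C}^+}$, and is outer in $\mathbb{C}^+$; its argument is $$\arg\mathfrak{A}(x,k,A)=\operatorname{Im}\Bigl(\frac1{\pi i}\int_{\mathbb{R}}\frac{\log|\mathfrak{A}(x,s,A)|}{s-k}\,ds\Bigr),\quad k\in\mathbb{C}^+,$$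 (the branch vanishing at infinity), extended continuously to real $k$. Put $$\mathfrak{M}(\xi,A)=\sup_{k\in S_\xi,\,x\in\mathbb{R}^+}|\arg\mathfrak{A}(x,k,A)|,\qquad \mathfrak{M}_w(\xi,A)=\sup_{x\in\mathbb{R}^+}|\arg\mathfrak{A}(x,\xi,A)|.$$ Dirac equation. For complex-valued $q\in L^1(\mathbb{R})$ let $\mathcal{L}_q=i\sigma_3\partial_x+i(q\sigma_--\overline{q}\sigma_+)$ with $\sigma_3=\begin{pmatrix}1&0\\0&-1\end{pmatrix}$, $\sigma_+=\begin{pmatrix}0&1\\0&0\end{pmatrix}$, $\sigma_-=\begin{pmatrix}0&0\\1&0\end{pmatrix}$, and $E(x,\xi)=\mathrm{diag}(e^{\frac{\xi}{2i}x},e^{-\frac{\xi}{2i}x})$. For $\xi\in\mathbb{R}$ the Jost solutions $T_\pm(x,\xi,q)$ are the matrix solutions of $\mathcal{L}_qT_\pm=\tfrac{\xi}{2}T_\pm$ with $T_\pm=E(x,\xi)+o(1)$ as $x\to\pm\infty$. Then $T_-(x,\xi,q)=T_+(x,\xi,q)T(\xi,q)$ with $$T(\xi,q)=\begin{pmatrix}a(\xi,q)&\overline{b(\xi,q)}\\ b(\xi,q)&\overline{a(\xi,q)}\end{pmatrix},\qquad |a|^2-|b|^2=1,$$ which defines $a$ and $b$. The function $a(\cdot,q)$ is the boundary value of the outer function $a(k,q)=\exp\bigl(\frac1{\pi i}\int_{\mathbb{R}}\frac{\log|a(s,q)|}{s-k}\,ds\bigr)$, $k\in\mathbb{C}^+$,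 and $\arg a(k,q)$ is the imaginary part of the exponent for $k\in\mathbb{C}^+$, extended continuously to real $k$ (for compactly supported integrable potentials). For $q\in L^2(\mathbb{R})$ put $$\mathrm{M}(\xi,q)=\sup_{k\in S_\xi,\,T_1<T_2}|\arg a(k,q\cdot\chi_{T_1\le x\le T_2})|,\qquad \mathrm{M}_w(\xi,q)=\sup_{T_1<T_2}|\arg a(\xi,q\cdot\chi_{T_1\le x\le T_2})|,$$ with suprema over real $T_1<T_2$. *)

theory Defs
  imports "HOL-Analysis.Analysis"
begin

subsection \<open>Square-integrable functions\<close>

definition L2_on :: "real set \<Rightarrow> (real \<Rightarrow> complex) set" where
  "L2_on S = {f. set_borel_measurable lebesgue S f \<and>
                 set_integrable lebesgue S (\<lambda>x. (cmod (f x))\<^sup>2)}"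

definition L2_norm_on :: "real set \<Rightarrow> (real \<Rightarrow> complex) \<Rightarrow> real" where
  "L2_norm_on S f = sqrt (LINT x:S|lebesgue. (cmod (f x))\<^sup>2)"

subsection \<open>Locally absolutely continuous functions\<close>

text \<open>For integrable coefficients, solutions of the differential systems below are meant in the
  usual (Caratheodory) sense: locally absolutely continuous functions satisfying the equation
  almost everywhere. A function is locally absolutely continuous on an interval
  iff it is the indefinite integral of a locally integrable function, which is then its
  a.e. derivative.\<close>

definition has_ac_derivative_on ::
    "(real \<Rightarrow> complex^2^2) \<Rightarrow> (real \<Rightarrow> complex^2^2) \<Rightarrow> real set \<Rightarrow> bool" where
  "has_ac_derivative_on X D S \<longleftrightarrow>
     (\<forall>x\<in>S. \<forall>y\<in>S. x \<le> y \<longrightarrow>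
        set_integrable lebesgue {x..y} D \<and> X y = X x + (LINT t:{x..y}|lebesgue. D t))"

subsection \<open>Arguments of outer functions in the upper half-plane\<close>

definition upper_half_plane :: "complex set" where
  "upper_half_plane = {k. Im k > 0}"

definition stolz :: "real \<Rightarrow> complex set" where
  "stolz \<xi> = {k \<in> upper_half_plane. \<bar>Re k - \<xi>\<bar> < Im k}"

text \<open>With \<open>u = ln \<bar>f\<bar>\<close> on the real line, \<open>exp (outer_exponent u)\<close> is the outer function with
  boundary modulus \<open>\<bar>f\<bar>\<close> that tends to 1 at infinity.\<close>

definition outer_exponent :: "(real \<Rightarrow> real) \<Rightarrow> complex \<Rightarrow> complex" where
  "outer_exponent u k =
     1 / (of_real pi * \<i>) * (LINT s|lebesgue. of_real (u s) / (of_real s - k))"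

text \<open>The value at real \<open>k\<close> is the continuous extension from the upper half-plane.\<close>

definition outer_arg :: "(real \<Rightarrow> real) \<Rightarrow> complex \<Rightarrow> real" where
  "outer_arg u k =
     (if k \<in> upper_half_plane then Im (outer_exponent u k)
      else Lim (at k within upper_half_plane) (\<lambda>z. Im (outer_exponent u z)))"

subsection \<open>The Krein system\<close>

definition krein_fundamental ::
    "complex \<Rightarrow> (real \<Rightarrow> complex) \<Rightarrow> (real \<Rightarrow> complex^2^2) \<Rightarrow> bool" where
  "krein_fundamental k A X \<longleftrightarrow> X 0 = mat 1 \<and>
     (\<exists>D. has_ac_derivative_on X D {0..} \<and>
          (AE x in lebesgue. x \<ge> 0 \<longrightarrow>
             D x = vector [vector [\<i> * k, - cnj (A x)],
                           vector [- A x,  0]] ** X x))"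

text \<open>The system determines the solution on \<open>{0..}\<close> only, hence the description is of its value
  at \<open>x\<close> rather than of the function on the whole type.\<close>

definition krein_X :: "real \<Rightarrow> complex \<Rightarrow> (real \<Rightarrow> complex) \<Rightarrow> complex^2^2" where
  "krein_X x k A = (THE M. \<exists>X. krein_fundamental k A X \<and> M = X x)"

definition krein_B :: "real \<Rightarrow> complex \<Rightarrow> (real \<Rightarrow> complex) \<Rightarrow> complex" where
  "krein_B x k A = krein_X x k A $ 2 $ 1"

definition krein_A :: "real \<Rightarrow> complex \<Rightarrow> (real \<Rightarrow> complex) \<Rightarrow> complex" where
  "krein_A x k A = krein_X x k A $ 2 $ 2"

definition krein_arg :: "real \<Rightarrow> complex \<Rightarrow> (real \<Rightarrow> complex) \<Rightarrow> real" where
  "krein_arg x k A = outer_arg (\<lambda>s. ln (cmod (krein_A x (of_real s) A))) k"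

definition krein_M :: "real \<Rightarrow> (real \<Rightarrow> complex) \<Rightarrow> ereal" where
  "krein_M \<xi> A = Sup {ereal \<bar>krein_arg x k A\<bar> | k x. k \<in> stolz \<xi> \<and> x \<ge> 0}"

definition krein_Mw :: "real \<Rightarrow> (real \<Rightarrow> complex) \<Rightarrow> ereal" where
  "krein_Mw \<xi> A = Sup {ereal \<bar>krein_arg x (of_real \<xi>) A\<bar> | x. x \<ge> 0}"

subsection \<open>The Dirac equation\<close>

definition sigma3 :: "complex^2^2" where
  "sigma3 = vector [vector [1, 0], vector [0, -1]]"

definition sigma_plus :: "complex^2^2" where
  "sigma_plus = vector [vector [0, 1], vector [0, 0]]"

definition sigma_minus :: "complex^2^2" where
  "sigma_minus = vector [vector [0, 0], vector [1, 0]]"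

text \<open>\<open>mat c ** M\<close> is the product of the matrix \<open>M\<close> with the complex scalar \<open>c\<close>.\<close>

definition dirac_solution ::
    "real \<Rightarrow> (real \<Rightarrow> complex) \<Rightarrow> (real \<Rightarrow> complex^2^2) \<Rightarrow> bool" where
  "dirac_solution \<xi> q T \<longleftrightarrow>
     (\<exists>D. has_ac_derivative_on T D UNIV \<and>
          (AE x in lebesgue.
             mat \<i> ** sigma3 ** D x
             + mat \<i> ** (mat (q x) ** sigma_minus - mat (cnj (q x)) ** sigma_plus) ** T x
             = mat (of_real (\<xi> / 2)) ** T x))"

definition dirac_E :: "real \<Rightarrow> real \<Rightarrow> complex^2^2" where
  "dirac_E x \<xi> =
     vector [vector [exp (of_real \<xi> / (2 * \<i>) * of_real x), 0],
             vector [0, exp (- (of_real \<xi> / (2 * \<i>)) * of_real x)]]"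

definition jost_plus :: "real \<Rightarrow> (real \<Rightarrow> complex) \<Rightarrow> real \<Rightarrow> complex^2^2" where
  "jost_plus \<xi> q =
     (THE T. dirac_solution \<xi> q T \<and> ((\<lambda>x. T x - dirac_E x \<xi>) \<longlongrightarrow> 0) at_top)"

definition jost_minus :: "real \<Rightarrow> (real \<Rightarrow> complex) \<Rightarrow> real \<Rightarrow> complex^2^2" where
  "jost_minus \<xi> q =
     (THE T. dirac_solution \<xi> q T \<and> ((\<lambda>x. T x - dirac_E x \<xi>) \<longlongrightarrow> 0) at_bot)"

definition dirac_T :: "real \<Rightarrow> (real \<Rightarrow> complex) \<Rightarrow> complex^2^2" where
  "dirac_T \<xi> q = (THE M. \<forall>x. jost_minus \<xi> q x = jost_plus \<xi> q x ** M)"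

definition dirac_a :: "real \<Rightarrow> (real \<Rightarrow> complex) \<Rightarrow> complex" where
  "dirac_a \<xi> q = dirac_T \<xi> q $ 1 $ 1"

definition dirac_arg :: "complex \<Rightarrow> (real \<Rightarrow> complex) \<Rightarrow> real" where
  "dirac_arg k q = outer_arg (\<lambda>s. ln (cmod (dirac_a s q))) k"

definition cutoff :: "real \<Rightarrow> real \<Rightarrow> (real \<Rightarrow> complex) \<Rightarrow> real \<Rightarrow> complex" where
  "cutoff T1 T2 q = (\<lambda>x. q x * indicator {T1..T2} x)"

definition dirac_M :: "real \<Rightarrow> (real \<Rightarrow> complex) \<Rightarrow> ereal" where
  "dirac_M \<xi> q =
     Sup {ereal \<bar>dirac_arg k (cutoff T1 T2 q)\<bar> | k T1 T2. k \<in> stolz \<xi> \<and> T1 < T2}"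

definition dirac_Mw :: "real \<Rightarrow> (real \<Rightarrow> complex) \<Rightarrow> ereal" where
  "dirac_Mw \<xi> q =
     Sup {ereal \<bar>dirac_arg (of_real \<xi>) (cutoff T1 T2 q)\<bar> | T1 T2. T1 < T2}"

end

theory Submission
  imports Defs "HOL-Complex_Analysis.Complex_Analysis" "HOL-Real_Asymp.Real_Asymp"
begin

text \<open>
  Let \<open>u = X\<^sub>2\<^sub>2\<close>, \<open>v = X\<^sub>1\<^sub>2\<close> and \<open>w = v / u\<close>. The logarithm of \<open>u\<close> satisfies \<open>(log u)' = - A w\<close>, where \<open>w\<close> solves a
  Riccati equation and \<open>\<bar>w\<bar> \<le> 1\<close> in the closed upper half-plane. For a \<open>C\<^sup>1\<close> coefficient, \<open>log u\<close> decays like \<open>1 / \<bar>k\<bar>\<close>, so by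
  Cauchy's formula its imaginary part is the argument of the outer function.

  Take a chirp \<open>A = g exp (- \<i> \<phi>)\<close>. While the detuning \<open>\<nu> = \<xi> - \<phi>'\<close> is positive and large compared with \<open>g\<close>, two integrations by
  parts show that the argument grows like \<open>\<integral> g\<^sup>2 / \<nu>\<close>, whatever the state at the start. When \<open>\<phi>'\<close> approaches \<open>\<xi>\<close> at speed
  \<open>\<phi>''\<close>, this is of the size \<open>(g\<^sup>2 / \<phi>'') ln (1 / g)\<close>, while the sweep contributes only about \<open>g\<^sup>2 / \<phi>''\<close> to the squared \<open>L\<^sup>2\<close> norm.
  With \<open>\<phi>' = sin \<theta>\<close>, \<open>\<theta> = arsinh (arsinh x)\<close> and \<open>g\<^sup>2 = \<eta>\<^sup>2 \<theta>' / (1 + \<theta>\<^sup>2)\<close> every \<open>\<xi>\<close> in the unit interval is approached infinitely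
  often, the norm is finite, and the logarithm wins. The argument is therefore unbounded on the
  unit interval for every \<open>\<eta> > 0\<close>, which makes the norm as small as desired. For the Dirac equation
  take \<open>q = - cnj A\<close>.
\<close>

subsection \<open>Picard iteration for the Krein system\<close>

text \<open>The gains of successive sweeps are never added up. The growth estimate covers only
  positive detuning well above the amplitude; it says nothing about the passage through resonance,
  nor about the return with negative detuning, where gains may be lost. So one sweep, started from
  an arbitrary state, must beat every prescribed bound, and this dictates the time scale. During the
  sweep near phase angle \<theta> the ratio of the squared amplitude to \<open>\<phi>''\<close> is
  at least of order \<open>1 / \<theta>^2\<close>, the price of square integrability. Since
  \<open>x = sinh (sinh \<theta>)\<close>, the logarithm of the inverse amplitude is about
  \<open>sinh \<theta> / 2\<close>, and the product of the two tends to infinity. With a single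
  arsinh the logarithm would be about \<open>\<theta> / 2\<close> and the product would tend to 0. A
  second obstacle is measurability: \<open>emeasure\<close> is 0 on nonmeasurable sets, where a weak
  type bound would hold for free. The superlevel sets are therefore shown to be Borel, through
  openness of the strict ones.\<close>

lemma integral_has_vector_derivative_atLeast:
  fixes f :: "real \<Rightarrow> 'a::euclidean_space"
  assumes "continuous_on {0..} f" "0 \<le> x"
  shows "((\<lambda>u. integral {0..u} f) has_vector_derivative f x) (at x within {0..})"
proof -
  have eq: "at x within {0..} = at x within {0..x+1}"
    by (rule at_within_nhd[of x "{..<x+1}"]) auto
  have "continuous_on {0..x+1} f"
    using assms(1) by (rule continuous_on_subset) auto
  then show ?thesis
    unfolding eq by (rule integral_has_vector_derivative) (use assms in auto)
qed

lemma continuous_on_integral_atLeast: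
  fixes f :: "real \<Rightarrow> 'a::euclidean_space"
  assumes "continuous_on {0..} f"
  shows "continuous_on {0..} (\<lambda>x. integral {0..x} f)"
  unfolding continuous_on_eq_continuous_within
  by (auto intro!: has_vector_derivative_continuous[OF integral_has_vector_derivative_atLeast[OF assms]])

lemma integrable_on_atLeast:
  fixes f :: "real \<Rightarrow> 'a::euclidean_space"
  assumes "continuous_on {0..} f"
  shows "f integrable_on {0..x}"
  by (rule integrable_continuous_real, rule continuous_on_subset[OF assms]) auto

text \<open>Terms of the Neumann series for the second column of the fundamental matrix, stored as
  the pair of the lower entry and the upper entry. Term 0 is the initial value, so the iteration
  produces single terms rather than partial sums.\<close>

primrec picard :: "(real \<Rightarrow> complex) \<Rightarrow> nat \<Rightarrow> complex \<Rightarrow> real \<Rightarrow> complex \<times> complex" where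
  "picard A 0 k x = (1, 0)"
| "picard A (Suc n) k x =
     (- integral {0..x} (\<lambda>t. A t * snd (picard A n k t)),
      integral {0..x} (\<lambda>t. \<i> * k * snd (picard A n k t) - cnj (A t) * fst (picard A n k t)))"

text \<open>Polynomials in \<open>k\<close> whose coefficients are continuous in \<open>x\<close>
  give continuity in \<open>x\<close> and holomorphy in \<open>k\<close> at once, without
  differentiation under the integral sign. The coefficients are padded by zero beyond degree
  \<open>n\<close> so that the sums of the recursion can be extended to
  \<open>Suc n\<close>.\<close>

lemma picard_polynomial:
  assumes A: "continuous_on {0..} A"
  shows "\<exists>c d. (\<forall>j. continuous_on {0..} (c j) \<and> continuous_on {0..} (d j)) \<and>
           (\<forall>j>n. c j = (\<lambda>_. 0) \<and> d j = (\<lambda>_. 0)) \<and>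
           (\<forall>k. \<forall>x\<ge>0. picard A n k x = (\<Sum>j\<le>n. c j x * k ^ j, \<Sum>j\<le>n. d j x * k ^ j))"
proof (induction n)
  case 0
  show ?case
    by (intro exI[of _ "\<lambda>j x. if j = 0 then 1 else 0"] exI[of _ "\<lambda>j x. 0"])
      (auto intro!: continuous_intros simp: fun_eq_iff)
next
  case (Suc n)
  then obtain c d where cont: "\<And>j. continuous_on {0..} (c j)" "\<And>j. continuous_on {0..} (d j)"
    and zero: "\<And>j. j > n \<Longrightarrow> c j = (\<lambda>_. 0)" "\<And>j. j > n \<Longrightarrow> d j = (\<lambda>_. 0)"
    and eq: "\<And>k x. x \<ge> 0 \<Longrightarrow> picard A n k x = (\<Sum>j\<le>n. c j x * k ^ j, \<Sum>j\<le>n. d j x * k ^ j)"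
    by blast
  define c' where "c' j x = - integral {0..x} (\<lambda>t. A t * d j t)" for j x
  define e where "e j x = integral {0..x} (\<lambda>t. cnj (A t) * c j t)" for j x
  \<comment> \<open>The factor \<open>\<i> * k\<close> in the equation raises the degree by one,
    hence the index shift in the first summand.\<close>
  define d' where "d' j x = (case j of 0 \<Rightarrow> 0 | Suc i \<Rightarrow> \<i> * integral {0..x} (d i)) - e j x" for j x
  have cA: "continuous_on {0..} (\<lambda>t. A t * d j t)" "continuous_on {0..} (\<lambda>t. cnj (A t) * c j t)" for j
    using A cont by (auto intro!: continuous_intros)
  note int = integrable_on_atLeast[OF cA(1)] integrable_on_atLeast[OF cA(2)]
    integrable_on_atLeast[OF cont(2)]
  have "continuous_on {0..} (c' j)" "continuous_on {0..} (e j)" for j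
    unfolding c'_def e_def
    by (intro continuous_intros continuous_on_integral_atLeast cA)+
  moreover have "continuous_on {0..} (d' j)" for j
    unfolding d'_def using \<open>\<And>j. continuous_on {0..} (e j)\<close>
    by (cases j) (auto intro!: continuous_intros continuous_on_integral_atLeast cont)
  moreover have "c' j = (\<lambda>_. 0)" "d' j = (\<lambda>_. 0)" if "j > Suc n" for j
    using that zero[of j] zero[of "j - 1"]
    by (cases j; simp add: c'_def[abs_def] d'_def[abs_def] e_def[abs_def])+
  moreover have "picard A (Suc n) k x = (\<Sum>j\<le>Suc n. c' j x * k ^ j, \<Sum>j\<le>Suc n. d' j x * k ^ j)"
    if "x \<ge> 0" for k x
  proof -
    have "integral {0..x} (\<lambda>t. A t * snd (picard A n k t))
        = integral {0..x} (\<lambda>t. \<Sum>j\<le>n. (A t * d j t) * k ^ j)"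
      by (rule integral_cong) (use that in \<open>auto simp: eq sum_distrib_left mult_ac\<close>)
    also have "\<dots> = (\<Sum>j\<le>n. integral {0..x} (\<lambda>t. A t * d j t) * k ^ j)"
      by (subst integral_sum) (auto intro!: integrable_on_mult_left int)
    also have "\<dots> = - (\<Sum>j\<le>Suc n. c' j x * k ^ j)"
      using zero[of "Suc n"] by (simp add: c'_def sum_negf)
    finally have 1: "fst (picard A (Suc n) k x) = (\<Sum>j\<le>Suc n. c' j x * k ^ j)"
      by simp
    have "integral {0..x} (\<lambda>t. \<i> * k * snd (picard A n k t) - cnj (A t) * fst (picard A n k t))
        = integral {0..x} (\<lambda>t. (\<Sum>j\<le>n. d j t * (\<i> * k ^ Suc j)) - (\<Sum>j\<le>n. (cnj (A t) * c j t) * k ^ j))"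
      by (rule integral_cong) (use that in \<open>auto simp: eq sum_distrib_left mult_ac\<close>)
    also have "\<dots> = (\<Sum>j\<le>n. integral {0..x} (d j) * (\<i> * k ^ Suc j)) - (\<Sum>j\<le>n. e j x * k ^ j)"
      unfolding e_def
      by (subst integral_diff, intro integrable_sum integrable_on_mult_left int finite_atMost,
          intro integrable_sum integrable_on_mult_left int finite_atMost, subst (1 2) integral_sum)
        (auto intro!: integrable_on_mult_left int simp del: power_Suc)
    also have "\<dots> = (\<Sum>j\<le>Suc n. d' j x * k ^ j)"
    proof -
      have "(\<Sum>j\<le>Suc n. (case j of 0 \<Rightarrow> 0 | Suc i \<Rightarrow> \<i> * integral {0..x} (d i)) * k ^ j)
        = (\<Sum>j\<le>n. integral {0..x} (d j) * (\<i> * k ^ Suc j))"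
        by (subst sum.atMost_Suc_shift) (simp add: mult_ac)
      moreover have "(\<Sum>j\<le>Suc n. e j x * k ^ j) = (\<Sum>j\<le>n. e j x * k ^ j)"
        using zero[of "Suc n"] by (simp add: e_def)
      ultimately show ?thesis
        unfolding d'_def left_diff_distrib sum_subtractf by simp
    qed
    finally show ?thesis
      using 1 by (simp add: prod_eq_iff)
  qed
  ultimately show ?case
    by (intro exI[of _ c'] exI[of _ d']) auto
qed

lemma picard_continuous:
  assumes "continuous_on {0..} A"
  shows "continuous_on {0..} (\<lambda>x. fst (picard A n k x))" "continuous_on {0..} (\<lambda>x. snd (picard A n k x))"
proof -
  obtain c d where cont: "\<And>j. continuous_on {0..} (c j)" "\<And>j. continuous_on {0..} (d j)"
    and eq: "\<And>k x. x \<ge> 0 \<Longrightarrow> picard A n k x = (\<Sum>j\<le>n. c j x * k ^ j, \<Sum>j\<le>n. d j x * k ^ j)"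
    using picard_polynomial[OF assms, of n] by blast
  show "continuous_on {0..} (\<lambda>x. fst (picard A n k x))"
    by (rule continuous_on_eq[of _ "\<lambda>x. \<Sum>j\<le>n. c j x * k ^ j"])
      (auto intro!: continuous_intros cont simp: eq)
  show "continuous_on {0..} (\<lambda>x. snd (picard A n k x))"
    by (rule continuous_on_eq[of _ "\<lambda>x. \<Sum>j\<le>n. d j x * k ^ j"])
      (auto intro!: continuous_intros cont simp: eq)
qed

lemma picard_holomorphic:
  assumes "continuous_on {0..} A" "x \<ge> 0"
  shows "(\<lambda>k. fst (picard A n k x)) holomorphic_on UNIV" "(\<lambda>k. snd (picard A n k x)) holomorphic_on UNIV"
proof -
  obtain c d where
    eq: "\<And>k x. x \<ge> 0 \<Longrightarrow> picard A n k x = (\<Sum>j\<le>n. c j x * k ^ j, \<Sum>j\<le>n. d j x * k ^ j)"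
    using picard_polynomial[OF assms(1), of n] by blast
  show "(\<lambda>k. fst (picard A n k x)) holomorphic_on UNIV" "(\<lambda>k. snd (picard A n k x)) holomorphic_on UNIV"
    unfolding eq[OF assms(2)] fst_conv snd_conv by (intro holomorphic_intros)+
qed

lemma has_integral_power_fact:
  fixes C x :: real
  assumes "x \<ge> 0"
  shows "((\<lambda>t. C * ((C * t) ^ n / fact n)) has_integral (C * x) ^ Suc n / fact (Suc n)) {0..x}"
proof -
  have "((\<lambda>t. C * ((C * t) ^ n / fact n)) has_integral
      ((C * x) ^ Suc n / fact (Suc n) - (C * 0) ^ Suc n / fact (Suc n))) {0..x}"
  proof (rule fundamental_theorem_of_calculus[OF assms])
    fix t
    have "((\<lambda>x. (C * x) ^ Suc n / fact (Suc n)) has_real_derivative C * ((C * t) ^ n / fact n)) (at t within {0..x})"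
      by (rule derivative_eq_intros refl | simp)+
    then show "((\<lambda>x. (C * x) ^ Suc n / fact (Suc n)) has_vector_derivative C * ((C * t) ^ n / fact n)) (at t within {0..x})"
      by (simp add: has_real_derivative_iff_has_vector_derivative)
  qed
  then show ?thesis by simp
qed

text \<open>Every integration contributes a factor \<open>C\<close> and one more power of
  \<open>x\<close> divided by its exponent, so both components are dominated by the exponential
  series.\<close>

lemma picard_bound:
  assumes A: "continuous_on {0..} A" and a: "\<And>t. cmod (A t) \<le> a" and C: "a + cmod k \<le> C"
    and x: "x \<ge> 0"
  shows "cmod (fst (picard A n k x)) \<le> (C * x) ^ n / fact n \<and>
         cmod (snd (picard A n k x)) \<le> (C * x) ^ n / fact n"
  using x
proof (induction n arbitrary: x)
  case (Suc n)
  note cont = picard_continuous[OF A, of n k]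
  have a0: "a \<ge> 0" using a[of 0] norm_ge_zero order_trans by blast
  have C0: "C \<ge> 0" using C a0 norm_ge_zero[of k] by linarith
  note int = has_integral_power_fact[OF Suc.prems, of C n]
  have "norm (integral {0..x} (\<lambda>t. A t * snd (picard A n k t)))
    \<le> integral {0..x} (\<lambda>t. C * ((C * t) ^ n / fact n))"
  proof (rule integral_norm_bound_integral)
    show "(\<lambda>t. A t * snd (picard A n k t)) integrable_on {0..x}"
      by (rule integrable_on_atLeast) (intro continuous_intros A cont)
    show "(\<lambda>t. C * ((C * t) ^ n / fact n)) integrable_on {0..x}"
      using int by blast
    fix t assume "t \<in> {0..x}"
    then show "norm (A t * snd (picard A n k t)) \<le> C * ((C * t) ^ n / fact n)"
      unfolding norm_mult
      by (intro mult_mono) (use Suc.IH[of t] order_trans[OF a[of t], of C] C C0 norm_ge_zero[of k] in auto)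
  qed
  moreover have "norm (integral {0..x} (\<lambda>t. \<i> * k * snd (picard A n k t) - cnj (A t) * fst (picard A n k t)))
    \<le> integral {0..x} (\<lambda>t. C * ((C * t) ^ n / fact n))"
  proof (rule integral_norm_bound_integral)
    show "(\<lambda>t. \<i> * k * snd (picard A n k t) - cnj (A t) * fst (picard A n k t)) integrable_on {0..x}"
      by (rule integrable_on_atLeast) (intro continuous_intros A cont)
    show "(\<lambda>t. C * ((C * t) ^ n / fact n)) integrable_on {0..x}"
      using int by blast
    fix t assume t: "t \<in> {0..x}"
    let ?b = "(C * t) ^ n / fact n"
    have "norm (\<i> * k * snd (picard A n k t) - cnj (A t) * fst (picard A n k t))
      \<le> norm (\<i> * k * snd (picard A n k t)) + norm (cnj (A t) * fst (picard A n k t))"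
      by (rule norm_triangle_ineq4)
    also have "\<dots> \<le> cmod k * ?b + a * ?b"
      unfolding norm_mult using Suc.IH[of t] a[of t] t a0
      by (intro add_mono mult_mono) auto
    also have "\<dots> \<le> C * ?b"
      unfolding distrib_right[symmetric] using C C0 t by (intro mult_right_mono) auto
    finally show "norm (\<i> * k * snd (picard A n k t) - cnj (A t) * fst (picard A n k t)) \<le> C * ?b" .
  qed
  ultimately show ?case
    using integral_unique[OF int] by (simp del: power_Suc fact_Suc)
qed simp

definition krein_u :: "(real \<Rightarrow> complex) \<Rightarrow> complex \<Rightarrow> real \<Rightarrow> complex" where
  "krein_u A k x = (\<Sum>n. fst (picard A n k x))"

definition krein_v :: "(real \<Rightarrow> complex) \<Rightarrow> complex \<Rightarrow> real \<Rightarrow> complex" where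
  "krein_v A k x = (\<Sum>n. snd (picard A n k x))"

text \<open>For such coefficients the solution is classically differentiable, so ordinary calculus
  applies; uniqueness identifies it later with the Caratheodory solution of the definitions.\<close>

locale bounded_continuous =
  fixes A :: "real \<Rightarrow> complex" and a :: real
  assumes cont_A: "continuous_on UNIV A" and bound_A: "\<And>t. cmod (A t) \<le> a"
begin

abbreviation "u \<equiv> krein_u A"
abbreviation "v \<equiv> krein_v A"

lemma cont_A': "continuous_on S A"
  using cont_A continuous_on_subset by blast

lemma a_nonneg: "a \<ge> 0"
  using bound_A[of 0] norm_ge_zero order_trans by blast

lemma summable_exp: "summable (\<lambda>n. (y::real) ^ n / fact n)"
  using summable_exp_generic[of y] by (simp add: field_simps)

lemma picard_summable:
  assumes "x \<ge> 0"
  shows "summable (\<lambda>n. fst (picard A n k x))" "summable (\<lambda>n. snd (picard A n k x))"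
  by (rule summable_comparison_test'[OF summable_exp[of "(a + cmod k) * x"]],
      use picard_bound[OF cont_A' bound_A order_refl assms] in blast)+

lemma partial_sum_bound:
  assumes "0 \<le> x" "x \<le> R"
  shows "cmod (\<Sum>n<N. fst (picard A n k x)) \<le> exp ((a + cmod k) * R)"
        "cmod (\<Sum>n<N. snd (picard A n k x)) \<le> exp ((a + cmod k) * R)"
proof -
  let ?C = "a + cmod k"
  have C: "?C \<ge> 0" using a_nonneg by simp
  have "(\<Sum>n<N. (?C * x) ^ n / fact n) \<le> (\<Sum>n. (?C * x) ^ n / fact n)"
    by (rule sum_le_suminf[OF summable_exp]) (use C assms in auto)
  also have "\<dots> = exp (?C * x)" by (simp add: exp_def field_simps)
  also have "\<dots> \<le> exp (?C * R)" using C assms by (simp add: mult_left_mono)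
  finally have le: "(\<Sum>n<N. (?C * x) ^ n / fact n) \<le> exp (?C * R)" .
  note b = picard_bound[OF cont_A' bound_A order_refl assms(1)]
  show "cmod (\<Sum>n<N. fst (picard A n k x)) \<le> exp ((a + cmod k) * R)"
        "cmod (\<Sum>n<N. snd (picard A n k x)) \<le> exp ((a + cmod k) * R)"
    by (rule order_trans[OF order_trans[OF sum_norm_le le]], use b in auto)+
qed

lemma partial_sums:
  assumes "x \<ge> 0"
  shows "(\<lambda>N. \<Sum>n<N. fst (picard A n k x)) \<longlonglongrightarrow> u k x" "(\<lambda>N. \<Sum>n<N. snd (picard A n k x)) \<longlonglongrightarrow> v k x"
  unfolding krein_u_def krein_v_def using picard_summable[OF assms] by (auto intro: summable_LIMSEQ)

text \<open>The partial sums satisfy these equations up to an index shift and are bounded on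
  \<open>{0..x}\<close> uniformly in their length, so dominated convergence applies. It also
  delivers integrability of the limits, whose continuity is not yet known and is deduced from these
  equations afterwards.\<close>

lemma krein_integral_equations:
  assumes x: "x \<ge> 0"
  shows "u k x = 1 - integral {0..x} (\<lambda>t. A t * v k t)" (is ?th1)
    and "v k x = integral {0..x} (\<lambda>t. \<i> * k * v k t - cnj (A t) * u k t)" (is ?th2)
    and "(\<lambda>t. A t * v k t) integrable_on {0..x}" (is ?th3)
    and "(\<lambda>t. \<i> * k * v k t - cnj (A t) * u k t) integrable_on {0..x}" (is ?th4)
proof -
  define E where "E = exp ((a + cmod k) * x)"
  note cont = picard_continuous[OF cont_A']
  let ?U = "\<lambda>N t. \<Sum>n<N. fst (picard A n k t)" and ?V = "\<lambda>N t. \<Sum>n<N. snd (picard A n k t)"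
  have int1: "(\<lambda>t. A t * snd (picard A n k t)) integrable_on {0..x}" for n
    by (intro integrable_on_atLeast continuous_intros cont cont_A')
  have int2: "(\<lambda>t. \<i> * k * snd (picard A n k t) - cnj (A t) * fst (picard A n k t)) integrable_on {0..x}" for n
    by (intro integrable_on_atLeast continuous_intros cont cont_A')
  \<comment> \<open>Integrating the terms below \<open>N\<close> gives the terms from 1 to
    \<open>N\<close>; the term of index 0 supplies the initial value.\<close>
  have 1: "?U (Suc N) x = 1 - integral {0..x} (\<lambda>t. A t * ?V N t)" for N
    unfolding sum.lessThan_Suc_shift sum_distrib_left
    by (subst integral_sum) (auto intro!: int1 simp: sum_negf)
  have 2: "?V (Suc N) x = integral {0..x} (\<lambda>t. \<i> * k * ?V N t - cnj (A t) * ?U N t)" for N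
    unfolding sum.lessThan_Suc_shift sum_distrib_left sum_subtractf[symmetric]
    by (subst integral_sum) (auto intro!: int2)
  have i1: "(\<lambda>t. A t * ?V N t) integrable_on {0..x}"
    and i2: "(\<lambda>t. \<i> * k * ?V N t - cnj (A t) * ?U N t) integrable_on {0..x}" for N
    by (intro integrable_on_atLeast continuous_intros cont cont_A')+
  have b1: "norm (A t * ?V N t) \<le> a * E"
    and b2: "norm (\<i> * k * ?V N t - cnj (A t) * ?U N t) \<le> cmod k * E + a * E"
    if "t \<in> {0..x}" for N t
  proof -
    have "cmod (?U N t) \<le> E" "cmod (?V N t) \<le> E"
      unfolding E_def using that partial_sum_bound[of t x k N] by auto
    then show "norm (A t * ?V N t) \<le> a * E"
      and "norm (\<i> * k * ?V N t - cnj (A t) * ?U N t) \<le> cmod k * E + a * E"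
      using a_nonneg bound_A[of t]
      by (auto simp: norm_mult intro!: mult_mono order_trans[OF norm_triangle_ineq4] add_mono)
  qed
  have l1: "(\<lambda>N. A t * ?V N t) \<longlonglongrightarrow> A t * v k t"
    and l2: "(\<lambda>N. \<i> * k * ?V N t - cnj (A t) * ?U N t) \<longlonglongrightarrow> \<i> * k * v k t - cnj (A t) * u k t"
    if "t \<in> {0..x}" for t
    using that by (auto intro!: tendsto_intros partial_sums)
  note L1 = dominated_convergence[of "\<lambda>N t. A t * ?V N t", OF i1 _ b1 l1, OF integrable_const_ivl]
  note L2 = dominated_convergence[of "\<lambda>N t. \<i> * k * ?V N t - cnj (A t) * ?U N t", OF i2 _ b2 l2, OF integrable_const_ivl]
  show ?th3 ?th4 using L1 L2 by auto
  have "(\<lambda>N. ?U (Suc N) x) \<longlonglongrightarrow> 1 - integral {0..x} (\<lambda>t. A t * v k t)"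
    unfolding 1 using L1 by (intro tendsto_intros) auto
  moreover have "(\<lambda>N. ?U (Suc N) x) \<longlonglongrightarrow> u k x"
    using partial_sums(1)[OF x] by (subst filterlim_sequentially_Suc)
  ultimately show ?th1 by (rule LIMSEQ_unique[symmetric])
  have "(\<lambda>N. ?V (Suc N) x) \<longlonglongrightarrow> integral {0..x} (\<lambda>t. \<i> * k * v k t - cnj (A t) * u k t)"
    unfolding 2 using L2 by auto
  moreover have "(\<lambda>N. ?V (Suc N) x) \<longlonglongrightarrow> v k x"
    using partial_sums(2)[OF x] by (subst filterlim_sequentially_Suc)
  ultimately show ?th2 by (rule LIMSEQ_unique[symmetric])
qed

lemma continuous_uv: "continuous_on {0..} (u k)" "continuous_on {0..} (v k)"
proof -
  have *: "continuous_on {0..} f"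
    if "\<And>R. R > 0 \<Longrightarrow> continuous_on {0..R} f" for f :: "real \<Rightarrow> complex"
    unfolding continuous_on_eq_continuous_within
  proof
    fix x :: real assume "x \<in> {0..}"
    then have "continuous (at x within {0..x+1}) f"
      using that[of "x+1"] by (auto simp: continuous_on_eq_continuous_within)
    moreover have "at x within {0..} = at x within {0..x+1}"
      by (rule at_within_nhd[of x "{..<x+1}"]) auto
    ultimately show "continuous (at x within {0..}) f" by simp
  qed
  show "continuous_on {0..} (u k)"
  proof (rule *)
    fix R :: real assume "R > 0"
    then have "continuous_on {0..R} (\<lambda>x. 1 - integral {0..x} (\<lambda>t. A t * v k t))"
      by (intro continuous_intros indefinite_integral_continuous_1 krein_integral_equations) auto
    then show "continuous_on {0..R} (u k)"
      by (rule continuous_on_eq) (simp add: krein_integral_equations(1))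
  qed
  show "continuous_on {0..} (v k)"
  proof (rule *)
    fix R :: real assume "R > 0"
    then have "continuous_on {0..R} (\<lambda>x. integral {0..x} (\<lambda>t. \<i> * k * v k t - cnj (A t) * u k t))"
      by (intro indefinite_integral_continuous_1 krein_integral_equations) auto
    then show "continuous_on {0..R} (v k)"
      by (rule continuous_on_eq) (simp add: krein_integral_equations(2))
  qed
qed

lemma has_vector_derivative_uv:
  assumes "x \<ge> 0"
  shows "(u k has_vector_derivative - A x * v k x) (at x within {0..})"
        "(v k has_vector_derivative \<i> * k * v k x - cnj (A x) * u k x) (at x within {0..})"
proof -
  have "((\<lambda>x. 1 - integral {0..x} (\<lambda>t. A t * v k t)) has_vector_derivative 0 - A x * v k x) (at x within {0..})"
    by (intro derivative_intros integral_has_vector_derivative_atLeast[of "\<lambda>t. A t * v k t"]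
        continuous_intros cont_A' continuous_uv assms)
  then have "((\<lambda>x. 1 - integral {0..x} (\<lambda>t. A t * v k t)) has_vector_derivative - A x * v k x) (at x within {0..})"
    by simp
  then show "(u k has_vector_derivative - A x * v k x) (at x within {0..})"
    by (rule has_vector_derivative_transform[rotated 2]) (use assms krein_integral_equations(1) in auto)
  have "((\<lambda>x. integral {0..x} (\<lambda>t. \<i> * k * v k t - cnj (A t) * u k t)) has_vector_derivative
       \<i> * k * v k x - cnj (A x) * u k x) (at x within {0..})"
    by (intro integral_has_vector_derivative_atLeast[of "\<lambda>t. \<i> * k * v k t - cnj (A t) * u k t"]
        continuous_intros cont_A' continuous_uv assms)
  then show "(v k has_vector_derivative \<i> * k * v k x - cnj (A x) * u k x) (at x within {0..})"
    by (rule has_vector_derivative_transform[rotated 2]) (use assms krein_integral_equations(2) in auto)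
qed

lemma u_0 [simp]: "u k 0 = 1" and v_0 [simp]: "v k 0 = 0"
  using krein_integral_equations(1,2)[of 0 k] by auto

lemma holomorphic_uv:
  assumes "x \<ge> 0"
  shows "(\<lambda>k. u k x) holomorphic_on UNIV" "(\<lambda>k. v k x) holomorphic_on UNIV"
proof -
  have ul: "uniform_limit (cball z 1) (\<lambda>N k. \<Sum>n<N. f n k) (\<lambda>k. \<Sum>n. f n k) sequentially"
    if "\<And>n k. cmod (f n k) \<le> ((a + cmod k) * x) ^ n / fact n"
    for f :: "nat \<Rightarrow> complex \<Rightarrow> complex" and z
  proof (rule Weierstrass_m_test[OF _ summable_exp[of "(a + (cmod z + 1)) * x"]])
    fix n k assume "k \<in> cball z 1"
    then have "cmod k \<le> cmod z + 1"
      by (smt (verit) mem_cball dist_norm norm_minus_commute norm_triangle_ineq2)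
    then have "((a + cmod k) * x) ^ n / fact n \<le> ((a + (cmod z + 1)) * x) ^ n / fact n"
      using a_nonneg assms by (intro divide_right_mono power_mono mult_right_mono) auto
    then show "norm (f n k) \<le> ((a + (cmod z + 1)) * x) ^ n / fact n"
      using that order_trans by blast
  qed
  note b = picard_bound[OF cont_A' bound_A order_refl assms]
  note hol = picard_holomorphic[OF cont_A' assms]
  have "(\<lambda>k. \<Sum>n. fst (picard A n k x)) holomorphic_on UNIV"
    by (rule holomorphic_uniform_sequence[where f="\<lambda>N k. \<Sum>n<N. fst (picard A n k x)"])
      (use b in \<open>auto intro!: holomorphic_intros hol exI[of _ 1] ul\<close>)
  then show "(\<lambda>k. u k x) holomorphic_on UNIV" by (simp add: krein_u_def)
  have "(\<lambda>k. \<Sum>n. snd (picard A n k x)) holomorphic_on UNIV"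
    by (rule holomorphic_uniform_sequence[where f="\<lambda>N k. \<Sum>n<N. snd (picard A n k x)"])
      (use b in \<open>auto intro!: holomorphic_intros hol exI[of _ 1] ul\<close>)
  then show "(\<lambda>k. v k x) holomorphic_on UNIV" by (simp add: krein_v_def)
qed

end

subsection \<open>Half-plane representation of decaying functions\<close>

text \<open>An improper fundamental theorem of calculus in which nonnegativity supplies
  integrability. It serves the dominating function \<open>1 / (1 + x^2)\<close> and later the
  squared modulus of the chirp.\<close>

lemma integral_nonneg_derivative:
  fixes f F :: "real \<Rightarrow> real"
  assumes F: "\<And>x. (F has_real_derivative f x) (at x)" and f: "continuous_on UNIV f" "\<And>x. f x \<ge> 0"
    and lim: "(F \<longlongrightarrow> l) at_bot" "(F \<longlongrightarrow> r) at_top"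
  shows "integrable lborel f" "(LINT x|lborel. f x) = r - l"
proof -
  have c: "isCont f x" for x
    using f(1) by (simp add: continuous_on_eq_continuous_at)
  have "((F \<circ> real_of_ereal) \<longlongrightarrow> l) (at_right (-\<infinity>))" "((F \<circ> real_of_ereal) \<longlongrightarrow> r) (at_left \<infinity>)"
    using lim by (simp_all add: ereal_tendsto_simps)
  note * = interval_integral_FTC_nonneg[of "-\<infinity>" \<infinity>, OF _ F c _ this]
  show "integrable lborel f"
    using *(1) f(2) by (simp add: set_integrable_def)
  show "(LINT x|lborel. f x) = r - l"
    using *(2) f(2) by (simp add: interval_lebesgue_integral_def set_lebesgue_integral_def)
qed

lemma integrable_inverse_1_plus_square: "integrable lborel (\<lambda>x::real. 1 / (1 + x\<^sup>2))"
proof (rule integral_nonneg_derivative(1)[OF _ _ _ tendsto_arctan_at_bot tendsto_arctan_at_top])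
  show "(arctan has_real_derivative 1 / (1 + x\<^sup>2)) (at x)" for x
    using DERIV_arctan[of x] by (simp add: divide_inverse)
  show "continuous_on UNIV (\<lambda>x::real. 1 / (1 + x\<^sup>2))"
    by (intro continuous_intros) (metis add_nonneg_eq_0_iff zero_le_one zero_le_power2 zero_neq_one)
qed auto

text \<open>The rectangles stand on the real axis. Their other three sides have total length
  \<open>4 * R\<close> and the integrand there is of order \<open>1 / R^2\<close>, so only the base
  survives in the limit.\<close>

lemma real_integral_from_rectangles:
  fixes f :: "complex \<Rightarrow> complex"
  assumes contour: "\<And>R. R \<ge> R0 \<Longrightarrow> (f has_contour_integral I) (rectpath (- of_real R) (Complex R R))"
    and far: "\<And>z. Im z \<ge> 0 \<Longrightarrow> cmod z \<ge> R0 \<Longrightarrow> cmod (f z) \<le> K / (1 + (cmod z)\<^sup>2)"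
    and line: "continuous_on UNIV (\<lambda>s. f (of_real s))" "\<And>s::real. cmod (f (of_real s)) \<le> K / (1 + s\<^sup>2)"
  shows "integrable lebesgue (\<lambda>s. f (of_real s))" "(LINT s|lebesgue. f (of_real s)) = I"
proof -
  have int: "integrable lborel (\<lambda>s. f (of_real s))"
  proof (rule Bochner_Integration.integrable_bound)
    show "integrable lborel (\<lambda>s. K * (1 / (1 + s\<^sup>2)))"
      using integrable_inverse_1_plus_square by (rule integrable_mult_right)
    show "(\<lambda>s. f (of_real s)) \<in> borel_measurable lborel"
      using line(1) by (simp add: borel_measurable_continuous_onI)
    have "K \<ge> 0" using order_trans[OF norm_ge_zero line(2)[of 0]] by simp
    then show "AE s in lborel. norm (f (of_real s)) \<le> norm (K * (1 / (1 + s\<^sup>2)))"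
      using line(2) by simp
  qed
  have meas: "(\<lambda>s. f (of_real s)) \<in> borel_measurable lborel" using int by auto
  show int': "integrable lebesgue (\<lambda>s. f (of_real s))"
    using int meas by (simp add: integrable_completion)
  define J where "J n = integral {- real n..real n} (\<lambda>s. f (of_real s))" for n
  have cont_line: "continuous_on S (\<lambda>s. f (of_real s))" for S
    using line(1) continuous_on_subset by blast
  have JL: "J n = (LINT s|lebesgue. indicator {- real n..real n} s *\<^sub>R f (of_real s))" for n
    unfolding J_def
    using set_lebesgue_integral_eq_integral(2)[OF absolutely_integrable_continuous_real[OF cont_line, of "- real n" "real n"]]
    by (simp add: set_lebesgue_integral_def)
  have lim1: "J \<longlonglongrightarrow> (LINT s|lebesgue. f (of_real s))"
    unfolding JL
  proof (rule integral_dominated_convergence[where w="\<lambda>s. norm (f (of_real s))"])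
    show "(\<lambda>s. f (of_real s)) \<in> borel_measurable lebesgue" using int' by auto
    then show "(\<lambda>s. indicator {- real n..real n} s *\<^sub>R f (of_real s)) \<in> borel_measurable lebesgue" for n
      by (intro borel_measurable_scaleR borel_measurable_indicator) auto
    show "AE s in lebesgue. (\<lambda>n. indicator {- real n..real n} s *\<^sub>R f (of_real s)) \<longlonglongrightarrow> f (of_real s)"
    proof (rule AE_I2)
      fix s :: real
      obtain N where "\<bar>s\<bar> \<le> real N" using real_arch_simple by blast
      then have "eventually (\<lambda>n. indicator {- real n..real n} s *\<^sub>R f (of_real s) = f (of_real s)) sequentially"
        unfolding eventually_sequentially by (intro exI[of _ N]) (auto simp: indicator_def)
      then show "(\<lambda>n. indicator {- real n..real n} s *\<^sub>R f (of_real s)) \<longlonglongrightarrow> f (of_real s)"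
        by (rule tendsto_eventually)
    qed
    show "AE s in lebesgue. norm (indicator {- real n..real n} s *\<^sub>R f (of_real s)) \<le> norm (f (of_real s))" for n
      by (auto simp: indicator_def)
  qed (use int' in auto)
  \<comment> \<open>On the three upper sides \<open>cmod z \<ge> r\<close>, which gives
    \<open>4 * r * K / (1 + r^2)\<close>.\<close>
  have est: "cmod (I - J n) \<le> 4 * K / real n" if n: "real n \<ge> max 1 R0" for n
  proof -
    define r where "r = real n"
    have r: "r \<ge> 1" "r \<ge> R0" using n by (auto simp: r_def)
    have K: "K \<ge> 0" using order_trans[OF norm_ge_zero line(2)[of 0]] by simp
    have path: "rectpath (- of_real r) (Complex r r) =
      linepath (- of_real r) (of_real r) +++ linepath (of_real r) (Complex r r) +++
      linepath (Complex r r) (Complex (- r) r) +++ linepath (Complex (- r) r) (- of_real r)"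
      by (simp add: rectpath_def Let_def complex_of_real_def)
    have fI: "(f has_contour_integral I) (rectpath (- of_real r) (Complex r r))"
      using contour r by blast
    then have ci: "f contour_integrable_on (rectpath (- of_real r) (Complex r r))"
      by (auto simp: contour_integrable_on_def)
    let ?a = "linepath (- complex_of_real r) (of_real r)" and ?b = "linepath (of_real r) (Complex r r)"
      and ?c = "linepath (Complex r r) (Complex (- r) r)" and ?d = "linepath (Complex (- r) r) (- of_real r)"
    have ab: "f contour_integrable_on ?a" "f contour_integrable_on ?b" "f contour_integrable_on ?c"
      "f contour_integrable_on ?d"
      using ci unfolding path by (auto simp: valid_path_join)
    have "I = contour_integral ?a f + (contour_integral ?b f + (contour_integral ?c f + contour_integral ?d f))"
      using contour_integral_unique[OF fI] ab unfolding path
      by (simp add: contour_integral_join valid_path_join)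
    moreover have "contour_integral ?a f = J n"
      using contour_integral_linepath_Reals_eq[of "- complex_of_real r" "of_real r" f] r
      by (simp add: J_def r_def)
    moreover have B: "cmod (contour_integral (linepath p q) f) \<le> K / (1 + r\<^sup>2) * cmod (q - p)"
      if "f contour_integrable_on (linepath p q)" "\<And>z. z \<in> closed_segment p q \<Longrightarrow> Im z \<ge> 0 \<and> cmod z \<ge> r" for p q
    proof (rule contour_integral_bound_linepath[OF that(1)])
      show "0 \<le> K / (1 + r\<^sup>2)" using K by (simp add: add_nonneg_pos)
      fix z assume "z \<in> closed_segment p q"
      then have z: "Im z \<ge> 0" "cmod z \<ge> r" using that(2) by auto
      then have "cmod (f z) \<le> K / (1 + (cmod z)\<^sup>2)" using far r by auto
      also have "\<dots> \<le> K / (1 + r\<^sup>2)"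
        using z r K by (intro divide_left_mono add_left_mono power_mono) (auto intro!: mult_pos_pos add_pos_nonneg)
      finally show "norm (f z) \<le> K / (1 + r\<^sup>2)" .
    qed
    have cm: "cmod z \<ge> r" if "\<bar>Re z\<bar> = r \<or> \<bar>Im z\<bar> = r" for z
      using that abs_Re_le_cmod[of z] abs_Im_le_cmod[of z] by auto
    have "cmod (contour_integral ?b f) \<le> K / (1 + r\<^sup>2) * cmod (Complex r r - of_real r)"
      by (rule B[OF ab(2)]) (use r in \<open>auto simp: closed_segment_same_Re closed_segment_eq_real_ivl intro!: cm\<close>)
    moreover have "cmod (contour_integral ?c f) \<le> K / (1 + r\<^sup>2) * cmod (Complex (- r) r - Complex r r)"
      by (rule B[OF ab(3)]) (use r in \<open>auto simp: closed_segment_same_Im closed_segment_eq_real_ivl intro!: cm\<close>)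
    moreover have "cmod (contour_integral ?d f) \<le> K / (1 + r\<^sup>2) * cmod (- of_real r - Complex (- r) r)"
      by (rule B[OF ab(4)]) (use r in \<open>auto simp: closed_segment_same_Re closed_segment_eq_real_ivl intro!: cm\<close>)
    moreover have "cmod (Complex r r - of_real r) = r" "cmod (Complex (- r) r - Complex r r) = 2 * r"
      "cmod (- of_real r - Complex (- r) r) = r"
      using r by (auto simp: cmod_def real_sqrt_mult)
    ultimately have "cmod (I - J n) \<le> K / (1 + r\<^sup>2) * r + (K / (1 + r\<^sup>2) * (2 * r) + K / (1 + r\<^sup>2) * r)"
      by (smt (verit) add_diff_cancel_left' norm_triangle_ineq)
    also have "\<dots> = 4 * K * r / (1 + r\<^sup>2)" by (simp add: field_simps)
    also have "\<dots> \<le> 4 * K / r"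
      using r K by (simp add: field_simps power2_eq_square add_pos_nonneg)
    finally show ?thesis unfolding r_def .
  qed
  have "(\<lambda>n. I - J n) \<longlonglongrightarrow> 0"
  proof (rule Lim_null_comparison)
    obtain N :: nat where "max 1 R0 \<le> real N" using real_arch_simple by blast
    then show "\<forall>\<^sub>F n in sequentially. norm (I - J n) \<le> 4 * K / real n"
      unfolding eventually_sequentially using est by (intro exI[of _ N]) auto
    show "(\<lambda>n. 4 * K / real n) \<longlonglongrightarrow> 0"
      using tendsto_mult[OF tendsto_const[of "4 * K"] lim_1_over_n] by simp
  qed
  then have "(\<lambda>n. I - (I - J n)) \<longlonglongrightarrow> I - 0" by (intro tendsto_intros)
  then show "(LINT s|lebesgue. f (of_real s)) = I"
    using LIMSEQ_unique[OF lim1] by simp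
qed

lemma real_line_Cauchy_bound:
  fixes F :: "complex \<Rightarrow> complex"
  assumes F: "\<And>z. Im z \<ge> 0 \<Longrightarrow> cmod (F z) \<le> C / (1 + cmod z)" and p: "Im p \<noteq> 0"
  obtains K R0 where "R0 > cmod p"
    "\<And>z. Im z \<ge> 0 \<Longrightarrow> cmod z \<ge> R0 \<Longrightarrow> cmod (F z / (z - p)) \<le> K / (1 + (cmod z)\<^sup>2)"
    "\<And>s::real. cmod (F (of_real s) / (of_real s - p)) \<le> K / (1 + s\<^sup>2)"
proof -
  have C: "C \<ge> 0" using order_trans[OF norm_ge_zero F[of 0]] by simp
  \<comment> \<open>One constant with \<open>1 + cmod z \<le> c * cmod (z - p)\<close> in both
    regimes: 4 is enough far from the pole, and the other entry is enough on the real axis, where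
    the distance to \<open>p\<close> is at least \<open>\<bar>Im p\<bar>\<close>.\<close>
  define c where "c = max 4 (1 + (1 + cmod p) / \<bar>Im p\<bar>)"
  have *: "cmod (F z / (z - p)) \<le> C * c / (1 + (cmod z)\<^sup>2)"
    if "Im z \<ge> 0" "1 + cmod z \<le> c * cmod (z - p)" for z
  proof -
    have pos: "cmod (z - p) > 0" using that(2) norm_ge_zero[of z] by (smt (verit) mult_eq_0_iff norm_ge_zero)
    have "cmod (F z / (z - p)) \<le> (C / (1 + cmod z)) / cmod (z - p)"
      unfolding norm_divide using F[OF that(1)] by (intro divide_right_mono) auto
    also have "\<dots> \<le> (C / (1 + cmod z)) / ((1 + cmod z) / c)"
      using that(2) pos C by (intro divide_left_mono) (auto simp: c_def field_simps add_pos_nonneg)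
    also have "\<dots> = C * c / (1 + cmod z)\<^sup>2" by (simp add: power2_eq_square)
    also have "\<dots> \<le> C * c / (1 + (cmod z)\<^sup>2)"
      using C by (intro divide_left_mono) (auto simp: power2_eq_square algebra_simps c_def add_pos_nonneg intro!: mult_pos_pos)
    finally show ?thesis .
  qed
  show ?thesis
  proof (rule that[of "2 * cmod p + 1" "C * c"])
    show "2 * cmod p + 1 > cmod p" by (smt (verit) norm_ge_zero)
    fix z assume z: "Im z \<ge> 0" "cmod z \<ge> 2 * cmod p + 1"
    have "cmod (z - p) \<ge> cmod z - cmod p" by (rule norm_triangle_ineq2)
    then have "1 + cmod z \<le> 4 * cmod (z - p)" using z norm_ge_zero[of p] by linarith
    also have "\<dots> \<le> c * cmod (z - p)" by (intro mult_right_mono) (auto simp: c_def)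
    finally show "cmod (F z / (z - p)) \<le> C * c / (1 + (cmod z)\<^sup>2)" using * z by blast
  next
    fix s :: real
    have "\<bar>Im p\<bar> \<le> cmod (of_real s - p)" using abs_Im_le_cmod[of "of_real s - p"] by simp
    then have 1: "1 + cmod p \<le> (1 + cmod p) / \<bar>Im p\<bar> * cmod (of_real s - p)"
      using p by (simp add: field_simps add_mono mult_left_mono)
    have "cmod (of_real s) \<le> cmod (of_real s - p) + cmod p" by (metis diff_add_cancel norm_triangle_ineq)
    then have "1 + cmod (of_real s) \<le> (1 + (1 + cmod p) / \<bar>Im p\<bar>) * cmod (of_real s - p)"
      using 1 by (simp add: distrib_right)
    also have "\<dots> \<le> c * cmod (of_real s - p)" by (intro mult_right_mono) (auto simp: c_def)
    finally show "cmod (F (of_real s) / (of_real s - p)) \<le> C * c / (1 + s\<^sup>2)" using *[of "of_real s"] by simp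
  qed
qed

lemma interior_closed_upper_half_plane: "interior {z. Im z \<ge> 0} = {z. Im z > 0}"
  using interior_halfspace_ge[of \<i> 0] by (simp add: inner_complex_def)

context
  fixes F :: "complex \<Rightarrow> complex" and C :: real
  assumes cont: "continuous_on {z. Im z \<ge> 0} F" and hol: "F holomorphic_on {z. Im z > 0}"
    and decay: "\<And>z. Im z \<ge> 0 \<Longrightarrow> cmod (F z) \<le> C / (1 + cmod z)"
begin

lemma continuous_on_real_line: "continuous_on UNIV (\<lambda>s. F (complex_of_real s))"
  by (rule continuous_on_compose2[OF cont]) (auto intro!: continuous_intros)

lemma differentiable_upper_half_plane: "Im z > 0 \<Longrightarrow> F field_differentiable at z"
  using hol by (simp add: holomorphic_on_open field_differentiable_def open_halfspace_Im_gt)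

text \<open>The pole lies inside all large rectangles. The Cauchy formula is taken on the closed
  half-plane, where continuity up to the boundary is enough; this matters because the base of the
  contour lies on that boundary.\<close>

lemma real_line_Cauchy_upper:
  assumes p: "Im p > 0"
  shows "integrable lebesgue (\<lambda>s. F (of_real s) / (of_real s - p))"
    and "(LINT s|lebesgue. F (of_real s) / (of_real s - p)) = 2 * pi * \<i> * F p"
proof -
  obtain K R0 where R0: "R0 > cmod p"
    and far: "\<And>z. Im z \<ge> 0 \<Longrightarrow> cmod z \<ge> R0 \<Longrightarrow> cmod (F z / (z - p)) \<le> K / (1 + (cmod z)\<^sup>2)"
    and line: "\<And>s::real. cmod (F (of_real s) / (of_real s - p)) \<le> K / (1 + s\<^sup>2)"
    using real_line_Cauchy_bound[OF decay, of p] p by (metis less_irrefl)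
  have contour: "((\<lambda>w. F w / (w - p)) has_contour_integral 2 * pi * \<i> * F p) (rectpath (- of_real R) (Complex R R))"
    if R: "R \<ge> R0" for R
  proof -
    have Rp: "R > 0" "\<bar>Re p\<bar> < R" "Im p < R"
      using R R0 abs_Re_le_cmod[of p] abs_Im_le_cmod[of p] norm_ge_zero[of p] by linarith+
    have box: "p \<in> box (- of_real R) (Complex R R)"
      using Rp p by (auto simp: in_box_complex_iff)
    have img: "path_image (rectpath (- of_real R) (Complex R R))
        = cbox (- of_real R) (Complex R R) - box (- of_real R) (Complex R R)"
      using Rp by (intro path_image_rectpath_cbox_minus_box) auto
    have contour: "((\<lambda>w. F w / (w - p)) has_contour_integral
        2 * pi * \<i> * winding_number (rectpath (- of_real R) (Complex R R)) p * F p) (rectpath (- of_real R) (Complex R R))"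
      by (rule Cauchy_integral_formula_convex[where S="{z. Im z \<ge> 0}" and K="{}"])
        (use box p in \<open>auto simp: interior_closed_upper_half_plane convex_halfspace_Im_ge img in_cbox_complex_iff cont differentiable_upper_half_plane\<close>)
    then show ?thesis by (simp add: winding_number_rectpath[OF box])
  qed
  moreover have "continuous_on UNIV (\<lambda>s. F (complex_of_real s) / (of_real s - p))"
    using p by (intro continuous_intros continuous_on_real_line) (auto simp: complex_eq_iff)
  ultimately show "integrable lebesgue (\<lambda>s. F (of_real s) / (of_real s - p))"
    and "(LINT s|lebesgue. F (of_real s) / (of_real s - p)) = 2 * pi * \<i> * F p"
    using real_integral_from_rectangles[OF contour far _ line] by blast+
qed

text \<open>The pole is outside the half-plane, so the integrand is holomorphic in it and every
  contour integral vanishes.\<close>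

lemma real_line_Cauchy_lower:
  assumes p: "Im p < 0"
  shows "integrable lebesgue (\<lambda>s. F (of_real s) / (of_real s - p))"
    and "(LINT s|lebesgue. F (of_real s) / (of_real s - p)) = 0"
proof -
  obtain K R0 where R0: "R0 > cmod p"
    and far: "\<And>z. Im z \<ge> 0 \<Longrightarrow> cmod z \<ge> R0 \<Longrightarrow> cmod (F z / (z - p)) \<le> K / (1 + (cmod z)\<^sup>2)"
    and line: "\<And>s::real. cmod (F (of_real s) / (of_real s - p)) \<le> K / (1 + s\<^sup>2)"
    using real_line_Cauchy_bound[OF decay, of p] p by (metis less_irrefl)
  have contour: "((\<lambda>w. F w / (w - p)) has_contour_integral 0) (rectpath (- of_real R) (Complex R R))"
    if R: "R \<ge> R0" for R
  proof -
    have Rp: "R > 0" using R R0 norm_ge_zero[of p] by linarith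
    show ?thesis
    proof (rule Cauchy_theorem_convex[where S="{z. Im z \<ge> 0}" and K="{}"])
      show "continuous_on {z. Im z \<ge> 0} (\<lambda>w. F w / (w - p))"
        using p by (intro continuous_intros cont) auto
      show "(\<lambda>w. F w / (w - p)) field_differentiable at x" if "x \<in> interior {z. Im z \<ge> 0} - {}" for x
        using that p by (auto simp: interior_closed_upper_half_plane intro!: derivative_intros differentiable_upper_half_plane field_differentiable_divide)
      show "path_image (rectpath (- of_real R) (Complex R R)) \<subseteq> {z. Im z \<ge> 0}"
        using Rp by (subst path_image_rectpath_cbox_minus_box) (auto simp: in_cbox_complex_iff)
    qed (auto simp: convex_halfspace_Im_ge)
  qed
  moreover have "continuous_on UNIV (\<lambda>s. F (complex_of_real s) / (of_real s - p))"
    using p by (intro continuous_intros continuous_on_real_line) (auto simp: complex_eq_iff)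
  ultimately show "integrable lebesgue (\<lambda>s. F (of_real s) / (of_real s - p))"
    and "(LINT s|lebesgue. F (of_real s) / (of_real s - p)) = 0"
    using real_integral_from_rectangles[OF contour far _ line] by blast+
qed

text \<open>The real part is half the sum of \<open>F\<close> and its conjugate. The Cauchy integral
  of \<open>F\<close> at \<open>k\<close> gives \<open>F k\<close>; that of the conjugate is the
  conjugate of the Cauchy integral of \<open>F\<close> at \<open>cnj k\<close>, which vanishes. The
  decay of \<open>F\<close> rules out an additive imaginary constant.\<close>

lemma outer_exponent_Re:
  assumes k: "Im k > 0"
  shows "outer_exponent (\<lambda>s. Re (F (of_real s))) k = F k"
proof -
  have k': "Im (cnj k) < 0" using k by simp
  note up = real_line_Cauchy_upper[OF k] and low = real_line_Cauchy_lower[OF k']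
  have conj: "cnj (F (of_real s) / (of_real s - cnj k)) = cnj (F (of_real s)) / (of_real s - k)" for s
    by simp
  have low': "integrable lebesgue (\<lambda>s. cnj (F (of_real s)) / (of_real s - k))"
    using low(1) unfolding conj[symmetric] by (rule integrable_cnj)
  have low0: "(LINT s|lebesgue. cnj (F (of_real s)) / (of_real s - k)) = 0"
    unfolding conj[symmetric] by (subst Bochner_Integration.integral_cnj, subst low(2)) simp
  have "of_real (Re (F (of_real s))) / (of_real s - k)
      = (F (of_real s) / (of_real s - k) + cnj (F (of_real s)) / (of_real s - k)) / 2" for s
  proof -
    have eq: "complex_of_real (Re (F (of_real s))) = (F (of_real s) + cnj (F (of_real s))) / 2"
      by (simp add: complex_add_cnj)
    show ?thesis
      unfolding eq add_divide_distrib by (simp add: mult.commute)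
  qed
  then have "(LINT s|lebesgue. of_real (Re (F (of_real s))) / (of_real s - k))
      = (LINT s|lebesgue. (F (of_real s) / (of_real s - k) + cnj (F (of_real s)) / (of_real s - k)) / 2)"
    by (simp only:)
  also have "\<dots> = pi * \<i> * F k"
    using up low' low0 by (simp add: Bochner_Integration.integral_add)
  finally show ?thesis
    unfolding outer_exponent_def by simp
qed

lemma outer_arg_Re:
  assumes k: "Im k \<ge> 0"
  shows "outer_arg (\<lambda>s. Re (F (of_real s))) k = Im (F k)"
proof (cases "Im k > 0")
  case True
  then show ?thesis by (simp add: outer_arg_def upper_half_plane_def outer_exponent_Re)
next
  case False
  have "(F \<longlongrightarrow> F k) (at k within {z. Im z \<ge> 0})"
    using cont k by (auto simp: continuous_on_def)
  then have "(F \<longlongrightarrow> F k) (at k within upper_half_plane)"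
    by (rule tendsto_within_subset) (auto simp: upper_half_plane_def)
  then have "((\<lambda>z. Im (F z)) \<longlongrightarrow> Im (F k)) (at k within upper_half_plane)"
    by (rule tendsto_Im)
  moreover have "\<forall>\<^sub>F z in at k within upper_half_plane. Im (F z) = Im (outer_exponent (\<lambda>s. Re (F (of_real s))) z)"
    by (auto simp: eventually_at_filter upper_half_plane_def outer_exponent_Re)
  ultimately have "((\<lambda>z. Im (outer_exponent (\<lambda>s. Re (F (of_real s))) z)) \<longlongrightarrow> Im (F k)) (at k within upper_half_plane)"
    by (rule Lim_transform_eventually)
  \<comment> \<open>The filter must be nontrivial, since otherwise \<open>Lim\<close> would not be
    determined by the convergence.\<close>
  moreover have "k islimpt upper_half_plane"
    unfolding islimpt_approachable
  proof (intro allI impI)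
    fix e :: real assume "e > 0"
    then show "\<exists>x'\<in>upper_half_plane. x' \<noteq> k \<and> dist x' k < e"
      using k by (intro bexI[of _ "k + of_real (e / 2) * \<i>"])
        (auto simp: upper_half_plane_def dist_norm norm_mult)
  qed
  ultimately show ?thesis
    using False by (simp add: outer_arg_def upper_half_plane_def[symmetric] trivial_limit_within tendsto_Lim)
      (simp add: upper_half_plane_def)
qed

end

subsection \<open>The logarithm of the outer entry\<close>

lemma has_integral_atLeast:
  fixes f :: "real \<Rightarrow> 'a::banach"
  assumes "\<And>t. t \<ge> 0 \<Longrightarrow> (f has_vector_derivative f' t) (at t within {0..})" "0 \<le> a" "a \<le> b"
  shows "(f' has_integral f b - f a) {a..b}"
  by (rule fundamental_theorem_of_calculus[OF assms(3)])
    (use assms in \<open>auto intro!: has_vector_derivative_within_subset[OF assms(1)]\<close>)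

lemma has_vector_derivative_divide_complex:
  fixes f g :: "real \<Rightarrow> complex"
  assumes "(f has_vector_derivative f') (at x within S)" "(g has_vector_derivative g') (at x within S)"
    "g x \<noteq> 0"
  shows "((\<lambda>x. f x / g x) has_vector_derivative (f' * g x - f x * g') / (g x * g x)) (at x within S)"
  using has_derivative_divide'[OF assms(1,2)[unfolded has_vector_derivative_def] assms(3)]
  unfolding has_vector_derivative_def by (simp add: scaleR_conv_of_real algebra_simps)

lemma has_vector_derivative_exp_complex:
  fixes f :: "real \<Rightarrow> complex"
  assumes "(f has_vector_derivative f') (at x within S)"
  shows "((\<lambda>x. exp (f x)) has_vector_derivative exp (f x) * f') (at x within S)"
  using field_vector_diff_chain_within[OF assms, of exp "exp (f x)"] 
  by (simp add: o_def mult.commute DERIV_exp has_field_derivative_at_within)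

context bounded_continuous
begin

text \<open>The difference of the squared moduli of \<open>u\<close> and \<open>v\<close> has
  derivative \<open>2 * Im k * (cmod v)^2\<close>, which is nonnegative, and it equals 1 at the
  origin. This is the source of both bounds \<open>cmod u \<ge> 1\<close> and
  \<open>cmod w \<le> 1\<close>.\<close>

lemma energy:
  assumes k: "Im k \<ge> 0" and x: "x \<ge> 0"
  shows "(cmod (v k x))\<^sup>2 + 1 \<le> (cmod (u k x))\<^sup>2"
proof -
  define f where "f t = u k t * cnj (u k t) - v k t * cnj (v k t)" for t
  have d: "(f has_vector_derivative of_real (2 * Im k * (cmod (v k t))\<^sup>2)) (at t within {0..})"
    if "t \<ge> 0" for t
  proof -
    note uv = has_vector_derivative_uv[OF that, of k]
    have "(f has_vector_derivative
       (u k t * cnj (- A t * v k t) + (- A t * v k t) * cnj (u k t))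
       - (v k t * cnj (\<i> * k * v k t - cnj (A t) * u k t) + (\<i> * k * v k t - cnj (A t) * u k t) * cnj (v k t)))
      (at t within {0..})"
      unfolding f_def
      by (intro has_vector_derivative_diff has_vector_derivative_mult uv has_vector_derivative_cnj)
    moreover have "(u k t * cnj (- A t * v k t) + (- A t * v k t) * cnj (u k t))
       - (v k t * cnj (\<i> * k * v k t - cnj (A t) * u k t) + (\<i> * k * v k t - cnj (A t) * u k t) * cnj (v k t))
       = - \<i> * (k - cnj k) * (v k t * cnj (v k t))"
      by (simp add: algebra_simps)
    moreover have "\<dots> = of_real (2 * Im k * (cmod (v k t))\<^sup>2)"
      by (simp add: complex_diff_cnj complex_norm_square[symmetric] del: of_real_mult of_real_power)
        (simp add: mult_ac)
    ultimately show ?thesis by simp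
  qed
  have "((\<lambda>t. 2 * Im k * (cmod (v k t))\<^sup>2) has_integral Re (f x - f 0)) {0..x}"
    using has_integral_Re[OF has_integral_atLeast[OF d order_refl x]] by (simp del: of_real_mult of_real_power)
  then have "Re (f x - f 0) \<ge> 0"
    by (rule has_integral_nonneg) (use k in auto)
  then show ?thesis
    by (simp add: f_def complex_norm_square[symmetric] del: of_real_power)
qed

lemma u_ge_1:
  assumes "Im k \<ge> 0" "x \<ge> 0"
  shows "cmod (u k x) \<ge> 1"
proof -
  have "1\<^sup>2 \<le> (cmod (u k x))\<^sup>2" using energy[OF assms] by (smt (verit) one_power2 zero_le_power2)
  then show ?thesis by (rule power2_le_imp_le) simp
qed

lemma u_nonzero: "Im k \<ge> 0 \<Longrightarrow> x \<ge> 0 \<Longrightarrow> u k x \<noteq> 0"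
  using u_ge_1[of k x] by auto

definition w :: "complex \<Rightarrow> real \<Rightarrow> complex" where
  "w k x = v k x / u k x"

lemma norm_w:
  assumes "Im k \<ge> 0" "x \<ge> 0"
  shows "cmod (w k x) \<le> 1"
proof -
  have "(cmod (v k x))\<^sup>2 \<le> (cmod (u k x))\<^sup>2" using energy[OF assms] by linarith
  then have "cmod (v k x) \<le> cmod (u k x)" by (rule power2_le_imp_le) simp
  then show ?thesis
    using u_nonzero[OF assms] by (simp add: w_def norm_divide divide_le_eq_1)
qed

lemma w_0 [simp]: "w k 0 = 0"
  by (simp add: w_def)

lemma continuous_on_w:
  assumes "Im k \<ge> 0"
  shows "continuous_on {0..} (w k)"
  unfolding w_def using assms u_nonzero by (auto intro!: continuous_intros continuous_uv)

lemma has_vector_derivative_w: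
  assumes "Im k \<ge> 0" "x \<ge> 0"
  shows "(w k has_vector_derivative \<i> * k * w k x - cnj (A x) + A x * (w k x)\<^sup>2) (at x within {0..})"
proof -
  note uv = has_vector_derivative_uv[OF assms(2), of k]
  note nz = u_nonzero[OF assms]
  have "((\<i> * k * v k x - cnj (A x) * u k x) * u k x - v k x * (- A x * v k x)) / (u k x * u k x)
    = \<i> * k * w k x - cnj (A x) + A x * (w k x)\<^sup>2"
    using nz by (simp add: w_def field_simps power2_eq_square)
  then show ?thesis
    using has_vector_derivative_divide_complex[OF uv(2,1) nz] unfolding w_def[abs_def] by simp
qed

text \<open>A branch of the logarithm of \<open>u\<close> that is continuous in \<open>x\<close> and
  starts at 0. Defining it by integrating the logarithmic derivative \<open>- A w\<close> avoids
  branch cuts, which matters because its imaginary part will be unbounded.\<close>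

definition log_u :: "complex \<Rightarrow> real \<Rightarrow> complex" where
  "log_u k x = - integral {0..x} (\<lambda>t. A t * w k t)"

lemma log_u_0 [simp]: "log_u k 0 = 0"
  by (simp add: log_u_def)

lemma has_vector_derivative_log_u:
  assumes "Im k \<ge> 0" "x \<ge> 0"
  shows "(log_u k has_vector_derivative - (A x * w k x)) (at x within {0..})"
  unfolding log_u_def
  by (intro derivative_intros integral_has_vector_derivative_atLeast[of "\<lambda>t. A t * w k t"]
      continuous_intros cont_A' continuous_on_w assms)

lemma continuous_on_log_u: "Im k \<ge> 0 \<Longrightarrow> continuous_on {0..} (log_u k)"
  unfolding continuous_on_eq_continuous_within
  using has_vector_derivative_continuous[OF has_vector_derivative_log_u] by auto

text \<open>Since \<open>u' = - A v = (- A w) u\<close>, the product of \<open>u\<close> with the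
  exponential of \<open>- log_u\<close> has derivative 0.\<close>

lemma exp_log_u:
  assumes k: "Im k \<ge> 0" and x: "x \<ge> 0"
  shows "exp (log_u k x) = u k x"
proof -
  have "((\<lambda>t. u k t * exp (- log_u k t)) has_vector_derivative 0) (at t within {0..})" if t: "t \<ge> 0" for t
  proof -
    have uw: "u k t * w k t = v k t" using u_nonzero[OF k t] by (simp add: w_def)
    have "u k t * (exp (- log_u k t) * - (- (A t * w k t))) + (- A t * v k t) * exp (- log_u k t)
      = A t * exp (- log_u k t) * (u k t * w k t - v k t)"
      by (simp add: algebra_simps)
    also have "\<dots> = 0" by (simp add: uw)
    finally have z: "u k t * (exp (- log_u k t) * - (- (A t * w k t))) + (- A t * v k t) * exp (- log_u k t) = 0" .
    show ?thesis
      unfolding z[symmetric]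
      by (intro has_vector_derivative_mult has_vector_derivative_exp_complex has_vector_derivative_minus
          has_vector_derivative_log_u has_vector_derivative_uv k t)
  qed
  from has_integral_atLeast[OF this order_refl x]
  have "((\<lambda>t. 0) has_integral u k x * exp (- log_u k x) - 1) {0..x}" by simp
  then have "u k x * exp (- log_u k x) = 1"
    using has_integral_unique[OF _ has_integral_0] by fastforce
  then show ?thesis by (simp add: exp_minus field_simps)
qed

lemma Re_log_u: "Im k \<ge> 0 \<Longrightarrow> x \<ge> 0 \<Longrightarrow> Re (log_u k x) = ln (cmod (u k x))"
  by (simp add: exp_log_u[symmetric])

lemma Aw_bound:
  assumes "Im k \<ge> 0" "t \<ge> 0"
  shows "cmod (A t * w k t) \<le> a"
  using mult_mono[OF bound_A[of t] norm_w[OF assms]] a_nonneg by (simp add: norm_mult)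

lemma Aw_integrable: "Im k \<ge> 0 \<Longrightarrow> (\<lambda>t. A t * w k t) integrable_on {0..x}"
  by (intro integrable_on_atLeast continuous_intros cont_A' continuous_on_w)

lemma norm_log_u:
  assumes k: "Im k \<ge> 0" and x: "x \<ge> 0"
  shows "cmod (log_u k x) \<le> a * x"
proof -
  have "norm (integral {0..x} (\<lambda>t. A t * w k t)) \<le> integral {0..x} (\<lambda>_. a)"
    by (rule integral_norm_bound_integral[OF Aw_integrable[OF k]]) (use Aw_bound[OF k] in auto)
  then show ?thesis using x by (simp add: log_u_def mult.commute)
qed

lemma continuous_on_log_u_param:
  assumes x: "x \<ge> 0"
  shows "continuous_on {k. Im k \<ge> 0} (\<lambda>k. log_u k x)"
  unfolding continuous_on_sequentially
proof (intro allI ballI impI)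
  fix z k assume k: "k \<in> {k. Im k \<ge> 0}" and z: "(\<forall>n. z n \<in> {k. Im k \<ge> 0}) \<and> z \<longlonglongrightarrow> k"
  have conv: "(\<lambda>n. w (z n) t) \<longlonglongrightarrow> w k t" if t: "t \<ge> 0" for t
  proof -
    have cont: "isCont (\<lambda>k. u k t) k" "isCont (\<lambda>k. v k t) k"
      using holomorphic_uv[OF t, THEN holomorphic_on_imp_continuous_on]
      by (auto simp: continuous_on_eq_continuous_at)
    show ?thesis
      unfolding w_def using z k t u_nonzero
      by (auto intro!: tendsto_divide isCont_tendsto_compose[OF cont(1)] isCont_tendsto_compose[OF cont(2)])
  qed
  have "(\<lambda>n. integral {0..x} (\<lambda>t. A t * w (z n) t)) \<longlonglongrightarrow> integral {0..x} (\<lambda>t. A t * w k t)"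
    by (rule dominated_convergence(2)[where h="\<lambda>_. a"])
      (use z conv Aw_bound in \<open>auto intro!: Aw_integrable tendsto_intros\<close>)
  then show "((\<lambda>k. log_u k x) \<circ> z) \<longlonglongrightarrow> log_u k x"
    unfolding log_u_def o_def by (intro tendsto_intros)
qed

text \<open>Near a point \<open>p\<close> the function differs from the principal logarithm of
  \<open>u k x / u p x\<close> by a constant: continuity in \<open>k\<close> keeps the increment of
  \<open>log_u\<close> inside the strip where \<open>Ln\<close> inverts \<open>exp\<close>.\<close>

lemma holomorphic_log_u:
  assumes x: "x \<ge> 0"
  shows "(\<lambda>k. log_u k x) holomorphic_on {k. Im k > 0}"
  unfolding holomorphic_on_def
proof
  fix p assume p: "p \<in> {k. Im k > 0}"
  have op: "open {k. Im k > 0}" by (rule open_halfspace_Im_gt)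
  have "continuous_on {k. Im k > 0} (\<lambda>k. log_u k x)"
    by (rule continuous_on_subset[OF continuous_on_log_u_param[OF x]]) auto
  then have "isCont (\<lambda>k. log_u k x) p"
    using p op by (simp add: continuous_on_eq_continuous_at)
  then obtain d where d: "d > 0" "\<And>k. dist k p < d \<Longrightarrow> dist (log_u k x) (log_u p x) < 1"
    unfolding continuous_at_eps_delta using zero_less_one by blast
  define S where "S = {k. Im k > 0} \<inter> ball p d"
  have S: "open S" "p \<in> S" using op p d by (auto simp: S_def)
  have eq: "log_u p x + Ln (u k x / u p x) = log_u k x" if "k \<in> S" for k
  proof -
    have "u k x / u p x = exp (log_u k x - log_u p x)"
      using that p x by (simp add: exp_diff exp_log_u S_def)
    moreover have "cmod (log_u k x - log_u p x) < 1"
      using that d(2)[of k] by (simp add: S_def dist_norm dist_commute norm_minus_commute)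
    then have "\<bar>Im (log_u k x - log_u p x)\<bar> < pi"
      using abs_Im_le_cmod[of "log_u k x - log_u p x"] pi_gt3 by linarith
    ultimately show ?thesis by (simp add: Ln_exp)
  qed
  have "(\<lambda>k. u k x) field_differentiable at p"
    using holomorphic_uv(1)[OF x] by (simp add: holomorphic_on_open field_differentiable_def)
  then have "(\<lambda>k. log_u p x + Ln (u k x / u p x)) field_differentiable at p"
    using p x u_nonzero[of p x]
    by (intro field_differentiable_add field_differentiable_const field_differentiable_divide
        field_differentiable_compose[of "\<lambda>k. u k x / u p x" p Ln, unfolded o_def]) 
      (auto intro!: field_differentiable_at_Ln)
  then obtain D where "((\<lambda>k. log_u p x + Ln (u k x / u p x)) has_field_derivative D) (at p)"
    by (auto simp: field_differentiable_def)
  then have "((\<lambda>k. log_u k x) has_field_derivative D) (at p)"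
    by (rule has_field_derivative_transform_within_open[OF _ S]) (rule eq)
  then show "(\<lambda>k. log_u k x) field_differentiable at p within {k. Im k > 0}"
    using has_field_derivative_at_within field_differentiable_def by blast
qed

end

section \<open>Smooth coefficients: decay in the spectral parameter\<close>

locale bounded_smooth = bounded_continuous +
  fixes A' :: "real \<Rightarrow> complex"
  assumes deriv_A: "\<And>t. (A has_vector_derivative A' t) (at t)" and cont_A'': "continuous_on UNIV A'"
begin

text \<open>The Riccati equation gives \<open>(A w)' = \<i> k A w + r\<close> with \<open>r\<close>
  bounded independently of \<open>k\<close>. Integrating over \<open>{0..x}\<close> bounds
  \<open>k\<close> times the integral of \<open>A w\<close>, that is \<open>k\<close> times
  \<open>log_u\<close> up to sign.\<close>

lemma log_u_decay:
  assumes x: "x \<ge> 0"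
  shows "\<exists>C. \<forall>k. Im k \<ge> 0 \<longrightarrow> cmod (log_u k x) \<le> C / (1 + cmod k)"
proof -
  have cA': "continuous_on S A'" for S using cont_A'' continuous_on_subset by blast
  have "bounded (A' ` {0..x})"
    by (intro compact_imp_bounded compact_continuous_image cA' compact_Icc)
  then obtain b where b: "\<And>t. t \<in> {0..x} \<Longrightarrow> cmod (A' t) \<le> b"
    by (auto simp: bounded_iff simp del: atLeastAtMost_iff)
  \<comment> \<open>The summand \<open>a * x\<close> bounds \<open>log_u\<close> itself; the
    remaining summand bounds \<open>cmod k\<close> times its modulus.\<close>
  have "cmod (log_u k x) \<le> (a * x + (a + (b + 2 * a\<^sup>2) * x)) / (1 + cmod k)" if k: "Im k \<ge> 0" for k
  proof -
    define r where "r t = A' t * w k t - A t * cnj (A t) + (A t * w k t)\<^sup>2" for t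
    have "((\<lambda>t. A t * w k t) has_vector_derivative r t + \<i> * k * (A t * w k t)) (at t within {0..})"
      if t: "t \<ge> 0" for t
    proof -
      have "((\<lambda>t. A t * w k t) has_vector_derivative A t * (\<i> * k * w k t - cnj (A t) + A t * (w k t)\<^sup>2) + A' t * w k t)
         (at t within {0..})"
        by (intro has_vector_derivative_mult has_vector_derivative_w k t has_vector_derivative_at_within[OF deriv_A])
      then show ?thesis by (simp add: r_def algebra_simps power2_eq_square)
    qed
    from has_integral_atLeast[OF this order_refl x]
    have 1: "((\<lambda>t. r t + \<i> * k * (A t * w k t)) has_integral A x * w k x) {0..x}" by simp
    have ri: "r integrable_on {0..x}"
      unfolding r_def by (intro integrable_on_atLeast continuous_intros cont_A' continuous_on_w k cA')
    have "((\<lambda>t. \<i> * k * (A t * w k t)) has_integral A x * w k x - integral {0..x} r) {0..x}"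
      using has_integral_diff[OF 1 integrable_integral[OF ri]] by simp
    then have "\<i> * k * integral {0..x} (\<lambda>t. A t * w k t) = A x * w k x - integral {0..x} r"
      using Aw_integrable[OF k] integral_unique by (metis integral_mult_right)
    then have "cmod k * cmod (log_u k x) = cmod (A x * w k x - integral {0..x} r)"
      by (metis (no_types, lifting) log_u_def mult.left_neutral norm_ii norm_minus_cancel norm_mult)
    also have "\<dots> \<le> a + cmod (integral {0..x} r)"
      using norm_triangle_ineq4 Aw_bound[OF k x] by (smt (verit))
    also have "cmod (integral {0..x} r) \<le> integral {0..x} (\<lambda>_. b + 2 * a\<^sup>2)"
    proof (rule integral_norm_bound_integral[OF ri])
      fix t assume t: "t \<in> {0..x}"
      have "cmod (A' t * w k t) \<le> b * 1"
        unfolding norm_mult using b[OF t] norm_w[OF k, of t] t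
        by (intro mult_mono) (auto intro: order_trans[OF norm_ge_zero])
      moreover have "cmod (A t * cnj (A t)) \<le> a\<^sup>2"
        unfolding norm_mult power2_eq_square using bound_A[of t] a_nonneg by (auto intro!: mult_mono)
      moreover have "cmod ((A t * w k t)\<^sup>2) \<le> a\<^sup>2"
        unfolding norm_power using Aw_bound[OF k, of t] t by (intro power_mono) auto
      ultimately show "norm (r t) \<le> b + 2 * a\<^sup>2"
        unfolding r_def by (smt (verit) norm_triangle_ineq norm_triangle_ineq4)
    qed auto
    finally have "cmod k * cmod (log_u k x) \<le> a + (b + 2 * a\<^sup>2) * x"
      using x by (simp add: mult.commute)
    then have "(1 + cmod k) * cmod (log_u k x) \<le> a * x + (a + (b + 2 * a\<^sup>2) * x)"
      using norm_log_u[OF k x] by (simp add: distrib_right)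
    then show ?thesis by (simp add: field_simps add_pos_nonneg)
  qed
  then show ?thesis by blast
qed

lemma outer_arg_u:
  assumes "x \<ge> 0" "Im k \<ge> 0"
  shows "outer_arg (\<lambda>s. ln (cmod (u (of_real s) x))) k = Im (log_u k x)"
proof -
  obtain C where C: "\<And>k. Im k \<ge> 0 \<Longrightarrow> cmod (log_u k x) \<le> C / (1 + cmod k)"
    using log_u_decay[OF assms(1)] by blast
  have "outer_arg (\<lambda>s. Re (log_u (of_real s) x)) k = Im (log_u k x)"
    by (rule outer_arg_Re[OF continuous_on_log_u_param holomorphic_log_u C]) (use assms in auto)
  then show ?thesis using assms by (simp add: Re_log_u)
qed

end

subsection \<open>Uniqueness of absolutely continuous solutions\<close>

text \<open>Gronwall in integral form: multiplied by \<open>exp (- C x)\<close>, the primitive of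
  \<open>z\<close> is nonincreasing and starts at 0, so it is nonpositive; being the primitive of a
  nonnegative function it is 0.\<close>

lemma integral_gronwall_zero:
  fixes z :: "real \<Rightarrow> real"
  assumes z: "continuous_on {a..b} z" "\<And>x. x \<in> {a..b} \<Longrightarrow> 0 \<le> z x"
    and le: "\<And>x. x \<in> {a..b} \<Longrightarrow> z x \<le> C * integral {a..x} z" and x: "x \<in> {a..b}"
  shows "z x = 0"
proof -
  define G where "G x = integral {a..x} z" for x
  define h where "h x = G x * exp (- (C * x))" for x
  have dG: "(G has_real_derivative z t) (at t within {a..b})" if "t \<in> {a..b}" for t
    unfolding G_def has_real_derivative_iff_has_vector_derivative
    by (rule integral_has_vector_derivative[OF z(1) that])
  have dh: "(h has_real_derivative (z t - C * G t) * exp (- (C * t))) (at t within {a..b})" if "t \<in> {a..b}" for t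
    unfolding h_def by (rule derivative_eq_intros dG that refl | simp)+ (simp add: algebra_simps)
  have "((\<lambda>t. (z t - C * G t) * exp (- (C * t))) has_integral h x - h a) {a..x}"
    using x by (intro fundamental_theorem_of_calculus)
      (auto simp: has_real_derivative_iff_has_vector_derivative[symmetric] intro!: DERIV_subset[OF dh])
  then have "((\<lambda>t. - ((z t - C * G t) * exp (- (C * t)))) has_integral - (h x - h a)) {a..x}"
    by (rule has_integral_neg)
  then have "- (h x - h a) \<ge> 0"
    by (rule has_integral_nonneg) (use x le in \<open>auto simp: G_def mult_le_0_iff\<close>)
  then have "G x \<le> 0"
    by (simp add: h_def G_def mult_le_0_iff)
  moreover have "G x \<ge> 0"
    unfolding G_def by (rule integral_nonneg)
      (use x z in \<open>auto intro!: integrable_continuous_real intro: continuous_on_subset\<close>)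
  ultimately show ?thesis
    using le[OF x] z(2)[OF x] by (simp add: G_def)
qed

text \<open>The crude constant 8 arises from a factor 2 for the inner product in each entry and a
  factor 2 for summing over columns and over rows.\<close>

lemma norm_matrix_mult_le:
  fixes M Z :: "complex^2^2"
  assumes "\<And>i j. cmod (M $ i $ j) \<le> m"
  shows "norm (M ** Z) \<le> 8 * m * norm Z"
proof -
  have m: "m \<ge> 0" using assms[of 1 1] norm_ge_zero order_trans by blast
  have z: "cmod (Z $ i $ j) \<le> norm Z" for i j
    by (rule order_trans[OF Finite_Cartesian_Product.norm_nth_le Finite_Cartesian_Product.norm_nth_le])
  have e: "cmod ((M ** Z) $ i $ j) \<le> 2 * (m * norm Z)" for i j
  proof -
    have "cmod ((M ** Z) $ i $ j) \<le> cmod (M $ i $ 1 * Z $ 1 $ j) + cmod (M $ i $ 2 * Z $ 2 $ j)"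
      by (simp add: matrix_matrix_mult_def sum_2 norm_triangle_ineq)
    also have "\<dots> \<le> m * norm Z + m * norm Z"
      unfolding norm_mult by (intro add_mono mult_mono assms z m) auto
    finally show ?thesis by simp
  qed
  have r: "norm ((M ** Z) $ i) \<le> 4 * (m * norm Z)" for i
  proof -
    have "norm ((M ** Z) $ i) \<le> (\<Sum>j\<in>UNIV. norm ((M ** Z) $ i $ j))"
      unfolding norm_vec_def by (rule L2_set_le_sum) simp
    also have "\<dots> \<le> 4 * (m * norm Z)" using e[of i 1] e[of i 2] by (simp add: sum_2)
    finally show ?thesis .
  qed
  have "norm (M ** Z) \<le> (\<Sum>j\<in>UNIV. norm ((M ** Z) $ j))"
    unfolding norm_vec_def[of "M ** Z"] by (rule L2_set_le_sum) simp
  also have "\<dots> \<le> 8 * m * norm Z" using r[of 1] r[of 2] by (simp add: sum_2)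
  finally show ?thesis .
qed

lemma has_ac_derivative_onD:
  assumes "has_ac_derivative_on X D S" "{a..b} \<subseteq> S" "a \<le> b"
  shows "D absolutely_integrable_on {a..b}" "X b = X a + integral {a..b} D"
proof -
  have "a \<in> S" "b \<in> S" using assms by auto
  with assms show *: "D absolutely_integrable_on {a..b}" and "X b = X a + integral {a..b} D"
    unfolding has_ac_derivative_on_def by (metis set_lebesgue_integral_eq_integral(2))+
qed

lemma has_ac_derivative_on_continuous:
  assumes "has_ac_derivative_on X D S" "{a..b} \<subseteq> S"
  shows "continuous_on {a..b} X"
proof (cases "a \<le> b")
  case True
  have "D integrable_on {a..b}"
    using has_ac_derivative_onD(1)[OF assms True] set_lebesgue_integral_eq_integral(1) by blast
  then have "continuous_on {a..b} (\<lambda>x. X a + integral {a..x} D)"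
    by (intro continuous_intros indefinite_integral_continuous_1)
  then show ?thesis
  proof (rule continuous_on_eq)
    fix x assume "x \<in> {a..b}"
    then have "{a..x} \<subseteq> S" "a \<le> x" using assms(2) by auto
    then show "X a + integral {a..x} D = X x" using has_ac_derivative_onD(2)[OF assms(1)] by simp
  qed
qed simp

lemma has_ac_derivative_on_diff:
  assumes "has_ac_derivative_on X D S" "has_ac_derivative_on Y D' S"
  shows "has_ac_derivative_on (\<lambda>x. X x - Y x) (\<lambda>x. D x - D' x) S"
  unfolding has_ac_derivative_on_def
proof (intro ballI impI)
  fix x y assume "x \<in> S" "y \<in> S" "x \<le> y"
  then have "set_integrable lebesgue {x..y} D" "X y = X x + (LINT t:{x..y}|lebesgue. D t)"
    "set_integrable lebesgue {x..y} D'" "Y y = Y x + (LINT t:{x..y}|lebesgue. D' t)"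
    using assms unfolding has_ac_derivative_on_def by blast+
  then show "set_integrable lebesgue {x..y} (\<lambda>x. D x - D' x) \<and>
      X y - Y y = X x - Y x + (LINT t:{x..y}|lebesgue. D t - D' t)"
    by (simp add: set_integral_diff)
qed

lemma has_ac_derivative_on_mult_right:
  fixes P :: "complex^2^2"
  assumes "has_ac_derivative_on X D S"
  shows "has_ac_derivative_on (\<lambda>x. X x ** P) (\<lambda>x. D x ** P) S"
proof -
  have bl: "bounded_linear (\<lambda>M :: complex^2^2. M ** P)"
    unfolding linear_conv_bounded_linear[symmetric]
    by (rule linearI) (auto simp: vec_eq_iff matrix_matrix_mult_def sum_2 algebra_simps)
  show ?thesis
    unfolding has_ac_derivative_on_def
  proof (intro ballI impI)
    fix x y assume xy: "x \<in> S" "y \<in> S" "x \<le> y"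
    then have D: "set_integrable lebesgue {x..y} D" and X: "X y = X x + (LINT t:{x..y}|lebesgue. D t)"
      using assms unfolding has_ac_derivative_on_def by blast+
    have scale: "indicator {x..y} t *\<^sub>R (D t ** P) = (indicator {x..y} t *\<^sub>R D t) ** P" for t
      by (auto simp: indicator_def)
    have "set_integrable lebesgue {x..y} (\<lambda>x. D x ** P)"
      using integrable_bounded_linear[OF bl D[unfolded set_integrable_def]] unfolding set_integrable_def scale .
    moreover have "(LINT t:{x..y}|lebesgue. D t ** P) = (LINT t:{x..y}|lebesgue. D t) ** P"
      unfolding set_lebesgue_integral_def scale
      by (rule integral_bounded_linear[OF bl D[unfolded set_integrable_def]])
    ultimately show "set_integrable lebesgue {x..y} (\<lambda>x. D x ** P) \<and>
        X y ** P = X x ** P + (LINT t:{x..y}|lebesgue. D t ** P)"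
      using X by (simp add: linear_add[OF bounded_linear.linear[OF bl]])
  qed
qed

lemma ac_forward_zero:
  assumes ac: "has_ac_derivative_on Z D S" and S: "{a..b} \<subseteq> S"
    and le: "AE x in lebesgue. x \<in> {a..b} \<longrightarrow> norm (D x) \<le> C * norm (Z x)"
    and Z: "Z a = 0" and x: "x \<in> {a..b}"
  shows "Z x = 0"
proof -
  note cont = has_ac_derivative_on_continuous[OF ac S]
  have "norm (Z x) = 0"
  proof (rule integral_gronwall_zero[of a b "\<lambda>x. norm (Z x)" C x])
    show "continuous_on {a..b} (\<lambda>x. norm (Z x))" by (intro continuous_intros cont)
    fix y assume y: "y \<in> {a..b}"
    have Sy: "{a..y} \<subseteq> S" "a \<le> y" using S y by auto
    have D: "integrable lebesgue (\<lambda>t. indicator {a..y} t *\<^sub>R D t)"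
      using has_ac_derivative_onD(1)[OF ac Sy] by (simp add: set_integrable_def)
    have cz: "continuous_on {a..y} (\<lambda>t. norm (Z t))"
      by (rule continuous_on_subset[OF continuous_on_norm[OF cont]]) (use y in auto)
    note ai = absolutely_integrable_continuous_real[OF cz]
    have "norm (Z y) = norm (LINT t:{a..y}|lebesgue. D t)"
      using has_ac_derivative_onD[OF ac Sy] Z
      by (simp add: set_lebesgue_integral_eq_integral(2))
    also have "\<dots> \<le> (LINT t|lebesgue. norm (indicator {a..y} t *\<^sub>R D t))"
      unfolding set_lebesgue_integral_def by (rule integral_norm_bound)
    also have "\<dots> \<le> (LINT t|lebesgue. C * (indicator {a..y} t *\<^sub>R norm (Z t)))"
    proof (rule integral_mono_AE)
      show "integrable lebesgue (\<lambda>t. norm (indicator {a..y} t *\<^sub>R D t))" using D by (rule integrable_norm)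
      show "integrable lebesgue (\<lambda>t. C * (indicator {a..y} t *\<^sub>R norm (Z t)))"
        using ai by (intro integrable_mult_right) (simp add: set_integrable_def)
      show "AE t in lebesgue. norm (indicator {a..y} t *\<^sub>R D t) \<le> C * (indicator {a..y} t *\<^sub>R norm (Z t))"
        using le by eventually_elim (use y in \<open>auto simp: indicator_def\<close>)
    qed
    also have "\<dots> = C * (LINT t:{a..y}|lebesgue. norm (Z t))"
      by (simp add: set_lebesgue_integral_def)
    also have "\<dots> = C * integral {a..y} (\<lambda>t. norm (Z t))"
      by (simp add: set_lebesgue_integral_eq_integral(2)[OF ai])
    finally show "norm (Z y) \<le> C * integral {a..y} (\<lambda>t. norm (Z t))" .
  qed (use x in auto)
  then show ?thesis by simp
qed

text \<open>The reflection of the line turns the integral from \<open>x\<close> up to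
  \<open>b\<close> into one starting at the initial point, so the same Gronwall argument
  applies.\<close>

lemma ac_backward_zero:
  assumes ac: "has_ac_derivative_on Z D S" and S: "{a..b} \<subseteq> S"
    and le: "AE x in lebesgue. x \<in> {a..b} \<longrightarrow> norm (D x) \<le> C * norm (Z x)"
    and Z: "Z b = 0" and x: "x \<in> {a..b}"
  shows "Z x = 0"
proof -
  note cont = has_ac_derivative_on_continuous[OF ac S]
  have "norm (Z (- (- x))) = 0"
  proof (rule integral_gronwall_zero[of "- b" "- a" "\<lambda>x. norm (Z (- x))" C "- x"])
    show "continuous_on {- b..- a} (\<lambda>x. norm (Z (- x)))"
      by (intro continuous_intros continuous_on_compose2[OF cont]) auto
    fix y' assume y': "y' \<in> {- b..- a}"
    define y where "y = - y'"
    have y: "y \<in> {a..b}" using y' by (auto simp: y_def)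
    have Sy: "{y..b} \<subseteq> S" "y \<le> b" using S y by auto
    have D: "integrable lebesgue (\<lambda>t. indicator {y..b} t *\<^sub>R D t)"
      using has_ac_derivative_onD(1)[OF ac Sy] by (simp add: set_integrable_def)
    have cz: "continuous_on {y..b} (\<lambda>t. norm (Z t))"
      by (rule continuous_on_subset[OF continuous_on_norm[OF cont]]) (use y in auto)
    note ai = absolutely_integrable_continuous_real[OF cz]
    have "Z b = Z y + (LINT t:{y..b}|lebesgue. D t)"
      using has_ac_derivative_onD[OF ac Sy]
      by (simp add: set_lebesgue_integral_eq_integral(2))
    then have "norm (Z y) = norm (LINT t:{y..b}|lebesgue. D t)"
      using Z by (metis add_eq_0_iff norm_minus_cancel)
    also have "\<dots> \<le> (LINT t|lebesgue. norm (indicator {y..b} t *\<^sub>R D t))"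
      unfolding set_lebesgue_integral_def by (rule integral_norm_bound)
    also have "\<dots> \<le> (LINT t|lebesgue. C * (indicator {y..b} t *\<^sub>R norm (Z t)))"
    proof (rule integral_mono_AE)
      show "integrable lebesgue (\<lambda>t. norm (indicator {y..b} t *\<^sub>R D t))" using D by (rule integrable_norm)
      show "integrable lebesgue (\<lambda>t. C * (indicator {y..b} t *\<^sub>R norm (Z t)))"
        using ai by (intro integrable_mult_right) (simp add: set_integrable_def)
      show "AE t in lebesgue. norm (indicator {y..b} t *\<^sub>R D t) \<le> C * (indicator {y..b} t *\<^sub>R norm (Z t))"
        using le by eventually_elim (use y in \<open>auto simp: indicator_def\<close>)
    qed
    also have "\<dots> = C * (LINT t:{y..b}|lebesgue. norm (Z t))"
      by (simp add: set_lebesgue_integral_def)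
    also have "\<dots> = C * integral {y..b} (\<lambda>t. norm (Z t))"
      by (simp add: set_lebesgue_integral_eq_integral(2)[OF ai])
    also have "integral {y..b} (\<lambda>t. norm (Z t)) = integral {- b..y'} (\<lambda>t. norm (Z (- t)))"
      using Henstock_Kurzweil_Integration.integral_reflect_real[of b y "\<lambda>t. norm (Z t)"] by (simp add: y_def)
    finally show "norm (Z (- y')) \<le> C * integral {- b..y'} (\<lambda>t. norm (Z (- t)))" by (simp add: y_def)
  qed (use x in auto)
  then show ?thesis by simp
qed

lemma ac_zero:
  assumes "has_ac_derivative_on Z D S" "{a..b} \<subseteq> S"
    and "AE x in lebesgue. x \<in> {a..b} \<longrightarrow> norm (D x) \<le> C * norm (Z x)"
    and "Z c = 0" "c \<in> {a..b}" "x \<in> {a..b}"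
  shows "Z x = 0"
proof (cases "c \<le> x")
  case True
  show ?thesis
    by (rule ac_forward_zero[OF assms(1), of c b C]) (use assms True in \<open>auto elim: eventually_mono\<close>)
next
  case False
  show ?thesis
    by (rule ac_backward_zero[OF assms(1), of a c C]) (use assms False in \<open>auto elim: eventually_mono\<close>)
qed

text \<open>The finite exceptional set \<open>N\<close> absorbs the endpoints of the support of a
  truncated potential, where the derivative prescribed by the equation has a jump.\<close>

lemma has_ac_derivative_on_piece:
  fixes X D D' :: "real \<Rightarrow> complex^2^2"
  assumes S: "is_interval S" and N: "finite N"
    and deriv: "\<And>t i j. t \<in> S \<Longrightarrow> ((\<lambda>t. X t $ i $ j) has_vector_derivative D' t $ i $ j) (at t within S)"
    and cont: "\<And>i j. continuous_on S (\<lambda>t. D' t $ i $ j)"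
    and eq: "\<And>t. t \<in> S - N \<Longrightarrow> D t = D' t"
  shows "has_ac_derivative_on X D S"
  unfolding has_ac_derivative_on_def
proof (intro ballI impI)
  fix x y assume xy: "x \<in> S" "y \<in> S" "x \<le> y"
  have sub: "{x..y} \<subseteq> S" using S xy unfolding is_interval_1 by (meson atLeastAtMost_iff subsetI)
  have cD: "continuous_on {x..y} D'"
  proof (rule continuous_on_subset[OF _ sub])
    have "continuous_on S (\<lambda>t. \<chi> i j. D' t $ i $ j)"
      by (intro continuous_on_vec_lambda cont)
    then show "continuous_on S D'" by simp
  qed
  have neg: "negligible N" using N by (rule negligible_finite)
  note ai = absolutely_integrable_continuous_real[OF cD]
  have ai': "D absolutely_integrable_on {x..y}"
    by (rule absolutely_integrable_spike[OF ai neg]) (use eq sub in auto)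
  have "integral {x..y} D = integral {x..y} D'"
    by (rule integral_spike[OF neg]) (use eq sub in auto)
  moreover have "integral {x..y} D' $ i $ j = X y $ i $ j - X x $ i $ j" for i j
  proof -
    have bl: "bounded_linear (\<lambda>M :: complex^2^2. M $ i $ j)"
      by (rule bounded_linear_compose[OF bounded_linear_vec_nth bounded_linear_vec_nth])
    have "integral {x..y} (\<lambda>t. D' t $ i $ j) = integral {x..y} D' $ i $ j"
      using integral_linear[OF integrable_continuous_real[OF cD] bl] by (simp add: o_def)
    moreover have "((\<lambda>t. D' t $ i $ j) has_integral X y $ i $ j - X x $ i $ j) {x..y}"
      by (rule fundamental_theorem_of_calculus[OF xy(3)])
        (use sub in \<open>auto intro!: has_vector_derivative_within_subset[OF deriv sub]\<close>)
    ultimately show ?thesis using integral_unique by metis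
  qed
  ultimately have "X y = X x + integral {x..y} D" by (simp add: vec_eq_iff)
  then show "set_integrable lebesgue {x..y} D \<and> X y = X x + (LINT t:{x..y}|lebesgue. D t)"
    unfolding set_lebesgue_integral_eq_integral(2)[OF ai'] using ai' by blast
qed

lemma has_ac_derivative_on_glue:
  assumes 1: "has_ac_derivative_on X D S1" and 2: "has_ac_derivative_on X D S2"
    and c: "c \<in> S1" "c \<in> S2" "S1 \<subseteq> {..c}" "S2 \<subseteq> {c..}"
  shows "has_ac_derivative_on X D (S1 \<union> S2)"
  unfolding has_ac_derivative_on_def
proof (intro ballI impI)
  fix x y assume xy: "x \<in> S1 \<union> S2" "y \<in> S1 \<union> S2" "x \<le> y"
  consider "x \<in> S1" "y \<in> S1" | "x \<in> S2" "y \<in> S2" | "x \<in> S1" "y \<in> S2" | "x \<in> S2" "y \<in> S1" using xy by blast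
  then show "set_integrable lebesgue {x..y} D \<and> X y = X x + (LINT t:{x..y}|lebesgue. D t)"
  proof cases
    case 3
    have l: "x \<le> c" "c \<le> y" using 3 c by auto
    have A: "set_integrable lebesgue {x..c} D" "X c = X x + (LINT t:{x..c}|lebesgue. D t)"
      using 1 3 c l unfolding has_ac_derivative_on_def by blast+
    have B: "set_integrable lebesgue {c..y} D" "X y = X c + (LINT t:{c..y}|lebesgue. D t)"
      using 2 3 c l unfolding has_ac_derivative_on_def by blast+
    have un: "{x..y} = {x..c} \<union> {c..y}" using l by auto
    have S: "set_integrable lebesgue {x..y} D"
      unfolding un by (rule set_integrable_Un[OF A(1) B(1)]) auto
    have "integral {x..c} D + integral {c..y} D = integral {x..y} D"
      by (rule Henstock_Kurzweil_Integration.integral_combine[OF l])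
        (rule set_lebesgue_integral_eq_integral(1)[OF S])
    then show ?thesis
      using A(2) B(2) S unfolding set_lebesgue_integral_eq_integral(2)[OF A(1)]
        set_lebesgue_integral_eq_integral(2)[OF B(1)] set_lebesgue_integral_eq_integral(2)[OF S]
      by (metis add.assoc)
  next
    case 4
    then have "x = c" "y = c" using c xy by (auto simp: subset_iff intro: antisym order_trans)
    then show ?thesis using 1 c unfolding has_ac_derivative_on_def by blast
  qed (use 1 2 xy in \<open>unfold has_ac_derivative_on_def, blast\<close>)+
qed

lemma has_ac_derivative_on_cong:
  assumes "has_ac_derivative_on X D S" "\<And>x. x \<in> S \<Longrightarrow> X x = Y x"
  shows "has_ac_derivative_on Y D S"
  using assms unfolding has_ac_derivative_on_def by metis

subsection \<open>The fundamental matrix of the Krein system\<close>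

lemma has_vector_derivative_exp_linear:
  "((\<lambda>t. exp (c * complex_of_real t)) has_vector_derivative c * exp (c * of_real t)) (at t within S)"
proof -
  have "((\<lambda>t. c * complex_of_real t) has_vector_derivative c * 1) (at t within S)"
    using has_vector_derivative_mult_right[OF has_vector_derivative_of_real[OF DERIV_ident]] by simp
  from has_vector_derivative_exp_complex[OF this] show ?thesis by (simp add: mult.commute)
qed

lemma matrix_mult_diff_right:
  fixes M X Y :: "complex^2^2"
  shows "M ** (X - Y) = M ** X - M ** Y"
  by (simp add: matrix_matrix_mult_def vec_eq_iff sum_2 algebra_simps)

lemma krein_fundamental_unique:
  assumes X: "krein_fundamental k A X" and Y: "krein_fundamental k A Y"
    and a: "\<And>t. cmod (A t) \<le> a" and x: "x \<ge> 0"
  shows "X x = Y x"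
proof -
  define M where "M t = (vector [vector [\<i> * k, - cnj (A t)], vector [- A t,  0]] :: complex^2^2)" for t
  obtain D where D: "has_ac_derivative_on X D {0..}" "AE x in lebesgue. x \<ge> 0 \<longrightarrow> D x = M x ** X x"
    using X by (auto simp: krein_fundamental_def M_def)
  obtain D' where D': "has_ac_derivative_on Y D' {0..}" "AE x in lebesgue. x \<ge> 0 \<longrightarrow> D' x = M x ** Y x"
    using Y by (auto simp: krein_fundamental_def M_def)
  have a0: "a \<ge> 0" using a[of 0] norm_ge_zero order_trans by blast
  have m: "cmod (M t $ i $ j) \<le> cmod k + a" for t i j
    using a[of t] a0 exhaust_2[of i] exhaust_2[of j]
    by (auto simp: M_def norm_mult intro: add_increasing)
  have "X x - Y x = 0"
  proof (rule ac_zero[OF has_ac_derivative_on_diff[OF D(1) D'(1)], of 0 x "8 * (cmod k + a)" 0 x])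
    show "AE t in lebesgue. t \<in> {0..x} \<longrightarrow> norm (D t - D' t) \<le> 8 * (cmod k + a) * norm (X t - Y t)"
      using D(2) D'(2)
    proof eventually_elim
      case (elim t)
      then show ?case
        using norm_matrix_mult_le[of "M t", OF m, of "X t - Y t"]
        by (simp add: matrix_mult_diff_right)
    qed
    show "X 0 - Y 0 = 0" using X Y by (simp add: krein_fundamental_def)
  qed (use x in auto)
  then show ?thesis by simp
qed

context bounded_continuous
begin

text \<open>The first column comes from the second by symmetry: for real \<xi>, if
  \<open>(v, u)\<close> solves the system, so does \<open>exp (\<i> \<xi> t)\<close> times
  \<open>(cnj u, cnj v)\<close>. Real parameters suffice, because \<open>krein_arg\<close> sees
  \<open>krein_A\<close> only through its modulus on the real line.\<close>

definition X :: "real \<Rightarrow> real \<Rightarrow> complex^2^2" where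
  "X \<xi> t = vector [vector [exp (\<i> * \<xi> * t) * cnj (u \<xi> t), v \<xi> t],
                  vector [exp (\<i> * \<xi> * t) * cnj (v \<xi> t), u \<xi> t]]"

lemma krein_fundamental_X: "krein_fundamental (of_real \<xi>) A (X \<xi>)"
proof -
  define e where "e t = exp (\<i> * \<xi> * complex_of_real t)" for t
  define D where "D t = (vector [vector [\<i> * of_real \<xi>, - cnj (A t)], vector [- A t,  0]] :: complex^2^2) ** X \<xi> t" for t
  have ce: "continuous_on S e" for S unfolding e_def by (intro continuous_intros)
  have de: "(e has_vector_derivative \<i> * \<xi> * e t) (at t within S)" for t S
    unfolding e_def by (rule has_vector_derivative_exp_linear)
  have Xe: "X \<xi> t = vector [vector [e t * cnj (u \<xi> t), v \<xi> t], vector [e t * cnj (v \<xi> t), u \<xi> t]]" for t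
    by (simp add: X_def e_def)
  note uv = has_vector_derivative_uv[of _ "of_real \<xi>"]
  have "has_ac_derivative_on (X \<xi>) D {0..}"
  proof (rule has_ac_derivative_on_piece[of _ "{}"])
    fix i j :: 2 and t :: real assume t: "t \<in> {0..}"
    then have t: "t \<ge> 0" by simp
    have "((\<lambda>t. e t * cnj (u \<xi> t)) has_vector_derivative
        \<i> * \<xi> * (e t * cnj (u \<xi> t)) - cnj (A t) * (e t * cnj (v \<xi> t))) (at t within {0..})"
      by (rule has_vector_derivative_eq_rhs[OF has_vector_derivative_mult[OF de has_vector_derivative_cnj[OF uv(1)[OF t]]]])
        (simp add: algebra_simps)
    moreover have "((\<lambda>t. e t * cnj (v \<xi> t)) has_vector_derivative - (A t * (e t * cnj (u \<xi> t)))) (at t within {0..})"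
      by (rule has_vector_derivative_eq_rhs[OF has_vector_derivative_mult[OF de has_vector_derivative_cnj[OF uv(2)[OF t]]]])
        (simp add: algebra_simps)
    ultimately show "((\<lambda>t. X \<xi> t $ i $ j) has_vector_derivative D t $ i $ j) (at t within {0..})"
      using exhaust_2[of i] exhaust_2[of j] uv[OF t]
      by (elim disjE) (simp_all add: Xe D_def matrix_matrix_mult_def sum_2)
  next
    fix i j :: 2
    have "continuous_on {0..} (\<lambda>t. X \<xi> t $ i $ j)" for i j
      using exhaust_2[of i] exhaust_2[of j]
      by (elim disjE; simp add: Xe; intro continuous_intros ce continuous_uv)
    then show "continuous_on {0..} (\<lambda>t. D t $ i $ j)"
      using exhaust_2[of i]
      by (elim disjE; simp add: D_def matrix_matrix_mult_def sum_2; intro continuous_on_diff continuous_on_add continuous_on_mult continuous_on_minus continuous_on_cnj continuous_on_const cont_A'; simp)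
  qed (auto simp: is_interval_ci)
  moreover have "X \<xi> 0 = mat 1"
    by (auto simp: X_def vec_eq_iff mat_def forall_2)
  ultimately show ?thesis
    unfolding krein_fundamental_def by (intro conjI exI[of _ D]) (auto simp: D_def)
qed

lemma krein_X_eq:
  assumes "x \<ge> 0"
  shows "krein_X x (of_real \<xi>) A = X \<xi> x"
  unfolding krein_X_def
  using krein_fundamental_X krein_fundamental_unique[OF _ krein_fundamental_X bound_A assms]
  by (intro the_equality) blast+

lemma krein_A_eq: "x \<ge> 0 \<Longrightarrow> krein_A x (of_real \<xi>) A = u \<xi> x"
  by (simp add: krein_A_def krein_X_eq X_def)

end

lemma (in bounded_smooth) krein_arg_eq:
  assumes "x \<ge> 0" "Im k \<ge> 0"
  shows "krein_arg x k A = Im (log_u k x)"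
  using outer_arg_u[OF assms] assms by (simp add: krein_arg_def krein_A_eq)

subsection \<open>Transmission coefficient of a truncated Dirac potential\<close>

text \<open>The coefficient matrix after the Dirac equation has been solved for the
  derivative.\<close>

definition dirac_N :: "real \<Rightarrow> complex \<Rightarrow> complex^2^2" where
  "dirac_N \<xi> c = vector [vector [- \<i> * \<xi> / 2, cnj c], vector [c, \<i> * \<xi> / 2]]"

lemma dirac_equation_iff:
  fixes D T :: "complex^2^2"
  shows "mat \<i> ** sigma3 ** D + mat \<i> ** (mat c ** sigma_minus - mat (cnj c) ** sigma_plus) ** T
      = mat (of_real (\<xi> / 2)) ** T \<longleftrightarrow> D = dirac_N \<xi> c ** T"
proof -
  have eq: "\<i> * p - \<i> * (c * r) = s * x \<longleftrightarrow> p = c * r - \<i> * s * x"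
       "\<i> * (c * r) - \<i> * p = s * x \<longleftrightarrow> p = c * r + \<i> * s * x"
    for p r s x c :: complex
  proof -
    have "\<i> * p - \<i> * (c * r) = s * x \<longleftrightarrow> \<i> * (\<i> * p - \<i> * (c * r)) = \<i> * (s * x)" by simp
    then show "\<i> * p - \<i> * (c * r) = s * x \<longleftrightarrow> p = c * r - \<i> * s * x"
      by (auto simp: algebra_simps)
    have "\<i> * (c * r) - \<i> * p = s * x \<longleftrightarrow> \<i> * (\<i> * (c * r) - \<i> * p) = \<i> * (s * x)" by simp
    then show "\<i> * (c * r) - \<i> * p = s * x \<longleftrightarrow> p = c * r + \<i> * s * x"
      by (auto simp: algebra_simps)
  qed
  have e: "(mat \<i> ** sigma3 ** D + mat \<i> ** (mat c ** sigma_minus - mat (cnj c) ** sigma_plus) ** T) $ 1 $ j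
      = \<i> * D $ 1 $ j - \<i> * (cnj c * T $ 2 $ j)"
    "(mat \<i> ** sigma3 ** D + mat \<i> ** (mat c ** sigma_minus - mat (cnj c) ** sigma_plus) ** T) $ 2 $ j
      = \<i> * (c * T $ 1 $ j) - \<i> * D $ 2 $ j"
    "(mat (of_real (\<xi> / 2)) ** T) $ i $ j = of_real (\<xi> / 2) * T $ i $ j"
    "(dirac_N \<xi> c ** T) $ 1 $ j = cnj c * T $ 2 $ j - \<i> * of_real (\<xi> / 2) * T $ 1 $ j"
    "(dirac_N \<xi> c ** T) $ 2 $ j = c * T $ 1 $ j + \<i> * of_real (\<xi> / 2) * T $ 2 $ j" for i j
    using exhaust_2[of i]
    by (auto simp: matrix_matrix_mult_def sum_2 mat_def sigma3_def sigma_plus_def sigma_minus_def dirac_N_def)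
  show ?thesis
    unfolding vec_eq_iff forall_2 e eq by blast
qed

lemma dirac_solution_iff:
  "dirac_solution \<xi> q T \<longleftrightarrow>
     (\<exists>D. has_ac_derivative_on T D UNIV \<and> (AE x in lebesgue. D x = dirac_N \<xi> (q x) ** T x))"
  unfolding dirac_solution_def dirac_equation_iff ..

lemma norm_dirac_N_mult:
  fixes Z :: "complex^2^2"
  assumes "cmod c \<le> a"
  shows "norm (dirac_N \<xi> c ** Z) \<le> 8 * (\<bar>\<xi>\<bar> / 2 + a) * norm Z"
proof (rule norm_matrix_mult_le)
  fix i j
  have "a \<ge> 0" using assms norm_ge_zero order_trans by blast
  then show "cmod (dirac_N \<xi> c $ i $ j) \<le> \<bar>\<xi>\<bar> / 2 + a"
    using exhaust_2[of i] exhaust_2[of j] assms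
    by (auto simp: dirac_N_def norm_divide norm_mult)
qed

lemma dirac_solution_diff:
  assumes "dirac_solution \<xi> q T" "dirac_solution \<xi> q T'"
  shows "dirac_solution \<xi> q (\<lambda>x. T x - T' x)"
proof -
  obtain D D' where D: "has_ac_derivative_on T D UNIV" "AE x in lebesgue. D x = dirac_N \<xi> (q x) ** T x"
    and D': "has_ac_derivative_on T' D' UNIV" "AE x in lebesgue. D' x = dirac_N \<xi> (q x) ** T' x"
    using assms by (auto simp: dirac_solution_iff)
  have "AE x in lebesgue. D x - D' x = dirac_N \<xi> (q x) ** (T x - T' x)"
    using D(2) D'(2) by eventually_elim (simp add: matrix_mult_diff_right)
  then show ?thesis
    using has_ac_derivative_on_diff[OF D(1) D'(1)] by (auto simp: dirac_solution_iff)
qed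

lemma dirac_solution_mult_right:
  assumes "dirac_solution \<xi> q T"
  shows "dirac_solution \<xi> q (\<lambda>x. T x ** P)"
proof -
  obtain D where D: "has_ac_derivative_on T D UNIV" "AE x in lebesgue. D x = dirac_N \<xi> (q x) ** T x"
    using assms by (auto simp: dirac_solution_iff)
  have "AE x in lebesgue. D x ** P = dirac_N \<xi> (q x) ** (T x ** P)"
    using D(2) by eventually_elim (simp add: matrix_mul_assoc)
  then show ?thesis
    using has_ac_derivative_on_mult_right[OF D(1)] by (auto simp: dirac_solution_iff)
qed

lemma dirac_solution_zero:
  assumes T: "dirac_solution \<xi> q T" and a: "\<And>x. cmod (q x) \<le> a" and c: "T c = 0"
  shows "T x = 0"
proof -
  obtain D where D: "has_ac_derivative_on T D UNIV" "AE x in lebesgue. D x = dirac_N \<xi> (q x) ** T x"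
    using T by (auto simp: dirac_solution_iff)
  show ?thesis
  proof (rule ac_zero[OF D(1), of "min c x" "max c x" "8 * (\<bar>\<xi>\<bar> / 2 + a)" c])
    show "AE x' in lebesgue. x' \<in> {min c x..max c x} \<longrightarrow> norm (D x') \<le> 8 * (\<bar>\<xi>\<bar> / 2 + a) * norm (T x')"
      using D(2)
    proof eventually_elim
      case (elim t)
      show ?case unfolding elim using norm_dirac_N_mult[OF a] by blast
    qed
  qed (use c in auto)
qed

lemma dirac_E_nth [simp]:
  "dirac_E x \<xi> $ 1 $ 1 = exp (- \<i> * \<xi> / 2 * x)" "dirac_E x \<xi> $ 1 $ 2 = 0"
  "dirac_E x \<xi> $ 2 $ 1 = 0" "dirac_E x \<xi> $ 2 $ 2 = exp (\<i> * \<xi> / 2 * x)"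
proof -
  have "of_real \<xi> / (2 * \<i>) = - \<i> * \<xi> / 2" by (simp add: field_simps)
  then show "dirac_E x \<xi> $ 1 $ 1 = exp (- \<i> * \<xi> / 2 * x)" "dirac_E x \<xi> $ 1 $ 2 = 0"
    "dirac_E x \<xi> $ 2 $ 1 = 0" "dirac_E x \<xi> $ 2 $ 2 = exp (\<i> * \<xi> / 2 * x)"
    by (simp_all add: dirac_E_def)
qed

text \<open>Both outer regions of a truncated potential are handled by this; \<open>N\<close> will
  be the single point where such a region touches the closed support.\<close>

lemma free_ac:
  fixes R :: "complex^2^2"
  assumes S: "is_interval S" "finite N"
    and X: "\<And>x. x \<in> S \<Longrightarrow> X x = dirac_E (x - c) \<xi> ** R"
    and D: "\<And>x. x \<in> S - N \<Longrightarrow> D x = dirac_N \<xi> 0 ** X x"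
  shows "has_ac_derivative_on X D S"
proof (rule has_ac_derivative_on_cong[OF _ X[symmetric]])
  have e: "((\<lambda>t. exp (b * complex_of_real (t - c))) has_vector_derivative b * exp (b * of_real (t - c))) (at t within S)"
    for b t
  proof -
    have "((\<lambda>t. exp (b * complex_of_real t) * exp (- b * of_real c)) has_vector_derivative
        (b * exp (b * of_real t)) * exp (- b * of_real c)) (at t within S)"
      by (intro has_vector_derivative_mult_left has_vector_derivative_exp_linear)
    moreover have "exp (b * complex_of_real (t - c)) = exp (b * complex_of_real t) * exp (- b * of_real c)" for t
      by (simp add: exp_add[symmetric] algebra_simps)
    ultimately show ?thesis by (simp add: mult.assoc)
  qed
  define p where "p b t = exp (b * complex_of_real (t - c))" for b t
  have E: "(dirac_E (t - c) \<xi> ** R) $ 1 $ j = p (- \<i> * \<xi> / 2) t * R $ 1 $ j"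
    "(dirac_E (t - c) \<xi> ** R) $ 2 $ j = p (\<i> * \<xi> / 2) t * R $ 2 $ j" for t j
    by (simp_all add: p_def matrix_matrix_mult_def sum_2)
  have N: "(dirac_N \<xi> 0 ** M) $ 1 $ j = - \<i> * \<xi> / 2 * M $ 1 $ j"
    "(dirac_N \<xi> 0 ** M) $ 2 $ j = \<i> * \<xi> / 2 * M $ 2 $ j" for M :: "complex^2^2" and j
    by (simp_all add: dirac_N_def matrix_matrix_mult_def sum_2)
  have dp: "((\<lambda>t. p b t * r) has_vector_derivative b * (p b t * r)) (at t within S)" for b r t
    unfolding p_def mult.assoc[symmetric] by (intro has_vector_derivative_mult_left e)
  have cp: "continuous_on S (p b)" for b
    unfolding p_def by (intro continuous_intros)
  show "has_ac_derivative_on (\<lambda>x. dirac_E (x - c) \<xi> ** R) D S"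
  proof (rule has_ac_derivative_on_piece[OF S, of _ "\<lambda>x. dirac_N \<xi> 0 ** (dirac_E (x - c) \<xi> ** R)"])
    fix t i j assume t: "t \<in> S"
    show "((\<lambda>t. (dirac_E (t - c) \<xi> ** R) $ i $ j) has_vector_derivative
        (dirac_N \<xi> 0 ** (dirac_E (t - c) \<xi> ** R)) $ i $ j) (at t within S)"
      using exhaust_2[of i] by (elim disjE; simp only: E N dp)
  next
    fix i j
    show "continuous_on S (\<lambda>t. (dirac_N \<xi> 0 ** (dirac_E (t - c) \<xi> ** R)) $ i $ j)"
      using exhaust_2[of i]
      by (elim disjE; simp only: E N; intro continuous_on_mult continuous_on_const cp)
  qed (use D X in auto)
qed

lemma dirac_E_mult: "dirac_E x \<xi> ** dirac_E y \<xi> = dirac_E (x + y) \<xi>"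
  by (auto simp: vec_eq_iff forall_2 matrix_matrix_mult_def sum_2 exp_add[symmetric] algebra_simps add_divide_distrib)

lemma dirac_E_0 [simp]: "dirac_E 0 \<xi> = mat 1"
  by (auto simp: vec_eq_iff forall_2 mat_def)

lemma norm_dirac_E_mult:
  fixes Z :: "complex^2^2"
  shows "norm (dirac_E x \<xi> ** Z) \<le> 8 * norm Z"
proof -
  have "norm (dirac_E x \<xi> ** Z) \<le> 8 * 1 * norm Z"
  proof (rule norm_matrix_mult_le)
    fix i j
    show "cmod (dirac_E x \<xi> $ i $ j) \<le> 1"
      using exhaust_2[of i] exhaust_2[of j] by (auto simp: norm_exp_eq_Re)
  qed
  then show ?thesis by simp
qed

lemma dirac_solution_free:
  assumes T: "dirac_solution \<xi> q T" and free: "\<And>t. min c x < t \<Longrightarrow> t < max c x \<Longrightarrow> q t = 0"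
  shows "T x = dirac_E (x - c) \<xi> ** T c"
proof -
  obtain D where D: "has_ac_derivative_on T D UNIV" "AE x in lebesgue. D x = dirac_N \<xi> (q x) ** T x"
    using T by (auto simp: dirac_solution_iff)
  let ?F = "\<lambda>x. dirac_E (x - c) \<xi> ** T c"
  have F: "has_ac_derivative_on ?F (\<lambda>x. dirac_N \<xi> 0 ** ?F x) UNIV"
    by (rule free_ac[of _ "{}"]) auto
  have neg: "AE t in lebesgue. t \<noteq> c" "AE t in lebesgue. t \<noteq> x"
    using AE_completion[OF AE_lborel_singleton] by auto
  have "T x - ?F x = 0"
  proof (rule ac_zero[OF has_ac_derivative_on_diff[OF D(1) F], of "min c x" "max c x" "8 * (\<bar>\<xi>\<bar> / 2 + 0)" c])
    show "AE t in lebesgue. t \<in> {min c x..max c x} \<longrightarrow>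
        norm (D t - dirac_N \<xi> 0 ** ?F t) \<le> 8 * (\<bar>\<xi>\<bar> / 2 + 0) * norm (T t - ?F t)"
      using D(2) neg
    proof eventually_elim
      case (elim t)
      show ?case
      proof
        assume "t \<in> {min c x..max c x}"
        then have "q t = 0" using free[of t] elim by (auto simp: min_def max_def split: if_splits)
        then have "D t - dirac_N \<xi> 0 ** ?F t = dirac_N \<xi> 0 ** (T t - ?F t)"
          using elim by (simp add: matrix_mult_diff_right)
        then show "norm (D t - dirac_N \<xi> 0 ** ?F t) \<le> 8 * (\<bar>\<xi>\<bar> / 2 + 0) * norm (T t - ?F t)"
          using norm_dirac_N_mult[of 0 0 \<xi> "T t - ?F t"] by simp
      qed
    qed
  qed auto
  then show ?thesis by simp
qed

text \<open>On the free side the difference \<open>Z\<close> of two solutions satisfies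
  \<open>Z c = E (c - x) Z x\<close> with diagonal entries of modulus 1. As \<open>Z x\<close> tends
  to 0, so does the bound for the fixed matrix \<open>Z c\<close>.\<close>

lemma dirac_solution_asymptotic_unique:
  assumes T: "dirac_solution \<xi> q T" "dirac_solution \<xi> q T'"
    and lim: "((\<lambda>x. T x - dirac_E x \<xi>) \<longlongrightarrow> 0) F" "((\<lambda>x. T' x - dirac_E x \<xi>) \<longlongrightarrow> 0) F"
    and F: "F \<noteq> bot" and a: "\<And>x. cmod (q x) \<le> a"
    and free: "\<forall>\<^sub>F x in F. \<forall>t. min c x < t \<longrightarrow> t < max c x \<longrightarrow> q t = 0"
  shows "T = T'"
proof -
  define Z where "Z x = T x - T' x" for x
  have Z: "dirac_solution \<xi> q Z" unfolding Z_def by (rule dirac_solution_diff[OF T])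
  have "((\<lambda>x. (T x - dirac_E x \<xi>) - (T' x - dirac_E x \<xi>)) \<longlongrightarrow> 0 - 0) F"
    by (intro tendsto_diff lim)
  then have "((\<lambda>x. 8 * norm (Z x)) \<longlongrightarrow> 0) F"
    unfolding Z_def by (intro tendsto_mult_right_zero tendsto_norm_zero) simp
  moreover have "\<forall>\<^sub>F x in F. norm (Z c) \<le> 8 * norm (Z x)"
    using free
  proof eventually_elim
    case (elim x)
    have "Z c = dirac_E (c - x) \<xi> ** Z x"
      by (rule dirac_solution_free[OF Z]) (use elim in \<open>auto simp: min.commute max.commute\<close>)
    then show ?case using norm_dirac_E_mult[of "c - x" \<xi> "Z x"] by simp
  qed
  ultimately have "norm (Z c) \<le> 0"
    using F by (rule tendsto_lowerbound)
  then have "Z c = 0" by simp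
  then have "Z x = 0" for x by (rule dirac_solution_zero[OF Z a])
  then show ?thesis by (simp add: Z_def fun_eq_iff)
qed

context bounded_continuous
begin

text \<open>This turns out to be the matrix \<open>dirac_T\<close> of the potential truncated to
  \<open>{T1..T1 + h}\<close>. The exponentials in the off-diagonal entries record where the
  interval lies.\<close>

definition scattering :: "real \<Rightarrow> real \<Rightarrow> real \<Rightarrow> complex^2^2" where
  "scattering \<xi> T1 h =
     vector [vector [u \<xi> h, exp (\<i> * \<xi> * (T1 + h)) * cnj (v \<xi> h)],
             vector [exp (- \<i> * \<xi> * (T1 + h)) * v \<xi> h, cnj (u \<xi> h)]]"

lemma scattering_inverse:
  assumes "h \<ge> 0"
  obtains P where "scattering \<xi> T1 h ** P = mat 1" "P ** scattering \<xi> T1 h = mat 1"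
proof -
  have "det (scattering \<xi> T1 h) = u \<xi> h * cnj (u \<xi> h) - v \<xi> h * cnj (v \<xi> h) * (exp (\<i> * \<xi> * (T1 + h)) * exp (- \<i> * \<xi> * (T1 + h)))"
    by (simp add: scattering_def det_2 mult_ac)
  also have "exp (\<i> * \<xi> * (T1 + h)) * exp (- \<i> * \<xi> * (T1 + h)) = 1"
    by (simp add: exp_add[symmetric])
  finally have "det (scattering \<xi> T1 h) = of_real ((cmod (u \<xi> h))\<^sup>2 - (cmod (v \<xi> h))\<^sup>2)"
    by (simp add: complex_norm_square del: of_real_power)
  moreover have "(cmod (u \<xi> h))\<^sup>2 - (cmod (v \<xi> h))\<^sup>2 \<noteq> 0"
    using energy[of "of_real \<xi>" h] assms by (smt (verit) Im_complex_of_real)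
  ultimately have "det (scattering \<xi> T1 h) \<noteq> 0" by (simp only: of_real_eq_0_iff not_False_eq_True)
  then have "invertible (scattering \<xi> T1 h)" by (simp add: invertible_det_nz)
  then show ?thesis using that by (auto simp: invertible_def)
qed

text \<open>Variation of constants for the left Jost solution. Clamping the argument makes the
  scattering factor the identity to the left of \<open>T1\<close> and constant to the right of
  \<open>T2\<close>.\<close>

definition dirac_J :: "real \<Rightarrow> real \<Rightarrow> real \<Rightarrow> real \<Rightarrow> complex^2^2" where
  "dirac_J \<xi> T1 T2 x = dirac_E x \<xi> ** scattering \<xi> T1 (max 0 (min x T2 - T1))"

text \<open>With \<open>A = - cnj q\<close> after translation by \<open>T1\<close>, multiplying
  \<open>(u, v)\<close> by \<open>exp (- \<i> \<xi> x / 2)\<close> distributes the diagonal term of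
  the Krein system symmetrically and gives a solution of the Dirac equation. The second column is
  the conjugate of the first with its entries exchanged.\<close>

lemma dirac_solution_J:
  assumes T: "T1 < T2" and q: "\<And>x. A x = - cnj (q (x + T1))"
  shows "dirac_solution \<xi> (cutoff T1 T2 q) (dirac_J \<xi> T1 T2)"
proof -
  let ?J = "dirac_J \<xi> T1 T2"
  define D where "D x = dirac_N \<xi> (cutoff T1 T2 q x) ** ?J x" for x
  \<comment> \<open>\<open>cutoff\<close> keeps the value of the potential at the endpoint itself,
    so the free equation is claimed only away from \<open>T1\<close>.\<close>
  have 1: "has_ac_derivative_on ?J D {..T1}"
    by (rule free_ac[of _ "{T1}" _ 0 _ "scattering \<xi> T1 0"])
      (auto simp: is_interval_ic dirac_J_def D_def cutoff_def)
  have 3: "has_ac_derivative_on ?J D {T2..}"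
    by (rule free_ac[of _ "{T2}" _ 0 _ "scattering \<xi> T1 (T2 - T1)"])
      (use T in \<open>auto simp: is_interval_ci dirac_J_def D_def cutoff_def\<close>)
  have 2: "has_ac_derivative_on ?J D {T1..T2}"
  proof -
    define U where "U x = u \<xi> (x - T1)" for x
    define V where "V x = v \<xi> (x - T1)" for x
    define e where "e x = exp (- \<i> * \<xi> / 2 * complex_of_real x)" for x
    define Y where "Y x = (vector [vector [e x * U x, cnj (e x) * cnj (V x)],
                            vector [e x * V x, cnj (e x) * cnj (U x)]] :: complex^2^2)" for x
    have shift: "((\<lambda>x. f (x - T1)) has_vector_derivative f') (at x within {T1..T2})"
      if "(f has_vector_derivative f') (at (x - T1) within {0..})" for f :: "real \<Rightarrow> complex" and f' x
    proof -
      have "((\<lambda>x. x - T1) has_vector_derivative 1 - 0) (at x within {T1..T2})"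
        by (intro has_vector_derivative_diff has_vector_derivative_id has_vector_derivative_const)
      moreover have "(f has_vector_derivative f') (at (x - T1) within (\<lambda>x. x - T1) ` {T1..T2})"
        by (rule has_vector_derivative_within_subset[OF that]) auto
      ultimately show ?thesis
        using vector_diff_chain_within[of "\<lambda>x. x - T1" 1 x "{T1..T2}" f f'] by (simp add: o_def)
    qed
    have dU: "(U has_vector_derivative cnj (q x) * V x) (at x within {T1..T2})"
      and dV: "(V has_vector_derivative \<i> * \<xi> * V x + q x * U x) (at x within {T1..T2})"
      if "x \<in> {T1..T2}" for x
      using shift[OF has_vector_derivative_uv(1)[of "x - T1" \<xi>]]
        shift[OF has_vector_derivative_uv(2)[of "x - T1" \<xi>]] that
      by (auto simp: U_def[abs_def] V_def[abs_def] q)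
    have de: "(e has_vector_derivative - \<i> * \<xi> / 2 * e x) (at x within {T1..T2})" for x
      unfolding e_def by (rule has_vector_derivative_exp_linear)
    have cq: "continuous_on S q" for S
    proof -
      have "q = (\<lambda>x. - cnj (A (x - T1)))" by (simp add: fun_eq_iff q)
      moreover have "continuous_on S (\<lambda>x. - cnj (A (x - T1)))"
        by (intro continuous_intros continuous_on_compose2[OF cont_A]) auto
      ultimately show ?thesis by simp
    qed
    have cUV: "continuous_on {T1..T2} U" "continuous_on {T1..T2} V" "continuous_on {T1..T2} e"
      using dU dV de has_vector_derivative_continuous
      unfolding continuous_on_eq_continuous_within by blast+
    have YJ: "Y x = ?J x" if "x \<in> {T1..T2}" for x
    proof -
      have m: "max 0 (min x T2 - T1) = x - T1" using that by auto
      have "exp (- \<i> * \<xi> / 2 * x) * exp (\<i> * \<xi> * x) = exp (\<i> * \<xi> / 2 * x)"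
        "exp (\<i> * \<xi> / 2 * x) * exp (- \<i> * \<xi> * x) = exp (- \<i> * \<xi> / 2 * x)"
        by (simp_all add: exp_add[symmetric] field_simps)
      moreover have "cnj (e x) = exp (\<i> * \<xi> / 2 * x)" by (simp add: e_def exp_cnj)
      ultimately show ?thesis
        by (simp add: vec_eq_iff forall_2 Y_def dirac_J_def m scattering_def matrix_matrix_mult_def sum_2
            U_def V_def e_def flip: mult.assoc)
    qed
    have "has_ac_derivative_on Y D {T1..T2}"
    proof (rule has_ac_derivative_on_piece[of _ "{}", where D'="\<lambda>x. dirac_N \<xi> (q x) ** Y x"])
      fix t i j assume t: "t \<in> {T1..T2}"
      note dU = dU[OF t] and dV = dV[OF t]
      have "((\<lambda>t. e t * U t) has_vector_derivative - \<i> * \<xi> / 2 * (e t * U t) + cnj (q t) * (e t * V t)) (at t within {T1..T2})"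
        by (rule has_vector_derivative_eq_rhs[OF has_vector_derivative_mult[OF de dU]]) (simp add: algebra_simps)
      moreover have "((\<lambda>t. e t * V t) has_vector_derivative q t * (e t * U t) + \<i> * \<xi> / 2 * (e t * V t)) (at t within {T1..T2})"
        by (rule has_vector_derivative_eq_rhs[OF has_vector_derivative_mult[OF de dV]]) (simp add: field_simps)
      moreover have "((\<lambda>t. cnj (e t) * cnj (V t)) has_vector_derivative
          - \<i> * \<xi> / 2 * (cnj (e t) * cnj (V t)) + cnj (q t) * (cnj (e t) * cnj (U t))) (at t within {T1..T2})"
        by (rule has_vector_derivative_eq_rhs[OF has_vector_derivative_mult[OF
                has_vector_derivative_cnj[OF de] has_vector_derivative_cnj[OF dV]]]) (simp add: field_simps)
      moreover have "((\<lambda>t. cnj (e t) * cnj (U t)) has_vector_derivative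
          q t * (cnj (e t) * cnj (V t)) + \<i> * \<xi> / 2 * (cnj (e t) * cnj (U t))) (at t within {T1..T2})"
        by (rule has_vector_derivative_eq_rhs[OF has_vector_derivative_mult[OF
                has_vector_derivative_cnj[OF de] has_vector_derivative_cnj[OF dU]]]) (simp add: algebra_simps)
      ultimately show "((\<lambda>t. Y t $ i $ j) has_vector_derivative (dirac_N \<xi> (q t) ** Y t) $ i $ j) (at t within {T1..T2})"
        using exhaust_2[of i] exhaust_2[of j]
        by (elim disjE) (simp_all add: Y_def dirac_N_def matrix_matrix_mult_def sum_2)
    next
      fix i j :: 2
      have "continuous_on {T1..T2} (\<lambda>t. Y t $ i $ j)" for i j
        using exhaust_2[of i] exhaust_2[of j]
        by (elim disjE; simp add: Y_def; intro continuous_intros cUV)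
      then show "continuous_on {T1..T2} (\<lambda>t. (dirac_N \<xi> (q t) ** Y t) $ i $ j)"
        using exhaust_2[of i]
        by (elim disjE; simp add: dirac_N_def matrix_matrix_mult_def sum_2; intro continuous_on_diff continuous_on_add continuous_on_mult continuous_on_divide continuous_on_minus continuous_on_cnj continuous_on_const cq; simp)
    next
      fix t assume "t \<in> {T1..T2} - {}"
      then show "D t = dirac_N \<xi> (q t) ** Y t"
        using YJ[of t] by (simp add: D_def cutoff_def)
    qed (auto simp: is_interval_cc)
    then show ?thesis
      by (rule has_ac_derivative_on_cong[OF _ YJ])
  qed
  have "has_ac_derivative_on ?J D (({..T1} \<union> {T1..T2}) \<union> {T2..})"
    by (intro has_ac_derivative_on_glue[of _ _ _ _ T2] has_ac_derivative_on_glue[of _ _ _ _ T1] 1 2 3)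
      (use T in auto)
  moreover have "({..T1} \<union> {T1..T2}) \<union> {T2..} = UNIV" using T by auto
  ultimately show ?thesis
    unfolding dirac_solution_iff D_def by auto
qed

text \<open>\<open>dirac_J\<close> equals \<open>dirac_E\<close> on the left and
  \<open>dirac_E ** S\<close> on the right, where \<open>S\<close> is the scattering matrix.
  Dividing by \<open>S\<close> therefore gives the right Jost solution, and \<open>S\<close> itself
  connects the two.\<close>

lemma dirac_a_eq:
  assumes T: "T1 < T2" and q: "\<And>x. A x = - cnj (q (x + T1))"
  shows "dirac_a \<xi> (cutoff T1 T2 q) = u \<xi> (T2 - T1)"
proof -
  let ?q = "cutoff T1 T2 q" and ?J = "dirac_J \<xi> T1 T2" and ?S = "scattering \<xi> T1 (T2 - T1)"
  have S0: "scattering \<xi> T1 0 = mat 1"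
    by (simp add: scattering_def vec_eq_iff forall_2 mat_def)
  obtain P where P: "?S ** P = mat 1" "P ** ?S = mat 1"
    using scattering_inverse[of "T2 - T1" \<xi> T1] T by auto
  have bound: "cmod (?q x) \<le> a" for x
    using bound_A[of "x - T1"] q[of "x - T1"] a_nonneg by (auto simp: cutoff_def indicator_def)
  note sol = dirac_solution_J[OF T q, of \<xi>]
  define K where "K x = ?J x ** P" for x
  have solK: "dirac_solution \<xi> ?q K" unfolding K_def by (rule dirac_solution_mult_right[OF sol])
  have J1: "?J x = dirac_E x \<xi>" if "x \<le> T1" for x
    using that T by (simp add: dirac_J_def S0)
  have J2: "?J x = dirac_E x \<xi> ** ?S" if "x \<ge> T2" for x
    using that T by (simp add: dirac_J_def)
  have K2: "K x = dirac_E x \<xi>" if "x \<ge> T2" for x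
    using J2[OF that] P by (simp add: K_def flip: matrix_mul_assoc)
  have limJ: "((\<lambda>x. ?J x - dirac_E x \<xi>) \<longlongrightarrow> 0) at_bot"
    by (intro tendsto_eventually eventually_mono[OF eventually_le_at_bot[of T1]]) (simp add: J1)
  have limK: "((\<lambda>x. K x - dirac_E x \<xi>) \<longlongrightarrow> 0) at_top"
    by (intro tendsto_eventually eventually_mono[OF eventually_ge_at_top[of T2]]) (simp add: K2)
  have minus: "jost_minus \<xi> ?q = ?J"
    unfolding jost_minus_def
  proof (rule the_equality)
    fix T assume H: "dirac_solution \<xi> ?q T \<and> ((\<lambda>x. T x - dirac_E x \<xi>) \<longlongrightarrow> 0) at_bot"
    show "T = ?J"
    proof (rule dirac_solution_asymptotic_unique[OF _ sol _ limJ trivial_limit_at_bot_linorder bound])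
      show "\<forall>\<^sub>F x in at_bot. \<forall>t>min T1 x. t < max T1 x \<longrightarrow> ?q t = 0"
        using eventually_le_at_bot[of T1]
        by eventually_elim (auto simp: cutoff_def indicator_def max_def)
    qed (use H in auto)
  qed (use sol limJ in auto)
  have plus: "jost_plus \<xi> ?q = K"
    unfolding jost_plus_def
  proof (rule the_equality)
    fix T assume H: "dirac_solution \<xi> ?q T \<and> ((\<lambda>x. T x - dirac_E x \<xi>) \<longlongrightarrow> 0) at_top"
    show "T = K"
    proof (rule dirac_solution_asymptotic_unique[OF _ solK _ limK trivial_limit_at_top_linorder bound])
      show "\<forall>\<^sub>F x in at_top. \<forall>t>min T2 x. t < max T2 x \<longrightarrow> ?q t = 0"
        using eventually_ge_at_top[of T2]
        by eventually_elim (auto simp: cutoff_def indicator_def min_def)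
    qed (use H in auto)
  qed (use solK limK in auto)
  have "dirac_T \<xi> ?q = ?S"
    unfolding dirac_T_def minus plus
  proof (rule the_equality)
    show "\<forall>x. ?J x = K x ** ?S"
      by (simp add: K_def P flip: matrix_mul_assoc)
    fix M assume "\<forall>x. ?J x = K x ** M"
    then have "dirac_E T2 \<xi> ** ?S = dirac_E T2 \<xi> ** M" using J2[of T2] K2[of T2] by simp
    then have "dirac_E (- T2) \<xi> ** dirac_E T2 \<xi> ** ?S = dirac_E (- T2) \<xi> ** dirac_E T2 \<xi> ** M"
      by (metis matrix_mul_assoc)
    then show "M = ?S" by (simp add: dirac_E_mult)
  qed
  then show ?thesis by (simp add: dirac_a_def scattering_def)
qed

end

subsection \<open>Growth of the argument during a sweep\<close>

lemma nondecreasing_within: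
  fixes f :: "real \<Rightarrow> real"
  assumes "a \<le> b" "\<And>t. t \<in> {a..b} \<Longrightarrow> (f has_real_derivative f' t) (at t within {a..b})"
    "\<And>t. t \<in> {a..b} \<Longrightarrow> f' t \<ge> 0"
  shows "f a \<le> f b"
proof -
  have "(f' has_integral f b - f a) {a..b}"
    using assms by (intro fundamental_theorem_of_calculus) (auto simp: has_real_derivative_iff_has_vector_derivative)
  then have "f b - f a \<ge> 0" by (rule has_integral_nonneg) (use assms in auto)
  then show ?thesis by simp
qed

context bounded_continuous
begin

text \<open>In the rotating frame \<open>y = exp (- \<i> \<phi>) w\<close> the Riccati equation
  reads \<open>y' = \<i> \<nu> y - g + g y^2\<close>, and the argument of \<open>u\<close> has
  derivative \<open>- g Im y\<close>. When \<nu> dominates \<open>g\<close>, the powers of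
  \<open>y\<close> oscillate and average out, leaving the positive drift \<open>g^2 / \<nu>\<close>.
  Only \<open>cmod y \<le> 1\<close> is known at the left endpoint, which makes the bound
  independent of the past. Since \<open>\<kappa> \<psi>' \<le> g^2\<close>, the drift is at least
  \<kappa> times the decrease rate of \<open>ln \<nu>\<close>.\<close>

lemma log_u_growth:
  fixes g g' \<phi> \<psi> \<psi>' :: "real \<Rightarrow> real" and \<xi> \<kappa> \<alpha> \<beta> :: real
  assumes \<alpha>\<beta>: "0 \<le> \<alpha>" "\<alpha> \<le> \<beta>"
    and A: "\<And>t. A t = of_real (g t) * exp (- \<i> * \<phi> t)"
    and d\<phi>: "\<And>t. (\<phi> has_real_derivative \<psi> t) (at t)"
    and dg: "\<And>t. (g has_real_derivative g' t) (at t)"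
    and d\<psi>: "\<And>t. (\<psi> has_real_derivative \<psi>' t) (at t)"
    and g: "\<And>t. t \<in> {\<alpha>..\<beta>} \<Longrightarrow> 0 < g t" "\<And>t. t \<in> {\<alpha>..\<beta>} \<Longrightarrow> 4 * g t \<le> \<xi> - \<psi> t"
    and g': "\<And>t. t \<in> {\<alpha>..\<beta>} \<Longrightarrow> g' t \<le> 0" "\<And>t. t \<in> {\<alpha>..\<beta>} \<Longrightarrow> - g' t \<le> (g t)\<^sup>2 / 8"
    and \<psi>': "\<And>t. t \<in> {\<alpha>..\<beta>} \<Longrightarrow> 0 \<le> \<psi>' t" "\<And>t. t \<in> {\<alpha>..\<beta>} \<Longrightarrow> \<kappa> * \<psi>' t \<le> (g t)\<^sup>2"
  shows "Im (log_u \<xi> \<beta>) - Im (log_u \<xi> \<alpha>) \<ge> 3 / 16 * \<kappa> * (ln (\<xi> - \<psi> \<alpha>) - ln (\<xi> - \<psi> \<beta>)) - 1"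
proof -
  define \<nu> where "\<nu> t = \<xi> - \<psi> t" for t
  define \<rho> where "\<rho> t = g t / \<nu> t" for t
  define \<rho>' where "\<rho>' t = g' t / \<nu> t + g t * \<psi>' t / (\<nu> t)\<^sup>2" for t
  define y where "y t = exp (- \<i> * \<phi> t) * w \<xi> t" for t
  have k: "Im (complex_of_real \<xi>) \<ge> 0" by simp
  have pos: "\<nu> t > 0" "\<rho> t > 0" "\<rho> t \<le> 1/4" "\<rho> t * \<nu> t = g t" if "t \<in> {\<alpha>..\<beta>}" for t
    using g(1)[OF that] g(2)[OF that] by (auto simp: \<nu>_def \<rho>_def field_simps)
  have ny: "cmod (y t) \<le> 1" if "t \<in> {\<alpha>..\<beta>}" for t
    using norm_w[OF k, of t] that \<alpha>\<beta> by (simp add: y_def norm_mult norm_exp_eq_Re)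
  have Aw: "A t * w \<xi> t = g t * y t" for t by (simp add: A y_def)
  define dy where "dy t = \<i> * \<nu> t * y t - g t + g t * (y t)\<^sup>2" for t
  have dy: "(y has_vector_derivative dy t) (at t within {\<alpha>..\<beta>})" if t: "t \<in> {\<alpha>..\<beta>}" for t
  proof -
    have "((\<lambda>t. - \<i> * complex_of_real (\<phi> t)) has_vector_derivative - \<i> * \<psi> t) (at t within {\<alpha>..\<beta>})"
      by (intro has_vector_derivative_mult_right has_vector_derivative_of_real has_field_derivative_at_within[OF d\<phi>])
    note e = has_vector_derivative_exp_complex[OF this]
    have W: "(w \<xi> has_vector_derivative \<i> * \<xi> * w \<xi> t - cnj (A t) + A t * (w \<xi> t)\<^sup>2) (at t within {\<alpha>..\<beta>})"
      by (rule has_vector_derivative_within_subset[OF has_vector_derivative_w[OF k]]) (use t \<alpha>\<beta> in auto)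
    have c: "exp (- \<i> * \<phi> t) * cnj (A t) = g t"
      by (simp add: A exp_cnj exp_minus field_simps)
    show ?thesis
      unfolding y_def[abs_def]
    proof (rule has_vector_derivative_eq_rhs[OF has_vector_derivative_mult[OF e W]])
      have "exp (- \<i> * \<phi> t) * (\<i> * \<xi> * w \<xi> t - cnj (A t) + A t * (w \<xi> t)\<^sup>2)
          = \<i> * \<xi> * y t - exp (- \<i> * \<phi> t) * cnj (A t) + g t * (y t)\<^sup>2"
        by (simp add: y_def A power2_eq_square algebra_simps)
      then show "exp (- \<i> * \<phi> t) * (\<i> * \<xi> * w \<xi> t - cnj (A t) + A t * (w \<xi> t)\<^sup>2)
          + exp (- \<i> * \<phi> t) * (- \<i> * \<psi> t) * w \<xi> t = dy t"
        unfolding c by (simp add: dy_def \<nu>_def y_def algebra_simps)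
    qed
  qed
  have dRe: "((\<lambda>t. Re (y t)) has_real_derivative Re (dy t)) (at t within {\<alpha>..\<beta>})"
    and dIm: "((\<lambda>t. Im (y t)) has_real_derivative Im (dy t)) (at t within {\<alpha>..\<beta>})" if "t \<in> {\<alpha>..\<beta>}" for t
    using bounded_linear.has_vector_derivative[OF bounded_linear_Re dy[OF that]]
      bounded_linear.has_vector_derivative[OF bounded_linear_Im dy[OF that]]
    by (auto simp: has_real_derivative_iff_has_vector_derivative)
  have dL: "((\<lambda>t. Im (log_u \<xi> t)) has_real_derivative - (g t * Im (y t))) (at t within {\<alpha>..\<beta>})"
    if t: "t \<in> {\<alpha>..\<beta>}" for t
  proof -
    have "(log_u \<xi> has_vector_derivative - (g t * y t)) (at t within {\<alpha>..\<beta>})"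
      by (rule has_vector_derivative_within_subset[OF has_vector_derivative_log_u[OF k, of t, unfolded Aw]])
        (use t \<alpha>\<beta> in auto)
    from bounded_linear.has_vector_derivative[OF bounded_linear_Im this] show ?thesis
      by (simp add: has_real_derivative_iff_has_vector_derivative)
  qed
  have d\<nu>: "(\<nu> has_real_derivative - \<psi>' t) (at t within {\<alpha>..\<beta>})" for t
    unfolding \<nu>_def[abs_def] by (rule derivative_eq_intros has_field_derivative_at_within[OF d\<psi>] refl)+ simp
  have d\<rho>: "(\<rho> has_real_derivative \<rho>' t) (at t within {\<alpha>..\<beta>})" if t: "t \<in> {\<alpha>..\<beta>}" for t
    unfolding \<rho>_def[abs_def] \<rho>'_def
    by (rule derivative_eq_intros has_field_derivative_at_within[OF dg] d\<nu> refl)+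
      (use pos(1)[OF t] in \<open>auto simp: field_simps power2_eq_square\<close>)
  \<comment> \<open>The oscillating part of \<open>(log u)' = - g y\<close> is removed by substituting \<open>y = (y' + g - g y\<^sup>2) / (\<i> \<nu>)\<close>
    and integrating by parts, once for \<open>y\<close> and once more for the resulting \<open>y\<^sup>2\<close>; the last bracket is the
    antiderivative of the lower bound for what remains.\<close>
  define h where "h t = Im (log_u \<xi> t) - \<rho> t * Re (y t) + (\<rho> t)\<^sup>2 * (Re (y t) * Im (y t))
     + (3 / 16 * \<kappa> * ln (\<nu> t) + 5 / 4 * \<rho> t)" for t
  define h' where "h' t = - (g t * Im (y t)) - (\<rho>' t * Re (y t) + \<rho> t * Re (dy t))
     + (2 * \<rho> t * \<rho>' t * (Re (y t) * Im (y t)) + (\<rho> t)\<^sup>2 * (Re (dy t) * Im (y t) + Re (y t) * Im (dy t)))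
     + (3 / 16 * \<kappa> * (- \<psi>' t / \<nu> t) + 5 / 4 * \<rho>' t)" for t
  have "h \<alpha> \<le> h \<beta>"
  proof (rule nondecreasing_within[OF \<alpha>\<beta>(2), of h h'])
    fix t assume t: "t \<in> {\<alpha>..\<beta>}"
    show "(h has_real_derivative h' t) (at t within {\<alpha>..\<beta>})"
      unfolding h_def[abs_def] h'_def
      by (rule derivative_eq_intros dL[OF t] dRe[OF t] dIm[OF t] d\<rho>[OF t] d\<nu> refl pos(1)[OF t])+
        (simp add: algebra_simps)
    note p = pos[OF t]
    define a b where "a = Re (y t)" and "b = Im (y t)"
    have y2: "a\<^sup>2 + b\<^sup>2 \<le> 1" using ny[OF t] by (simp add: a_def b_def cmod_def)
    have RI: "Re (dy t) = - (\<nu> t * b) - g t + g t * (a\<^sup>2 - b\<^sup>2)" "Im (dy t) = \<nu> t * a + g t * (2 * a * b)"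
      by (simp_all add: dy_def a_def b_def power2_eq_square)
    \<comment> \<open>All terms linear and quadratic in \<open>y\<close> without a factor
      \<open>\<rho>'\<close> or \<open>\<rho>^2\<close> cancel. The drift \<open>\<rho> g\<close>
      remains, and the cubic expression is the imaginary part of \<open>y^3 - y\<close>.\<close>
    have eq: "h' t = \<rho> t * g t - \<rho>' t * a + \<rho> t * \<rho>' t * (2 * a * b)
      + (\<rho> t)\<^sup>2 * g t * (3 * a\<^sup>2 * b - b ^ 3 - b) - 3 / 16 * \<kappa> * (\<psi>' t / \<nu> t) + 5 / 4 * \<rho>' t"
      unfolding h'_def RI a_def[symmetric] b_def[symmetric] p(4)[symmetric]
      by (simp add: algebra_simps power2_eq_square power3_eq_cube)
    have absa: "\<bar>a\<bar> \<le> 1" using ny[OF t] abs_Re_le_cmod[of "y t"] by (simp add: a_def)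
    have ab: "\<bar>2 * a * b\<bar> \<le> 1"
      using y2 sum_squares_bound[of a b] sum_squares_bound[of a "- b"] by (simp add: abs_le_iff)
    have abs3: "\<bar>3 * a\<^sup>2 * b - b ^ 3 - b\<bar> \<le> 2"
    proof -
      have "Im (y t ^ 3 - y t) = 3 * a\<^sup>2 * b - b ^ 3 - b"
        by (simp add: a_def b_def power3_eq_cube power2_eq_square algebra_simps)
      moreover have "cmod (y t ^ 3 - y t) \<le> 1 + 1"
        using ny[OF t] by (intro order_trans[OF norm_triangle_ineq4] add_mono) (auto simp: norm_power power_le_one)
      ultimately show ?thesis using abs_Im_le_cmod[of "y t ^ 3 - y t"] by simp
    qed
    have g0: "g t > 0" using g(1)[OF t] .
    have 1: "(\<rho> t)\<^sup>2 * g t * (3 * a\<^sup>2 * b - b ^ 3 - b) \<ge> - (1 / 2 * (\<rho> t * g t))"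
    proof -
      have "\<bar>(\<rho> t)\<^sup>2 * g t * (3 * a\<^sup>2 * b - b ^ 3 - b)\<bar> \<le> (\<rho> t)\<^sup>2 * g t * 2"
        unfolding abs_mult using abs3 p g0 by (intro mult_mono) auto
      also have "\<dots> \<le> 1 / 2 * (\<rho> t * g t)"
        using mult_right_mono[OF p(3), of "2 * (\<rho> t * g t)"] p(2) g0 by (simp add: power2_eq_square mult_ac)
      finally show ?thesis by linarith
    qed
    have 2: "\<bar>- \<rho>' t * a + \<rho> t * \<rho>' t * (2 * a * b)\<bar> \<le> 5 / 4 * \<bar>\<rho>' t\<bar>"
    proof -
      have "\<bar>- \<rho>' t * a\<bar> \<le> \<bar>\<rho>' t\<bar> * 1"
        unfolding abs_mult using absa by (intro mult_mono) auto
      moreover have "\<bar>\<rho> t * \<rho>' t * (2 * a * b)\<bar> \<le> (1 / 4 * \<bar>\<rho>' t\<bar>) * 1"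
        unfolding abs_mult[of "\<rho> t * \<rho>' t"] abs_mult[of "\<rho> t"] using ab p by (intro mult_mono) auto
      ultimately show ?thesis by linarith
    qed
    \<comment> \<open>The part of \<open>\<rho>'\<close> coming from the sweep is nonnegative, so
      replacing the absolute value by \<open>\<rho>'\<close> costs only twice the part coming from
      the decay of \<open>g\<close>. What is left is an exact derivative, compensated by the summand
      \<open>5 / 4 * \<rho>\<close> of \<open>h\<close>.\<close>
    have 3: "\<bar>\<rho>' t\<bar> \<le> \<rho>' t + 1 / 4 * (\<rho> t * g t)"
    proof -
      have n: "- (g' t / \<nu> t) \<le> 1 / 8 * (\<rho> t * g t)"
        using divide_right_mono[OF g'(2)[OF t], of "\<nu> t"] p(1) by (simp add: \<rho>_def power2_eq_square field_simps)
      moreover have "g t * \<psi>' t / (\<nu> t)\<^sup>2 \<ge> 0" using g0 \<psi>'(1)[OF t] by simp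
      moreover have "g' t / \<nu> t \<le> 0" using g'(1)[OF t] p(1) by (simp add: divide_nonpos_pos)
      ultimately show ?thesis unfolding \<rho>'_def by linarith
    qed
    have 4: "\<kappa> * (\<psi>' t / \<nu> t) \<le> \<rho> t * g t"
      using divide_right_mono[OF \<psi>'(2)[OF t], of "\<nu> t"] p(1) by (simp add: \<rho>_def power2_eq_square)
    \<comment> \<open>Of the drift \<open>\<rho> g\<close>, one half pays for the cubic term and
      \<open>5 / 4 * 1 / 4 = 5 / 16\<close> for the terms with \<open>\<rho>'\<close>. The remaining
      \<open>3 / 16\<close> is the constant of the statement.\<close>
    show "h' t \<ge> 0"
      unfolding eq using 1 2 3 4 by linarith
  qed
  moreover have "\<bar>\<rho> t * Re (y t)\<bar> \<le> 1 / 4 \<and> \<bar>(\<rho> t)\<^sup>2 * (Re (y t) * Im (y t))\<bar> \<le> 1 / 16" if "t \<in> {\<alpha>..\<beta>}" for t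
  proof -
    note p = pos[OF that]
    have "\<bar>Re (y t)\<bar> \<le> 1" "\<bar>Im (y t)\<bar> \<le> 1"
      using ny[OF that] abs_Re_le_cmod[of "y t"] abs_Im_le_cmod[of "y t"] by auto
    moreover from this have "\<bar>Re (y t)\<bar> * \<bar>Im (y t)\<bar> \<le> 1 * 1" by (intro mult_mono) auto
    moreover have "(\<rho> t)\<^sup>2 \<le> (1 / 4)\<^sup>2" using p by (intro power_mono) auto
    ultimately show ?thesis
      using p mult_mono[of "\<rho> t" "1/4" "\<bar>Re (y t)\<bar>" 1] mult_mono[of "(\<rho> t)\<^sup>2" "1/16" "\<bar>Re (y t)\<bar> * \<bar>Im (y t)\<bar>" 1]
      by (simp add: abs_mult power2_eq_square)
  qed
  from this[of \<alpha>] this[of \<beta>] have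
    "\<bar>\<rho> \<alpha> * Re (y \<alpha>)\<bar> \<le> 1 / 4" "\<bar>(\<rho> \<alpha>)\<^sup>2 * (Re (y \<alpha>) * Im (y \<alpha>))\<bar> \<le> 1 / 16"
    "\<bar>\<rho> \<beta> * Re (y \<beta>)\<bar> \<le> 1 / 4" "\<bar>(\<rho> \<beta>)\<^sup>2 * (Re (y \<beta>) * Im (y \<beta>))\<bar> \<le> 1 / 16"
    using \<alpha>\<beta> by auto
  moreover have "\<rho> \<beta> \<le> 1/4" "\<rho> \<alpha> \<ge> 0" using pos[of \<alpha>] pos[of \<beta>] \<alpha>\<beta> by auto
  \<comment> \<open>The boundary terms cost at most
    \<open>2 / 4 + 2 / 16 + 5 / 16 = 15 / 16\<close>, which is below the subtracted 1.\<close>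
  ultimately show ?thesis
    unfolding h_def \<nu>_def[symmetric] right_diff_distrib by linarith
qed

end

subsection \<open>The chirp\<close>

definition slow :: "real \<Rightarrow> real" where
  "slow x = arsinh (arsinh x)"

definition slow' :: "real \<Rightarrow> real" where
  "slow' x = 1 / (sqrt (1 + (arsinh x)\<^sup>2) * sqrt (1 + x\<^sup>2))"

lemma one_plus_square_pos [simp]: "0 < 1 + (x::real)\<^sup>2" "1 + (x::real)\<^sup>2 \<noteq> 0"
  by (auto simp: add_pos_nonneg add_nonneg_eq_0_iff)

lemma DERIV_arsinh: "(arsinh has_real_derivative 1 / sqrt (1 + x\<^sup>2)) (at x)"
  using arsinh_real_has_field_derivative[of x UNIV] by (simp add: add.commute)

lemma DERIV_slow: "(slow has_real_derivative slow' x) (at x)"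
  using DERIV_chain2[OF DERIV_arsinh DERIV_arsinh, of x]
  by (simp add: slow_def[abs_def] slow'_def)

lemma slow'_pos: "slow' x > 0"
  by (simp add: slow'_def)

lemma sqrt_1_plus_ge_1: "1 \<le> sqrt (1 + (x::real)\<^sup>2)"
  by (simp add: real_le_rsqrt)

lemma slow'_le: "slow' x \<le> 1 / sqrt (1 + x\<^sup>2)"
  unfolding slow'_def
  using mult_right_mono[OF sqrt_1_plus_ge_1[of "arsinh x"], of "sqrt (1 + x\<^sup>2)"]
  by (intro divide_left_mono) (auto intro!: mult_pos_pos)

lemma arsinh_mono: "(x::real) \<le> y \<Longrightarrow> arsinh x \<le> arsinh y"
  by (metis arsinh_less_iff_real not_less)

lemma slow_mono: "x \<le> y \<Longrightarrow> slow x \<le> slow y"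
  by (simp add: slow_def arsinh_mono)

lemma slow_sinh_sinh [simp]: "slow (sinh (sinh x)) = x"
  by (simp add: slow_def arsinh_sinh_real)

lemma slow_nonneg: "x \<ge> 0 \<Longrightarrow> slow x \<ge> 0"
  using slow_mono[of 0 x] by (simp add: slow_def)

text \<open>The square of the amplitude is \<open>\<eta>\<^sup>2\<close> times the derivative of \<open>arctan \<circ> slow\<close>; this makes the
  potential square integrable.\<close>

definition amp :: "real \<Rightarrow> real \<Rightarrow> real" where
  "amp \<eta> x = \<eta> * sqrt (slow' x / (1 + (slow x)\<^sup>2))"

text \<open>The logarithmic derivative of \<open>\<eta>^2 / amp^2\<close>, with one summand for each
  of the factors \<open>1 + slow^2\<close>, \<open>sqrt (1 + arsinh^2)\<close> and
  \<open>sqrt (1 + x^2)\<close> of that function.\<close>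

definition amp_rate :: "real \<Rightarrow> real" where
  "amp_rate x = 2 * slow x * slow' x / (1 + (slow x)\<^sup>2)
     + arsinh x / ((1 + (arsinh x)\<^sup>2) * sqrt (1 + x\<^sup>2)) + x / (1 + x\<^sup>2)"

definition amp' :: "real \<Rightarrow> real \<Rightarrow> real" where
  "amp' \<eta> x = - (amp \<eta> x * amp_rate x / 2)"

lemma amp_pos: "\<eta> > 0 \<Longrightarrow> amp \<eta> x > 0"
  using slow'_pos by (simp add: amp_def)

lemma amp_square: "(amp \<eta> x)\<^sup>2 = \<eta>\<^sup>2 * (slow' x / (1 + (slow x)\<^sup>2))"
  using slow'_pos[of x] by (simp add: amp_def power_mult_distrib less_imp_le)

lemma DERIV_amp: "(amp \<eta> has_real_derivative amp' \<eta> x) (at x)"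
proof -
  define P where "P x = (1 + (slow x)\<^sup>2) * (sqrt (1 + (arsinh x)\<^sup>2) * sqrt (1 + x\<^sup>2))" for x
  have P: "P x > 0" for x by (simp add: P_def)
  have ampP: "amp \<eta> x = \<eta> * sqrt (inverse (P x))" for x
    by (simp add: amp_def slow'_def P_def divide_inverse mult_ac)
  have ds: "((\<lambda>x. sqrt (1 + (f x)\<^sup>2)) has_real_derivative sqrt (1 + (f x)\<^sup>2) * (f x * f' / (1 + (f x)\<^sup>2))) (at x)"
    if "(f has_real_derivative f') (at x)" for f f' x
  proof -
    have "sqrt (1 + (f x)\<^sup>2) * (f x * f' / (1 + (f x)\<^sup>2)) = f x * f' / sqrt (1 + (f x)\<^sup>2)"
    proof -
      define r where "r = sqrt (1 + (f x)\<^sup>2)"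
      have "1 + (f x)\<^sup>2 = r * r" "r > 0" by (simp_all add: r_def)
      then show ?thesis by (simp add: r_def[symmetric])
    qed
    moreover have "((\<lambda>x. sqrt (1 + (f x)\<^sup>2)) has_real_derivative
        inverse (sqrt (1 + (f x)\<^sup>2)) / 2 * (2 * f x * f')) (at x)"
    proof (rule DERIV_chain2[OF DERIV_real_sqrt])
      show "((\<lambda>x. 1 + (f x)\<^sup>2) has_real_derivative 2 * f x * f') (at x)"
        using DERIV_add[OF DERIV_const[of 1] DERIV_power[OF that, of 2]] by (simp add: mult_ac)
    qed simp
    moreover have "inverse (sqrt (1 + (f x)\<^sup>2)) / 2 * (2 * f x * f') = f x * f' / sqrt (1 + (f x)\<^sup>2)"
      by (simp add: inverse_eq_divide)
    ultimately show ?thesis by metis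
  qed
  have dP: "(P has_real_derivative P x * amp_rate x) (at x)"
  proof -
    have 1: "((\<lambda>x. 1 + (slow x)\<^sup>2) has_real_derivative (1 + (slow x)\<^sup>2) * (2 * slow x * slow' x / (1 + (slow x)\<^sup>2))) (at x)"
    proof -
      have "(1 + (slow x)\<^sup>2) * (2 * slow x * slow' x / (1 + (slow x)\<^sup>2)) = 2 * slow x * slow' x"
        by simp
      then show ?thesis
        using DERIV_add[OF DERIV_const[of 1] DERIV_power[OF DERIV_slow[of x], of 2]] by (simp add: mult_ac)
    qed
    note 2 = ds[OF DERIV_arsinh, of x] and 3 = ds[OF DERIV_ident, of x]
    define q\<^sub>1 q\<^sub>2 q\<^sub>3 where "q\<^sub>1 = 2 * slow x * slow' x / (1 + (slow x)\<^sup>2)"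
      and "q\<^sub>2 = arsinh x * (1 / sqrt (1 + x\<^sup>2)) / (1 + (arsinh x)\<^sup>2)"
      and "q\<^sub>3 = x * 1 / (1 + x\<^sup>2)"
    have "amp_rate x = q\<^sub>1 + q\<^sub>2 + q\<^sub>3"
      by (simp add: amp_rate_def q\<^sub>1_def q\<^sub>2_def q\<^sub>3_def mult.commute)
    then show ?thesis
      unfolding P_def[abs_def]
      by (intro DERIV_cong[OF DERIV_mult[OF 1 DERIV_mult[OF 2 3]]], fold q\<^sub>1_def q\<^sub>2_def q\<^sub>3_def)
        (simp add: algebra_simps)
  qed
  have "((\<lambda>x. \<eta> * sqrt (inverse (P x))) has_real_derivative
      \<eta> * (inverse (sqrt (inverse (P x))) / 2 * (- (inverse (P x) * (P x * amp_rate x) * inverse (P x))))) (at x)"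
    using P[of x] by (intro DERIV_cmult DERIV_chain2[OF DERIV_real_sqrt] DERIV_inverse' dP) auto
  moreover have "\<eta> * (inverse (sqrt (inverse (P x))) / 2 * (- (inverse (P x) * (P x * amp_rate x) * inverse (P x)))) = amp' \<eta> x"
  proof -
    have "inverse (sqrt (inverse (P x))) * inverse (P x) = sqrt (inverse (P x))"
      using P[of x] real_div_sqrt[of "inverse (P x)"] by (simp add: divide_inverse mult.commute)
    then show ?thesis
      using P[of x] by (simp add: amp'_def ampP field_simps)
  qed
  ultimately show ?thesis by (simp add: ampP[abs_def])
qed

lemma continuous_slow [continuous_intros]: "continuous_on S slow"
  unfolding slow_def by (intro continuous_intros)

lemma continuous_slow' [continuous_intros]: "continuous_on S slow'"
  unfolding slow'_def by (intro continuous_intros) auto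

lemma continuous_amp [continuous_intros]: "continuous_on S (amp \<eta>)"
  unfolding amp_def by (intro continuous_intros) auto

lemma continuous_amp' [continuous_intros]: "continuous_on S (amp' \<eta>)"
  unfolding amp'_def amp_rate_def by (intro continuous_intros) auto

lemma amp_le:
  assumes "\<eta> > 0"
  shows "amp \<eta> x \<le> \<eta> * sqrt (1 / sqrt (1 + x\<^sup>2))" "amp \<eta> x \<le> \<eta>"
proof -
  have "slow' x / (1 + (slow x)\<^sup>2) \<le> slow' x / 1"
    using slow'_pos[of x] by (intro divide_left_mono) auto
  then have "sqrt (slow' x / (1 + (slow x)\<^sup>2)) \<le> sqrt (1 / sqrt (1 + x\<^sup>2))"
    using slow'_le[of x] by (intro real_sqrt_le_mono) simp
  then show le: "amp \<eta> x \<le> \<eta> * sqrt (1 / sqrt (1 + x\<^sup>2))"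
    unfolding amp_def using assms by (intro mult_left_mono) auto
  have "sqrt (1 / sqrt (1 + x\<^sup>2)) \<le> sqrt 1"
    using sqrt_1_plus_ge_1[of x] by (intro real_sqrt_le_mono) simp
  then have "\<eta> * sqrt (1 / sqrt (1 + x\<^sup>2)) \<le> \<eta> * 1"
    using assms by (intro mult_left_mono) auto
  then show "amp \<eta> x \<le> \<eta>" using le by simp
qed

lemma amp_rate_bounds:
  assumes "x \<ge> 0"
  shows "0 \<le> amp_rate x" "amp_rate x \<le> 3 / sqrt (1 + x\<^sup>2)"
proof -
  have s: "arsinh x \<ge> 0" using arsinh_mono[OF assms] by simp
  define p where "p = sqrt (1 + x\<^sup>2)"
  have p: "p \<ge> 1" "p * p = 1 + x\<^sup>2" by (simp_all add: p_def sqrt_1_plus_ge_1)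
  have half: "y / (1 + y\<^sup>2) \<le> 1 / 2" "y / (1 + y\<^sup>2) \<le> 1" if "y \<ge> 0" for y :: real
    using sum_squares_bound[of y 1] that by (simp_all add: divide_le_eq)
  have "2 * (slow x / (1 + (slow x)\<^sup>2)) * slow' x \<le> 1 * (1 / p)"
    using half(1)[OF slow_nonneg[OF assms]] slow'_le[of x] slow'_pos[of x]
    by (intro mult_mono) (auto simp: p_def)
  moreover have "arsinh x / (1 + (arsinh x)\<^sup>2) * (1 / p) \<le> 1 * (1 / p)"
    using half(2)[OF s] p by (intro mult_right_mono) auto
  moreover have "x / (1 + x\<^sup>2) \<le> 1 / p"
  proof -
    have "x \<le> p" unfolding p_def by (rule real_le_rsqrt) simp
    then show ?thesis using p by (simp add: field_simps flip: p(2))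
  qed
  moreover have "amp_rate x = 2 * (slow x / (1 + (slow x)\<^sup>2)) * slow' x
      + arsinh x / (1 + (arsinh x)\<^sup>2) * (1 / p) + x / (1 + x\<^sup>2)"
    by (simp add: amp_rate_def p_def)
  ultimately show "amp_rate x \<le> 3 / sqrt (1 + x\<^sup>2)" by (simp add: p_def[symmetric])
  show "0 \<le> amp_rate x"
    unfolding amp_rate_def using s assms slow_nonneg[OF assms] slow'_pos[of x]
    by (intro add_nonneg_nonneg divide_nonneg_nonneg mult_nonneg_nonneg) auto
qed

lemma amp'_nonpos: "\<eta> > 0 \<Longrightarrow> x \<ge> 0 \<Longrightarrow> amp' \<eta> x \<le> 0"
  using amp_rate_bounds(1)[of x] amp_pos[of \<eta> x] by (simp add: amp'_def)

lemma amp_antimono: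
  assumes "\<eta> > 0" "0 \<le> x" "x \<le> y"
  shows "amp \<eta> y \<le> amp \<eta> x"
  by (rule DERIV_nonpos_imp_nonincreasing[OF assms(3)])
    (use assms DERIV_amp amp'_nonpos[OF assms(1)] in \<open>meson order_trans\<close>)

text \<open>The amplitude decays like \<open>x\<close> to the power \<open>- 1 / 2\<close> up to
  logarithmic factors, whereas its logarithmic derivative is of order \<open>1 / x\<close>, which is
  eventually small compared with the amplitude.\<close>

lemma amp'_small:
  assumes "\<eta> > 0"
  shows "\<forall>\<^sub>F x in at_top. - amp' \<eta> x \<le> (amp \<eta> x)\<^sup>2 / 8"
proof -
  have "((\<lambda>x::real. (1 + (arsinh (arsinh x))\<^sup>2) * sqrt (1 + (arsinh x)\<^sup>2) / sqrt (1 + x\<^sup>2)) \<longlongrightarrow> 0) at_top"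
    unfolding arsinh_real_def by real_asymp
  \<comment> \<open>Here \<open>144 = 12^2\<close>: the claim amounts to
    \<open>amp_rate \<le> amp / 4\<close>, and \<open>amp_rate \<le> 3 / p\<close> reduces it to
    \<open>12 \<le> amp * p\<close>, where \<open>p = sqrt (1 + x^2)\<close>.\<close>
  then have "\<forall>\<^sub>F x in at_top. (1 + (slow x)\<^sup>2) * sqrt (1 + (arsinh x)\<^sup>2) / sqrt (1 + x\<^sup>2) < \<eta>\<^sup>2 / 144"
    using assms by (auto simp: slow_def dest!: order_tendstoD(2)[of _ _ _ "\<eta>\<^sup>2 / 144"])
  then show ?thesis
    using eventually_ge_at_top[of 0]
  proof eventually_elim
    case (elim x)
    define p where "p = sqrt (1 + x\<^sup>2)"
    have p: "p > 0" by (simp add: p_def)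
    define g where "g = amp \<eta> x"
    have g: "g > 0" using amp_pos[OF assms] by (simp add: g_def)
    define c where "c = (1 + (slow x)\<^sup>2) * sqrt (1 + (arsinh x)\<^sup>2)"
    have c: "c > 0" by (simp add: c_def)
    have "g\<^sup>2 = \<eta>\<^sup>2 / (c * p)"
      by (simp add: g_def amp_square slow'_def c_def p_def mult_ac)
    moreover have "144 * c \<le> \<eta>\<^sup>2 * p"
      using elim(1) p by (simp add: c_def[symmetric] p_def[symmetric] field_simps)
    ultimately have "(g * p)\<^sup>2 = \<eta>\<^sup>2 * p / c" "12\<^sup>2 \<le> \<eta>\<^sup>2 * p / c"
      using c p by (simp_all add: power_mult_distrib power2_eq_square[of p] le_divide_eq)
    then have "12\<^sup>2 \<le> (g * p)\<^sup>2" by simp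
    then have "12 \<le> g * p"
      by (rule power2_le_imp_le) (use g p in simp)
    then have "3 / p \<le> g / 4"
      using p by (simp add: field_simps)
    then have "amp_rate x \<le> g / 4"
      using amp_rate_bounds(2)[OF elim(2)] by (simp add: p_def)
    then have "g * amp_rate x \<le> g * (g / 4)"
      using g by (intro mult_left_mono) auto
    then show ?case
      by (simp add: amp'_def g_def[symmetric] power2_eq_square)
  qed
qed

text \<open>Any antiderivative will do: the arguments below use only its derivative, and another
  choice multiplies the chirp by a constant of modulus 1.\<close>

definition phase :: "real \<Rightarrow> real" where
  "phase = (SOME F. \<forall>x. (F has_real_derivative sin (slow x)) (at x))"

lemma DERIV_phase: "(phase has_real_derivative sin (slow x)) (at x)"
proof -
  have "isCont (\<lambda>x. sin (slow x)) x" for x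
    by (rule DERIV_isCont[OF DERIV_chain2[OF DERIV_sin DERIV_slow]])
  then have "\<exists>F. \<forall>x. (F has_real_derivative sin (slow x)) (at x)"
    using einterval_antiderivative[of "-\<infinity>" \<infinity> "\<lambda>x. sin (slow x)"]
    by (auto simp: has_real_derivative_iff_has_vector_derivative)
  then have "\<forall>x. (phase has_real_derivative sin (slow x)) (at x)"
    unfolding phase_def by (rule someI_ex)
  then show ?thesis by blast
qed

definition chirp :: "real \<Rightarrow> real \<Rightarrow> complex" where
  "chirp \<eta> x = of_real (amp \<eta> x) * exp (- \<i> * phase x)"

definition chirp' :: "real \<Rightarrow> real \<Rightarrow> complex" where
  "chirp' \<eta> x = (of_real (amp' \<eta> x) - \<i> * of_real (amp \<eta> x * sin (slow x))) * exp (- \<i> * phase x)"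

lemma continuous_phase [continuous_intros]: "continuous_on S phase"
  by (meson DERIV_phase DERIV_continuous continuous_at_imp_continuous_on)

lemma has_vector_derivative_chirp: "(chirp \<eta> has_vector_derivative chirp' \<eta> x) (at x)"
proof -
  have "((\<lambda>t. - \<i> * complex_of_real (phase t)) has_vector_derivative - \<i> * sin (slow x)) (at x)"
    by (intro has_vector_derivative_mult_right has_vector_derivative_of_real DERIV_phase)
  from has_vector_derivative_mult[OF has_vector_derivative_of_real[OF DERIV_amp] has_vector_derivative_exp_complex[OF this]]
  show ?thesis
    unfolding chirp_def[abs_def]
    by (rule has_vector_derivative_eq_rhs) (simp add: chirp'_def algebra_simps)
qed

lemma cmod_chirp: "\<eta> > 0 \<Longrightarrow> cmod (chirp \<eta> x) = amp \<eta> x"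
  using amp_pos[of \<eta> x] by (simp add: chirp_def norm_mult norm_exp_eq_Re)

lemma bounded_smooth_chirp:
  assumes "\<eta> > 0"
  shows "bounded_smooth (\<lambda>x. chirp \<eta> (x + T)) \<eta> (\<lambda>x. chirp' \<eta> (x + T))"
proof
  have c: "continuous_on UNIV (chirp \<eta>)" "continuous_on UNIV (chirp' \<eta>)"
    unfolding chirp_def[abs_def] chirp'_def[abs_def] by (intro continuous_intros)+
  show "continuous_on UNIV (\<lambda>x. chirp \<eta> (x + T))" "continuous_on UNIV (\<lambda>x. chirp' \<eta> (x + T))"
    by (rule continuous_on_compose2[OF c(1)] continuous_on_compose2[OF c(2)]; auto intro!: continuous_intros)+
  show "cmod (chirp \<eta> (t + T)) \<le> \<eta>" for t
    using amp_le(2)[OF assms] by (simp add: cmod_chirp assms)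
  show "((\<lambda>x. chirp \<eta> (x + T)) has_vector_derivative chirp' \<eta> (t + T)) (at t)" for t
  proof -
    have "((\<lambda>x. x + T) has_vector_derivative 1 + 0) (at t)"
      by (intro has_vector_derivative_add has_vector_derivative_id has_vector_derivative_const)
    from vector_diff_chain_at[OF this has_vector_derivative_chirp] show ?thesis by (simp add: o_def)
  qed
qed

text \<open>The squared modulus is the derivative of \<open>\<eta>^2 * arctan (slow x)\<close>,
  which rises by \<open>\<eta>^2 * pi\<close> over the whole line.\<close>

lemma chirp_integrable:
  assumes "\<eta> > 0"
  shows "integrable lborel (\<lambda>x. (cmod (chirp \<eta> x))\<^sup>2)" "(LINT x|lborel. (cmod (chirp \<eta> x))\<^sup>2) = \<eta>\<^sup>2 * pi"
proof -
  have sq: "(cmod (chirp \<eta> x))\<^sup>2 = \<eta>\<^sup>2 * (slow' x / (1 + (slow x)\<^sup>2))" for x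
    by (simp add: cmod_chirp assms amp_square)
  have top: "filterlim slow at_top at_top" and bot: "filterlim slow at_bot at_bot"
    unfolding slow_def by (rule filterlim_compose[OF arsinh_real_at_top arsinh_real_at_top]
        filterlim_compose[OF arsinh_real_at_bot arsinh_real_at_bot])+
  have d: "((\<lambda>x. \<eta>\<^sup>2 * arctan (slow x)) has_real_derivative \<eta>\<^sup>2 * (slow' x / (1 + (slow x)\<^sup>2))) (at x)" for x
    by (auto intro!: derivative_eq_intros DERIV_slow simp: field_simps)
  have lim: "((\<lambda>x. \<eta>\<^sup>2 * arctan (slow x)) \<longlongrightarrow> \<eta>\<^sup>2 * - (pi / 2)) at_bot"
    "((\<lambda>x. \<eta>\<^sup>2 * arctan (slow x)) \<longlongrightarrow> \<eta>\<^sup>2 * (pi / 2)) at_top"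
    by (intro tendsto_mult_left filterlim_compose[OF tendsto_arctan_at_bot bot]
        filterlim_compose[OF tendsto_arctan_at_top top])+
  have c: "continuous_on UNIV (\<lambda>x. \<eta>\<^sup>2 * (slow' x / (1 + (slow x)\<^sup>2)))"
    by (intro continuous_intros) auto
  have nn: "0 \<le> \<eta>\<^sup>2 * (slow' x / (1 + (slow x)\<^sup>2))" for x
    using slow'_pos[of x] by simp
  show "integrable lborel (\<lambda>x. (cmod (chirp \<eta> x))\<^sup>2)" "(LINT x|lborel. (cmod (chirp \<eta> x))\<^sup>2) = \<eta>\<^sup>2 * pi"
    unfolding sq using integral_nonneg_derivative[OF d c nn lim] by (simp_all add: algebra_simps)
qed

lemma chirp_L2:
  assumes "\<eta> > 0" and S: "S \<in> sets borel" and q: "continuous_on UNIV q" "\<And>x. cmod (q x) = cmod (chirp \<eta> x)"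
  shows "q \<in> L2_on S" "L2_norm_on S q \<le> 2 * \<eta>"
proof -
  note i = chirp_integrable[OF assms(1)]
  have I: "integrable lebesgue (\<lambda>x. (cmod (q x))\<^sup>2)" "(LINT x|lebesgue. (cmod (q x))\<^sup>2) = \<eta>\<^sup>2 * pi"
    using i unfolding q(2) by (simp_all add: integrable_completion integral_completion)
  have S': "S \<in> sets lebesgue" using S by simp
  have si: "set_integrable lebesgue S (\<lambda>x. (cmod (q x))\<^sup>2)"
    unfolding set_integrable_def using integrable_mult_indicator[OF S' I(1)] .
  have "q \<in> borel_measurable lebesgue"
    using q(1) by (intro measurable_completion) (simp add: borel_measurable_continuous_onI)
  then have "set_borel_measurable lebesgue S q"
    unfolding set_borel_measurable_def using S' by (intro borel_measurable_scaleR borel_measurable_indicator)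
  then show "q \<in> L2_on S" using si by (simp add: L2_on_def)
  have "(LINT x:S|lebesgue. (cmod (q x))\<^sup>2) \<le> \<eta>\<^sup>2 * pi"
    unfolding I(2)[symmetric] set_lebesgue_integral_def
    by (rule integral_mono) (use si I in \<open>auto simp: set_integrable_def indicator_def\<close>)
  also have "\<dots> \<le> (2 * \<eta>)\<^sup>2"
    using pi_less_4 assms(1) by (simp add: power_mult_distrib)
  finally have "L2_norm_on S q \<le> sqrt ((2 * \<eta>)\<^sup>2)"
    unfolding L2_norm_on_def by (rule real_sqrt_le_mono)
  then show "L2_norm_on S q \<le> 2 * \<eta>" using assms(1) by (simp only: real_sqrt_abs)
qed

section \<open>Sweeps that meet the hypotheses of the growth estimate\<close>

lemma chirp_window:
  fixes \<eta> \<xi> X B :: real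
  assumes \<eta>: "\<eta> > 0" and \<xi>: "0 < \<xi>" "\<xi> < 1"
  obtains \<alpha> \<beta> \<kappa> where "X \<le> \<alpha>" "0 \<le> \<alpha>" "\<alpha> \<le> \<beta>"
    "\<And>t. t \<in> {\<alpha>..\<beta>} \<Longrightarrow> 4 * amp \<eta> t \<le> \<xi> - sin (slow t)"
    "\<And>t. t \<in> {\<alpha>..\<beta>} \<Longrightarrow> - amp' \<eta> t \<le> (amp \<eta> t)\<^sup>2 / 8"
    "\<And>t. t \<in> {\<alpha>..\<beta>} \<Longrightarrow> 0 \<le> cos (slow t)"
    "\<And>t. t \<in> {\<alpha>..\<beta>} \<Longrightarrow> \<kappa> * (cos (slow t) * slow' t) \<le> (amp \<eta> t)\<^sup>2"
    "B \<le> 3 / 16 * \<kappa> * (ln (\<xi> - sin (slow \<alpha>)) - ln (\<xi> - sin (slow \<beta>))) - 1"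
proof -
  \<comment> \<open>A lower bound for the gain of a sweep that starts at phase angle \<theta>: the
    factor \<open>\<eta>^2 / (1 + (\<theta> + pi)^2)\<close> will be \<kappa>, and the bracket
    bounds the drop of the logarithm of the detuning. The exponential growth of \<open>sinh\<close>
    beats the quadratic denominator.\<close>
  define G where "G \<theta> = 3 / 16 * (\<eta>\<^sup>2 / (1 + (\<theta> + pi)\<^sup>2)) * (sinh \<theta> / 2 - (ln (4 * \<eta>) + ln 2 / 2)) - 1" for \<theta>
  have "filterlim G at_top at_top"
    unfolding G_def sinh_field_def using \<eta> by real_asymp
  then have evG: "\<forall>\<^sub>F \<theta> in at_top. B \<le> G \<theta>"
    by (simp add: filterlim_at_top)
  have lim: "filterlim (\<lambda>\<theta>::real. sinh (sinh \<theta>)) at_top at_top"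
    unfolding sinh_field_def by real_asymp
  have "\<forall>\<^sub>F x in at_top. \<forall>t\<ge>x. - amp' \<eta> t \<le> (amp \<eta> t)\<^sup>2 / 8"
    using amp'_small[OF \<eta>] unfolding eventually_at_top_linorder by (meson order_trans)
  then have "\<forall>\<^sub>F x in at_top. (\<forall>t\<ge>x. - amp' \<eta> t \<le> (amp \<eta> t)\<^sup>2 / 8) \<and> X \<le> x \<and> 0 \<le> x"
    by (intro eventually_conj eventually_ge_at_top)
  then have ev1: "\<forall>\<^sub>F \<theta> in at_top. (\<forall>t\<ge>sinh (sinh \<theta>). - amp' \<eta> t \<le> (amp \<eta> t)\<^sup>2 / 8)
      \<and> X \<le> sinh (sinh \<theta>) \<and> 0 \<le> sinh (sinh \<theta>)"
    by (rule eventually_compose_filterlim[OF _ lim])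
  have lim2: "((\<lambda>\<theta>::real. 4 * (\<eta> * sqrt (1 / sqrt (1 + (sinh (sinh \<theta>))\<^sup>2)))) \<longlongrightarrow> 0) at_top"
    unfolding sinh_field_def using \<eta> by real_asymp
  have ev2: "\<forall>\<^sub>F \<theta> in at_top. 4 * (\<eta> * sqrt (1 / sqrt (1 + (sinh (sinh \<theta>))\<^sup>2))) < 1"
    using order_tendstoD(2)[OF lim2, of 1] by simp
  \<comment> \<open>The sweep starts where the sine is -1. There the detuning is
    \<open>1 + \<xi>\<close>, so its logarithm is positive.\<close>
  have seq: "filterlim (\<lambda>n. 2 * pi * real n - pi / 2) at_top sequentially"
    by real_asymp
  have "\<forall>\<^sub>F \<theta> in at_top. B \<le> G \<theta> \<and> ((\<forall>t\<ge>sinh (sinh \<theta>). - amp' \<eta> t \<le> (amp \<eta> t)\<^sup>2 / 8)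
      \<and> X \<le> sinh (sinh \<theta>) \<and> 0 \<le> sinh (sinh \<theta>)) \<and> 4 * (\<eta> * sqrt (1 / sqrt (1 + (sinh (sinh \<theta>))\<^sup>2))) < 1 \<and> 0 \<le> \<theta>"
    by (intro eventually_conj evG ev1 ev2 eventually_ge_at_top)
  from eventually_happens[OF eventually_compose_filterlim[OF this seq]]
  obtain n :: nat where n: "B \<le> G (2 * pi * real n - pi / 2)"
    "\<And>t. t \<ge> sinh (sinh (2 * pi * real n - pi / 2)) \<Longrightarrow> - amp' \<eta> t \<le> (amp \<eta> t)\<^sup>2 / 8"
    "X \<le> sinh (sinh (2 * pi * real n - pi / 2))" "0 \<le> sinh (sinh (2 * pi * real n - pi / 2))"
    "4 * (\<eta> * sqrt (1 / sqrt (1 + (sinh (sinh (2 * pi * real n - pi / 2)))\<^sup>2))) < 1"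
    "0 \<le> 2 * pi * real n - pi / 2"
    by auto
  define \<theta> where "\<theta> = 2 * pi * real n - pi / 2"
  define \<alpha> where "\<alpha> = sinh (sinh \<theta>)"
  \<comment> \<open>The detuning at which the sweep is stopped. Since the amplitude decreases, four
    times its initial value dominates \<open>4 * amp\<close> on the whole window.\<close>
  define \<delta> where "\<delta> = 4 * amp \<eta> \<alpha>"
  note n = n[folded \<theta>_def, folded \<alpha>_def]
  have \<delta>: "0 < \<delta>" "\<delta> < 1"
    using amp_pos[OF \<eta>, of \<alpha>] amp_le(1)[OF \<eta>, of \<alpha>] n(5) by (auto simp: \<delta>_def)
  define \<theta>\<^sub>1 where "\<theta>\<^sub>1 = 2 * pi * real n + arcsin (\<xi> - \<delta>)"
  have as: "- (pi / 2) \<le> arcsin (\<xi> - \<delta>)" "arcsin (\<xi> - \<delta>) \<le> pi / 2"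
    using \<delta> \<xi> arcsin_bounded[of "\<xi> - \<delta>"] by auto
  have shift: "sin (2 * pi * real n + z) = sin z" "cos (2 * pi * real n + z) = cos z" for z
    using sin_cos_eq_iff[of "2 * pi * real n + z" z]
    by (metis (no_types, opaque_lifting) add.commute Ints_of_nat mult.commute of_int_of_nat_eq)+
  define \<beta> where "\<beta> = sinh (sinh \<theta>\<^sub>1)"
  have slow: "slow \<alpha> = \<theta>" "slow \<beta> = \<theta>\<^sub>1" by (simp_all add: \<alpha>_def \<beta>_def)
  have \<alpha>\<beta>: "\<alpha> \<le> \<beta>" unfolding \<alpha>_def \<beta>_def using as by (simp add: \<theta>_def \<theta>\<^sub>1_def)
  \<comment> \<open>The window covers at most half a period, so
    \<open>slow t \<le> \<theta> + pi\<close> throughout. With this \<kappa> the inequality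
    \<open>\<kappa> * slow' \<le> amp^2\<close> follows, and the cosine is at most 1.\<close>
  define \<kappa> where "\<kappa> = \<eta>\<^sup>2 / (1 + (\<theta> + pi)\<^sup>2)"
  have range: "\<theta> \<le> slow t" "slow t \<le> \<theta>\<^sub>1" if "t \<in> {\<alpha>..\<beta>}" for t
    using that slow_mono[of \<alpha> t] slow_mono[of t \<beta>] by (auto simp: slow)
  show ?thesis
  proof (rule that[of \<alpha> \<beta> \<kappa>])
    show "X \<le> \<alpha>" "0 \<le> \<alpha>" "\<alpha> \<le> \<beta>" by (fact n(3) n(4) \<alpha>\<beta>)+
    fix t assume t: "t \<in> {\<alpha>..\<beta>}"
    define z where "z = slow t - 2 * pi * real n"
    have z: "- (pi / 2) \<le> z" "z \<le> arcsin (\<xi> - \<delta>)" and st: "slow t = 2 * pi * real n + z"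
      using range[OF t] by (auto simp: z_def \<theta>_def \<theta>\<^sub>1_def)
    have "sin z \<le> sin (arcsin (\<xi> - \<delta>))"
      using z as by (intro sin_monotone_2pi_le) auto
    also have "\<dots> = \<xi> - \<delta>" using \<delta> \<xi> by (intro sin_arcsin) auto
    finally have "sin (slow t) \<le> \<xi> - \<delta>" by (simp add: st shift)
    moreover have "amp \<eta> t \<le> amp \<eta> \<alpha>" using amp_antimono[OF \<eta> n(4)] t by simp
    ultimately show "4 * amp \<eta> t \<le> \<xi> - sin (slow t)" by (simp add: \<delta>_def)
    show "- amp' \<eta> t \<le> (amp \<eta> t)\<^sup>2 / 8" using n(2) t by simp
    show "0 \<le> cos (slow t)" unfolding st shift using z as by (intro cos_ge_zero) auto
    have "slow t \<le> \<theta> + pi" using range(2)[OF t] as by (simp add: \<theta>_def \<theta>\<^sub>1_def)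
    moreover have "0 \<le> slow t" using range(1)[OF t] n(6) by simp
    ultimately have "(slow t)\<^sup>2 \<le> (\<theta> + pi)\<^sup>2" by (intro power_mono)
    then have "\<kappa> * slow' t \<le> \<eta>\<^sup>2 / (1 + (slow t)\<^sup>2) * slow' t"
      unfolding \<kappa>_def using slow'_pos[of t] by (intro mult_right_mono divide_left_mono) auto
    moreover have "\<kappa> * (cos (slow t) * slow' t) \<le> \<kappa> * (1 * slow' t)"
      using slow'_pos[of t] by (intro mult_left_mono mult_right_mono) (auto simp: \<kappa>_def)
    ultimately show "\<kappa> * (cos (slow t) * slow' t) \<le> (amp \<eta> t)\<^sup>2"
      by (simp add: amp_square)
  next
    have "sin (slow \<alpha>) = - 1"
      using shift(1)[of "- (pi / 2)"] by (simp add: slow \<theta>_def)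
    then have l\<alpha>: "ln (\<xi> - sin (slow \<alpha>)) \<ge> 0" using \<xi> by simp
    have "sin (slow \<beta>) = \<xi> - \<delta>" using \<delta> \<xi> by (simp add: slow \<theta>\<^sub>1_def shift)
    then have l\<beta>: "ln (\<xi> - sin (slow \<beta>)) = ln \<delta>" by simp
    \<comment> \<open>The source of \<open>sinh \<theta> / 2\<close>: the amplitude at \<alpha> is
      at most \<eta> divided by the square root of \<open>cosh (sinh \<theta>)\<close>.\<close>
    have c: "sqrt (1 + \<alpha>\<^sup>2) = cosh (sinh \<theta>)"
      by (simp add: \<alpha>_def cosh_square_eq[symmetric] add.commute[of 1])
    have c2: "cosh (sinh \<theta>) \<ge> exp (sinh \<theta>) / 2" by (simp add: cosh_field_def)
    have "amp \<eta> \<alpha> \<le> \<eta> * sqrt (1 / cosh (sinh \<theta>))" using amp_le(1)[OF \<eta>, of \<alpha>] by (simp add: c)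
    then have "\<delta> \<le> 4 * \<eta> * sqrt (1 / cosh (sinh \<theta>))" by (simp add: \<delta>_def)
    also have "\<dots> \<le> 4 * \<eta> * sqrt (1 / (exp (sinh \<theta>) / 2))"
      using c2 \<eta> by (intro mult_left_mono real_sqrt_le_mono divide_left_mono) (auto intro!: mult_pos_pos)
    finally have "ln \<delta> \<le> ln (4 * \<eta> * sqrt (1 / (exp (sinh \<theta>) / 2)))"
      using \<delta> \<eta> by (intro ln_mono) auto
    also have "\<dots> = ln (4 * \<eta>) + ln 2 / 2 - sinh \<theta> / 2"
      using \<eta> by (subst ln_mult) (auto simp: ln_sqrt ln_div diff_divide_distrib)
    finally have "sinh \<theta> / 2 - (ln (4 * \<eta>) + ln 2 / 2)
       \<le> ln (\<xi> - sin (slow \<alpha>)) - ln (\<xi> - sin (slow \<beta>))"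
      using l\<alpha> l\<beta> by linarith
    then have "3 / 16 * \<kappa> * (sinh \<theta> / 2 - (ln (4 * \<eta>) + ln 2 / 2))
       \<le> 3 / 16 * \<kappa> * (ln (\<xi> - sin (slow \<alpha>)) - ln (\<xi> - sin (slow \<beta>)))"
      by (intro mult_left_mono) (auto simp: \<kappa>_def)
    then show "B \<le> 3 / 16 * \<kappa> * (ln (\<xi> - sin (slow \<alpha>)) - ln (\<xi> - sin (slow \<beta>))) - 1"
      using n(1) by (simp add: G_def \<kappa>_def)
  qed
qed

subsection \<open>Divergence\<close>

lemma (in bounded_continuous) log_u_chirp_growth:
  fixes \<xi> X B T \<eta> :: real
  assumes \<eta>: "\<eta> > 0" and \<xi>: "0 < \<xi>" "\<xi> < 1" and A: "A = (\<lambda>x. chirp \<eta> (x + T))"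
  obtains \<alpha> \<beta> where "X \<le> \<alpha>" "0 \<le> \<alpha>" "\<alpha> \<le> \<beta>" "B \<le> Im (log_u \<xi> \<beta>) - Im (log_u \<xi> \<alpha>)"
proof -
  \<comment> \<open>The window lives in the time of the unshifted chirp. The margin
    \<open>\<bar>T\<bar>\<close> keeps its translate by \<open>- T\<close> beyond both
    \<open>X\<close> and 0.\<close>
  obtain \<alpha> \<beta> \<kappa> where win: "max X 0 + \<bar>T\<bar> \<le> \<alpha>" "0 \<le> \<alpha>" "\<alpha> \<le> \<beta>"
    "\<And>t. t \<in> {\<alpha>..\<beta>} \<Longrightarrow> 4 * amp \<eta> t \<le> \<xi> - sin (slow t)"
    "\<And>t. t \<in> {\<alpha>..\<beta>} \<Longrightarrow> - amp' \<eta> t \<le> (amp \<eta> t)\<^sup>2 / 8"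
    "\<And>t. t \<in> {\<alpha>..\<beta>} \<Longrightarrow> 0 \<le> cos (slow t)"
    "\<And>t. t \<in> {\<alpha>..\<beta>} \<Longrightarrow> \<kappa> * (cos (slow t) * slow' t) \<le> (amp \<eta> t)\<^sup>2"
    "B \<le> 3 / 16 * \<kappa> * (ln (\<xi> - sin (slow \<alpha>)) - ln (\<xi> - sin (slow \<beta>))) - 1"
    by (rule chirp_window[OF \<eta> \<xi>, of "max X 0 + \<bar>T\<bar>" B]) blast
  have "3 / 16 * \<kappa> * (ln (\<xi> - sin (slow ((\<alpha> - T) + T))) - ln (\<xi> - sin (slow ((\<beta> - T) + T)))) - 1
      \<le> Im (log_u \<xi> (\<beta> - T)) - Im (log_u \<xi> (\<alpha> - T))"
  proof (rule log_u_growth[where g="\<lambda>t. amp \<eta> (t + T)" and g'="\<lambda>t. amp' \<eta> (t + T)"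
        and \<phi>="\<lambda>t. phase (t + T)" and \<psi>="\<lambda>t. sin (slow (t + T))" and \<psi>'="\<lambda>t. cos (slow (t + T)) * slow' (t + T)"])
    show "0 \<le> \<alpha> - T" "\<alpha> - T \<le> \<beta> - T" using win(1,3) by auto
    show "A t = of_real (amp \<eta> (t + T)) * exp (- \<i> * phase (t + T))" for t
      by (simp add: A chirp_def)
    show "((\<lambda>t. phase (t + T)) has_real_derivative sin (slow (t + T))) (at t)" for t
      using DERIV_phase[of "t + T"] by (simp add: DERIV_shift)
    show "((\<lambda>t. amp \<eta> (t + T)) has_real_derivative amp' \<eta> (t + T)) (at t)" for t
      using DERIV_amp[of \<eta> "t + T"] by (simp add: DERIV_shift)
    show "((\<lambda>t. sin (slow (t + T))) has_real_derivative cos (slow (t + T)) * slow' (t + T)) (at t)" for t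
      using DERIV_chain2[OF DERIV_sin DERIV_slow, of "t + T"] DERIV_shift[of "\<lambda>x. sin (slow x)" _ t T] by simp
    fix t assume "t \<in> {\<alpha> - T..\<beta> - T}"
    then have t: "t + T \<in> {\<alpha>..\<beta>}" by auto
    then have "t + T \<ge> 0" using win(2) by auto
    then show "0 < amp \<eta> (t + T)" "4 * amp \<eta> (t + T) \<le> \<xi> - sin (slow (t + T))" "amp' \<eta> (t + T) \<le> 0"
      "- amp' \<eta> (t + T) \<le> (amp \<eta> (t + T))\<^sup>2 / 8" "0 \<le> cos (slow (t + T)) * slow' (t + T)"
      "\<kappa> * (cos (slow (t + T)) * slow' (t + T)) \<le> (amp \<eta> (t + T))\<^sup>2"
      using win(4-7)[OF t] amp_pos[OF \<eta>] amp'_nonpos[OF \<eta>] slow'_pos[of "t + T"] by auto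
  qed
  then show ?thesis
    using that[of "\<alpha> - T" "\<beta> - T"] win by auto
qed

text \<open>When the argument grows by \<open>\<pi>\<close>, the function \<open>u\<close> passes through two opposite directions
  outside the unit disc.\<close>

lemma (in bounded_continuous) u_chirp_oscillates:
  fixes \<xi> X T \<eta> :: real
  assumes "\<eta> > 0" "0 < \<xi>" "\<xi> < 1" "A = (\<lambda>x. chirp \<eta> (x + T))"
  obtains s t where "X \<le> s" "0 \<le> s" "s \<le> t" "2 \<le> cmod (u \<xi> t - u \<xi> s)"
proof -
  obtain \<alpha> \<beta> where \<alpha>\<beta>: "X \<le> \<alpha>" "0 \<le> \<alpha>" "\<alpha> \<le> \<beta>" "pi \<le> Im (log_u \<xi> \<beta>) - Im (log_u \<xi> \<alpha>)"
    by (rule log_u_chirp_growth[OF assms, of X pi]) blast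
  have "continuous_on {\<alpha>..\<beta>} (\<lambda>t. Im (log_u \<xi> t))"
    by (intro continuous_intros continuous_on_subset[OF continuous_on_log_u]) (use \<alpha>\<beta> in auto)
  then obtain t where t: "\<alpha> \<le> t" "t \<le> \<beta>" "Im (log_u \<xi> t) = Im (log_u \<xi> \<alpha>) + pi"
    using IVT'[of "\<lambda>t. Im (log_u \<xi> t)" \<alpha> "Im (log_u \<xi> \<alpha>) + pi" \<beta>] \<alpha>\<beta> by auto
  have polar: "u \<xi> x = of_real (cmod (u \<xi> x)) * exp (\<i> * Im (log_u \<xi> x))" if "x \<ge> 0" for x
  proof -
    have "exp (log_u \<xi> x) = u \<xi> x" using exp_log_u that by simp
    then show ?thesis
      using exp_eq_polar[of "log_u \<xi> x"] norm_exp_eq_Re[of "log_u \<xi> x"] by (simp add: cis_conv_exp)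
  qed
  define e where "e = exp (\<i> * Im (log_u \<xi> \<alpha>))"
  define r\<^sub>1 r\<^sub>2 where "r\<^sub>1 = cmod (u \<xi> t)" and "r\<^sub>2 = cmod (u \<xi> \<alpha>)"
  have "exp (\<i> * Im (log_u \<xi> t)) = - e"
    unfolding t(3) e_def by (simp add: distrib_left exp_add)
  then have "u \<xi> t = of_real r\<^sub>1 * - e" "u \<xi> \<alpha> = of_real r\<^sub>2 * e"
    using polar[of t] polar[of \<alpha>] t \<alpha>\<beta> by (simp_all add: r\<^sub>1_def r\<^sub>2_def e_def)
  then have "u \<xi> t - u \<xi> \<alpha> = - of_real (r\<^sub>1 + r\<^sub>2) * e"
    by (simp add: algebra_simps)
  moreover have "cmod e = 1" by (simp add: e_def norm_exp_eq_Re)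
  moreover have "r\<^sub>1 \<ge> 1" "r\<^sub>2 \<ge> 1"
    using u_ge_1[of "of_real \<xi>" t] u_ge_1[of "of_real \<xi>" \<alpha>] t \<alpha>\<beta> by (simp_all add: r\<^sub>1_def r\<^sub>2_def)
  ultimately have "2 \<le> cmod (u \<xi> t - u \<xi> \<alpha>)"
    by (simp add: norm_mult del: of_real_add)
  then show ?thesis
    using that[of \<alpha> t] t \<alpha>\<beta> by simp
qed

lemma (in bounded_continuous) u_chirp_not_eventually_close:
  assumes "\<eta> > 0" "0 < \<xi>" "\<xi> < 1" "A = (\<lambda>x. chirp \<eta> (x + T))"
  shows "\<not> (\<forall>\<^sub>F x in at_top. dist (u (complex_of_real \<xi>) x) l < 1)"
proof
  assume "\<forall>\<^sub>F x in at_top. dist (u (complex_of_real \<xi>) x) l < 1"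
  then obtain X where X: "\<And>x. x \<ge> X \<Longrightarrow> dist (u (complex_of_real \<xi>) x) l < 1"
    by (auto simp: eventually_at_top_linorder)
  obtain s t where st: "X \<le> s" "0 \<le> s" "s \<le> t" "2 \<le> cmod (u \<xi> t - u \<xi> s)"
    by (rule u_chirp_oscillates[OF assms, of X]) blast
  have "dist (u \<xi> t) (u \<xi> s) < 1 + 1"
    using X[of s] X[of t] st by (intro dist_triangle_less_add) (auto simp: dist_commute)
  then show False using st by (simp add: dist_norm)
qed

lemma chirp_shift_0: "(\<lambda>x. chirp \<eta> (x + 0)) = chirp \<eta>"
  by simp

section \<open>From infinite suprema on the unit interval to the negated statements\<close>

lemma not_AE_unit_interval:
  assumes "\<And>\<xi>::real. 0 < \<xi> \<Longrightarrow> \<xi> < 1 \<Longrightarrow> \<not> P \<xi>"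
  shows "\<not> (AE \<xi> in lebesgue. P \<xi>)"
proof
  assume "AE \<xi> in lebesgue. P \<xi>"
  then have "AE \<xi> in lebesgue. \<xi> \<notin> {0<..<1::real}"
    by eventually_elim (use assms in auto)
  then have "{0<..<1::real} \<in> null_sets lebesgue"
    by (subst AE_iff_null_sets) auto
  then show False by (simp add: null_sets_def)
qed

text \<open>Measurability is essential for the refutation, because \<open>emeasure\<close> assigns 0
  to nonmeasurable sets. It comes from lower semicontinuity, which is available for suprema of
  continuous functions.\<close>

lemma borel_superlevel_set:
  fixes M :: "real \<Rightarrow> ereal"
  assumes "\<And>b. open {\<xi>. b < M \<xi>}"
  shows "{\<xi>. M \<xi> \<ge> c} \<in> sets lebesgue"
proof -
  have "M \<in> borel_measurable borel"
    by (rule borel_measurableI_greater) (use assms in auto)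
  then have "{\<xi> \<in> space borel. c \<le> M \<xi>} \<in> sets borel" by measurable
  then show ?thesis by simp
qed

lemma no_weak_type_bound:
  fixes M :: "real \<Rightarrow> ereal"
  assumes inf: "\<And>\<xi>. 0 < \<xi> \<Longrightarrow> \<xi> < 1 \<Longrightarrow> M \<xi> = \<infinity>" and meas: "\<And>c. {\<xi>. M \<xi> \<ge> c} \<in> sets lebesgue"
  shows "\<exists>\<mu>>0. \<not> emeasure lebesgue {\<xi>. M \<xi> \<ge> ereal \<mu>} \<le> ennreal (K / \<mu>)"
proof -
  \<comment> \<open>Any level above \<open>\<bar>K\<bar>\<close> works: the superlevel set contains
    the whole unit interval, whereas \<open>K / \<mu>\<close> is below 1.\<close>
  define \<mu> where "\<mu> = \<bar>K\<bar> + 1"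
  have "1 = emeasure lebesgue {0<..<1::real}" by simp
  also have "\<dots> \<le> emeasure lebesgue {\<xi>. M \<xi> \<ge> ereal \<mu>}"
    by (rule emeasure_mono[OF _ meas]) (auto simp: inf)
  finally have "1 \<le> emeasure lebesgue {\<xi>. M \<xi> \<ge> ereal \<mu>}" .
  moreover have "K / \<mu> < 1"
    by (simp add: \<mu>_def divide_less_eq abs_if)
  then have "ennreal (K / \<mu>) < 1"
    by (simp add: ennreal_less_one_iff)
  moreover have "\<mu> > 0" by (simp add: \<mu>_def)
  ultimately show ?thesis by (meson leD order_trans)
qed

text \<open>This makes a supremum over Stolz angles lower semicontinuous in the vertex, with no
  regularity of the function inside the angle.\<close>

lemma open_stolz_vertices: "open {\<xi>. k \<in> stolz \<xi>}"
proof (cases "Im k > 0")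
  case True
  have "open {\<xi>. \<bar>Re k - \<xi>\<bar> < Im k}" by (intro open_Collect_less continuous_intros)
  then show ?thesis using True by (simp add: stolz_def upper_half_plane_def)
qed (simp add: stolz_def upper_half_plane_def)

text \<open>The vertex is approached vertically inside the Stolz angle, so a nontangential supremum
  dominates the boundary value. Hence divergence on the real line settles both kinds of maximal
  function.\<close>

lemma abs_boundary_value_le:
  fixes f :: "complex \<Rightarrow> real"
  assumes f: "continuous_on {k. Im k \<ge> 0} f" and le: "\<And>k. k \<in> stolz \<xi> \<Longrightarrow> ereal \<bar>f k\<bar> \<le> M"
  shows "ereal \<bar>f (of_real \<xi>)\<bar> \<le> M"
proof (rule LIMSEQ_le_const2)
  have "(\<lambda>n. of_real \<xi> + \<i> * of_real (1 / real (Suc n))) \<longlonglongrightarrow> complex_of_real \<xi> + \<i> * of_real 0"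
    by (intro tendsto_intros LIMSEQ_Suc[OF lim_1_over_n])
  then have "(\<lambda>n. of_real \<xi> + \<i> * of_real (1 / real (Suc n))) \<longlonglongrightarrow> complex_of_real \<xi>" by simp
  then have "(\<lambda>n. f (of_real \<xi> + \<i> * of_real (1 / real (Suc n)))) \<longlonglongrightarrow> f (of_real \<xi>)"
    by (rule continuous_on_tendsto_compose[OF f]) auto
  then show "(\<lambda>n. ereal \<bar>f (of_real \<xi> + \<i> * of_real (1 / real (Suc n)))\<bar>) \<longlonglongrightarrow> ereal \<bar>f (of_real \<xi>)\<bar>"
    by (intro tendsto_intros)
  show "\<exists>N. \<forall>n\<ge>N. ereal \<bar>f (of_real \<xi> + \<i> * of_real (1 / real (Suc n)))\<bar> \<le> M"
    by (intro exI allI impI le) (auto simp: stolz_def upper_half_plane_def)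
qed

lemma (in bounded_continuous) continuous_on_Im_log_u_param:
  assumes "x \<ge> 0"
  shows "continuous_on {k. Im k \<ge> 0} (\<lambda>k. Im (log_u k x))"
    and "continuous_on UNIV (\<lambda>\<xi>. Im (log_u (complex_of_real \<xi>) x))"
proof -
  show c: "continuous_on {k. Im k \<ge> 0} (\<lambda>k. Im (log_u k x))"
    by (intro continuous_intros continuous_on_log_u_param assms)
  show "continuous_on UNIV (\<lambda>\<xi>. Im (log_u (complex_of_real \<xi>) x))"
    by (rule continuous_on_compose2[OF c]) (auto intro!: continuous_intros)
qed

text \<open>Only increments of the argument are controlled; an increment of \<open>2 * B\<close>
  forces modulus at least \<open>B\<close> at one of the two ends.\<close>

lemma (in bounded_continuous) Sup_Im_log_u_chirp:
  assumes "\<eta> > 0" "0 < \<xi>" "\<xi> < 1" "A = (\<lambda>x. chirp \<eta> (x + T))"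
    and M: "\<And>x. x \<ge> 0 \<Longrightarrow> ereal \<bar>Im (log_u (of_real \<xi>) x)\<bar> \<le> M"
  shows "M = \<infinity>"
proof (rule ereal_top)
  fix B :: real
  obtain \<alpha> \<beta> where \<alpha>\<beta>: "0 \<le> \<alpha>" "\<alpha> \<le> \<beta>" "2 * B \<le> Im (log_u \<xi> \<beta>) - Im (log_u \<xi> \<alpha>)"
    by (rule log_u_chirp_growth[OF assms(1-4), of 0 "2 * B"]) blast
  then have "B \<le> \<bar>Im (log_u \<xi> \<beta>)\<bar> \<or> B \<le> \<bar>Im (log_u \<xi> \<alpha>)\<bar>" by linarith
  then show "ereal B \<le> M"
    using M[of \<alpha>] M[of \<beta>] \<alpha>\<beta> by (metis ereal_less_eq(3) order_trans)
qed

lemma krein_M_chirp: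
  assumes \<eta>: "\<eta> > 0" and F: "\<M> \<in> {krein_M, krein_Mw}"
  shows "0 < \<xi> \<Longrightarrow> \<xi> < 1 \<Longrightarrow> \<M> \<xi> (chirp \<eta>) = \<infinity>" "{\<xi>. \<M> \<xi> (chirp \<eta>) \<ge> c} \<in> sets lebesgue"
proof -
  interpret bounded_smooth "chirp \<eta>" \<eta> "chirp' \<eta>"
    using bounded_smooth_chirp[OF \<eta>, of 0] by simp
  have w: "ereal \<bar>Im (log_u (of_real \<xi>) x)\<bar> \<le> krein_Mw \<xi> (chirp \<eta>)" if "x \<ge> 0" for \<xi> x
    unfolding krein_Mw_def using that krein_arg_eq[of x "of_real \<xi>"]
    by (intro Sup_upper CollectI exI[of _ x]) simp
  have m: "ereal \<bar>Im (log_u (of_real \<xi>) x)\<bar> \<le> krein_M \<xi> (chirp \<eta>)" if "x \<ge> 0" for \<xi> x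
  proof (rule abs_boundary_value_le[OF continuous_on_Im_log_u_param(1)[OF that]])
    fix k assume k: "k \<in> stolz \<xi>"
    then have "Im k \<ge> 0" by (simp add: stolz_def upper_half_plane_def)
    then show "ereal \<bar>Im (log_u k x)\<bar> \<le> krein_M \<xi> (chirp \<eta>)"
      unfolding krein_M_def using k that krein_arg_eq[of x k]
      by (intro Sup_upper CollectI exI[of _ k] exI[of _ x]) simp
  qed
  show "\<M> \<xi> (chirp \<eta>) = \<infinity>" if "0 < \<xi>" "\<xi> < 1"
    using Sup_Im_log_u_chirp[OF \<eta> that chirp_shift_0[symmetric]] w m F by blast
  \<comment> \<open>A strict superlevel set is the union, over all \<open>k\<close> and
    \<open>x\<close> with a large argument, of the open sets of vertices whose Stolz angle contains
    \<open>k\<close>.\<close>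
  have "{\<xi>. b < krein_M \<xi> (chirp \<eta>)}
      = (\<Union>(k, x)\<in>{(k, x). x \<ge> 0 \<and> b < ereal \<bar>krein_arg x k (chirp \<eta>)\<bar>}. {\<xi>. k \<in> stolz \<xi>})" for b
    unfolding krein_M_def less_Sup_iff by blast
  then have "open {\<xi>. b < krein_M \<xi> (chirp \<eta>)}" for b
    using open_stolz_vertices by (simp add: open_UN case_prod_beta)
  moreover have "{\<xi>. b < krein_Mw \<xi> (chirp \<eta>)}
      = (\<Union>x\<in>{0..}. {\<xi>. b < ereal \<bar>Im (log_u (of_real \<xi>) x)\<bar>})" for b
    unfolding krein_Mw_def less_Sup_iff using krein_arg_eq by auto
  then have "open {\<xi>. b < krein_Mw \<xi> (chirp \<eta>)}" for b
    by (auto intro!: open_UN open_Collect_less continuous_on_const continuous_on_ereal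
        continuous_on_rabs continuous_on_Im_log_u_param(2))
  ultimately show "{\<xi>. \<M> \<xi> (chirp \<eta>) \<ge> c} \<in> sets lebesgue"
    using F by (auto intro!: borel_superlevel_set)
qed

lemma krein_A_chirp_diverges:
  assumes "0 < \<xi>" "\<xi> < 1"
  shows "\<not> ((\<lambda>x. krein_A x (complex_of_real \<xi>) (chirp 1)) \<longlongrightarrow> l) at_top"
proof
  interpret bounded_smooth "chirp 1" 1 "chirp' 1"
    using bounded_smooth_chirp[of 1 0] by simp
  assume "((\<lambda>x. krein_A x (complex_of_real \<xi>) (chirp 1)) \<longlongrightarrow> l) at_top"
  then have "\<forall>\<^sub>F x in at_top. dist (krein_A x (complex_of_real \<xi>) (chirp 1)) l < 1"
    by (rule tendstoD) simp
  then have "\<forall>\<^sub>F x in at_top. dist (u (complex_of_real \<xi>) x) l < 1"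
    using eventually_ge_at_top[of 0] by eventually_elim (simp add: krein_A_eq)
  then show False
    using u_chirp_not_eventually_close[OF _ assms chirp_shift_0[symmetric]] by simp
qed

section \<open>The chirp as a Dirac potential\<close>

definition dirac_chirp :: "real \<Rightarrow> real \<Rightarrow> complex" where
  "dirac_chirp \<eta> x = - cnj (chirp \<eta> x)"

lemma dirac_a_chirp:
  assumes "\<eta> > 0" "T1 < T2"
  shows "dirac_a \<xi> (cutoff T1 T2 (dirac_chirp \<eta>)) = krein_u (\<lambda>x. chirp \<eta> (x + T1)) \<xi> (T2 - T1)"
proof -
  interpret bounded_smooth "\<lambda>x. chirp \<eta> (x + T1)" \<eta> "\<lambda>x. chirp' \<eta> (x + T1)"
    by (rule bounded_smooth_chirp[OF assms(1)])
  show ?thesis by (rule dirac_a_eq[OF assms(2)]) (simp add: dirac_chirp_def)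
qed

text \<open>The locale constant as a function of the shift. This allows all left endpoints
  \<open>T1\<close>, each belonging to a different coefficient, to occur in one statement.\<close>

definition shifted_log_u :: "real \<Rightarrow> real \<Rightarrow> complex \<Rightarrow> real \<Rightarrow> complex" where
  "shifted_log_u \<eta> T = bounded_continuous.log_u (\<lambda>x. chirp \<eta> (x + T))"

lemma dirac_arg_chirp:
  assumes "\<eta> > 0" "T1 < T2" "Im k \<ge> 0"
  shows "dirac_arg k (cutoff T1 T2 (dirac_chirp \<eta>)) = Im (shifted_log_u \<eta> T1 k (T2 - T1))"
proof -
  interpret bounded_smooth "\<lambda>x. chirp \<eta> (x + T1)" \<eta> "\<lambda>x. chirp' \<eta> (x + T1)"
    by (rule bounded_smooth_chirp[OF assms(1)])
  show ?thesis
    unfolding dirac_arg_def shifted_log_u_def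
    using outer_arg_u[of "T2 - T1" k] assms by (simp add: dirac_a_chirp)
qed

lemma continuous_on_shifted_log_u:
  assumes "\<eta> > 0" "x \<ge> 0"
  shows "continuous_on {k. Im k \<ge> 0} (\<lambda>k. Im (shifted_log_u \<eta> T k x))"
    and "continuous_on UNIV (\<lambda>\<xi>. Im (shifted_log_u \<eta> T (complex_of_real \<xi>) x))"
proof -
  interpret bounded_smooth "\<lambda>x. chirp \<eta> (x + T)" \<eta> "\<lambda>x. chirp' \<eta> (x + T)"
    by (rule bounded_smooth_chirp[OF assms(1)])
  show "continuous_on {k. Im k \<ge> 0} (\<lambda>k. Im (shifted_log_u \<eta> T k x))"
    and "continuous_on UNIV (\<lambda>\<xi>. Im (shifted_log_u \<eta> T (complex_of_real \<xi>) x))"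
    unfolding shifted_log_u_def by (rule continuous_on_Im_log_u_param[OF assms(2)])+
qed

lemma dirac_M_chirp:
  assumes \<eta>: "\<eta> > 0" and F: "\<M> \<in> {dirac_M, dirac_Mw}"
  shows "0 < \<xi> \<Longrightarrow> \<xi> < 1 \<Longrightarrow> \<M> \<xi> (dirac_chirp \<eta>) = \<infinity>" "{\<xi>. \<M> \<xi> (dirac_chirp \<eta>) \<ge> c} \<in> sets lebesgue"
proof -
  interpret bounded_smooth "chirp \<eta>" \<eta> "chirp' \<eta>"
    using bounded_smooth_chirp[OF \<eta>, of 0] by simp
  have s0: "shifted_log_u \<eta> 0 = log_u" by (simp add: shifted_log_u_def)
  \<comment> \<open>Truncations starting at 0 reduce to the unshifted chirp and already force the
    suprema to be infinite; general truncations enter only in the measurability argument.\<close>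
  have arg: "dirac_arg k (cutoff 0 x (dirac_chirp \<eta>)) = Im (log_u k x)" if "x > 0" "Im k \<ge> 0" for k x
    using dirac_arg_chirp[OF \<eta> that] by (simp add: s0)
  have w: "ereal \<bar>Im (log_u (of_real \<xi>) x)\<bar> \<le> dirac_Mw \<xi> (dirac_chirp \<eta>)" if "x > 0" for \<xi> x
    unfolding dirac_Mw_def by (rule Sup_upper, use that arg[of x "of_real \<xi>"] in force)
  have m: "ereal \<bar>Im (log_u (of_real \<xi>) x)\<bar> \<le> dirac_M \<xi> (dirac_chirp \<eta>)" if "x > 0" for \<xi> x
  proof (rule abs_boundary_value_le[OF continuous_on_Im_log_u_param(1)])
    fix k assume k: "k \<in> stolz \<xi>"
    then have "Im k \<ge> 0" by (simp add: stolz_def upper_half_plane_def)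
    then show "ereal \<bar>Im (log_u k x)\<bar> \<le> dirac_M \<xi> (dirac_chirp \<eta>)"
      unfolding dirac_M_def by (intro Sup_upper, use k that arg[of x k] in force)
  qed (use that in simp)
  \<comment> \<open>Truncations require \<open>T1 < T2\<close>, so \<open>x = 0\<close> is not
    covered by them. There \<open>log_u\<close> is 0 and any nonnegative lower bound will
    do.\<close>
  have "ereal \<bar>Im (log_u (of_real \<xi>) x)\<bar> \<le> \<M> \<xi> (dirac_chirp \<eta>)" if "x \<ge> 0" for \<xi> x
  proof (cases "x = 0")
    case True
    have "0 \<le> ereal \<bar>Im (log_u (of_real \<xi>) 1)\<bar>" by simp
    also have "\<dots> \<le> \<M> \<xi> (dirac_chirp \<eta>)" using w[of 1 \<xi>] m[of 1 \<xi>] F by auto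
    finally show ?thesis using True by (simp add: zero_ereal_def)
  qed (use that w[of x \<xi>] m[of x \<xi>] F in auto)
  then show "\<M> \<xi> (dirac_chirp \<eta>) = \<infinity>" if "0 < \<xi>" "\<xi> < 1"
    using Sup_Im_log_u_chirp[OF \<eta> that chirp_shift_0[symmetric]] by blast
  have "{\<xi>. b < dirac_M \<xi> (dirac_chirp \<eta>)}
      = (\<Union>(k, T1, T2)\<in>{(k, T1, T2). T1 < T2 \<and> b < ereal \<bar>dirac_arg k (cutoff T1 T2 (dirac_chirp \<eta>))\<bar>}. {\<xi>. k \<in> stolz \<xi>})" for b
    unfolding dirac_M_def less_Sup_iff by blast
  then have "open {\<xi>. b < dirac_M \<xi> (dirac_chirp \<eta>)}" for b
    using open_stolz_vertices by (simp add: open_UN case_prod_beta)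
  moreover have "{\<xi>. b < dirac_Mw \<xi> (dirac_chirp \<eta>)}
      = (\<Union>(T1, T2)\<in>{(T1, T2). T1 < T2}. {\<xi>. b < ereal \<bar>Im (shifted_log_u \<eta> T1 (of_real \<xi>) (T2 - T1))\<bar>})" for b
  proof -
    have "{\<xi>. b < dirac_Mw \<xi> (dirac_chirp \<eta>)}
      = (\<Union>(T1, T2)\<in>{(T1, T2). T1 < T2}. {\<xi>. b < ereal \<bar>dirac_arg (of_real \<xi>) (cutoff T1 T2 (dirac_chirp \<eta>))\<bar>})"
      unfolding dirac_Mw_def less_Sup_iff by blast
    also have "\<dots> = (\<Union>(T1, T2)\<in>{(T1, T2). T1 < T2}. {\<xi>. b < ereal \<bar>Im (shifted_log_u \<eta> T1 (of_real \<xi>) (T2 - T1))\<bar>})"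
      by (rule SUP_cong) (auto simp: dirac_arg_chirp[OF \<eta>])
    finally show ?thesis .
  qed
  then have "open {\<xi>. b < dirac_Mw \<xi> (dirac_chirp \<eta>)}" for b
    by (auto intro!: open_UN open_Collect_less continuous_on_const continuous_on_ereal
        continuous_on_rabs continuous_on_shifted_log_u(2) \<eta>)
  ultimately show "{\<xi>. \<M> \<xi> (dirac_chirp \<eta>) \<ge> c} \<in> sets lebesgue"
    using F by (auto intro!: borel_superlevel_set)
qed

lemma dirac_a_chirp_diverges:
  assumes "0 < \<xi>" "\<xi> < 1"
  shows "\<not> ((\<lambda>(T1, T2). dirac_a \<xi> (cutoff T1 T2 (dirac_chirp 1))) \<longlongrightarrow> l) (at_bot \<times>\<^sub>F at_top)"
proof
  assume "((\<lambda>(T1, T2). dirac_a \<xi> (cutoff T1 T2 (dirac_chirp 1))) \<longlongrightarrow> l) (at_bot \<times>\<^sub>F at_top)"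
  then have "\<forall>\<^sub>F p in at_bot \<times>\<^sub>F at_top. dist (case p of (T1, T2) \<Rightarrow> dirac_a \<xi> (cutoff T1 T2 (dirac_chirp 1))) l < 1"
    by (rule tendstoD) simp
  then obtain P Q where PQ: "eventually P at_bot" "eventually Q at_top"
    "\<And>T1 T2. P T1 \<Longrightarrow> Q T2 \<Longrightarrow> dist (dirac_a \<xi> (cutoff T1 T2 (dirac_chirp 1))) l < 1"
    by (auto simp: eventually_prod_filter)
  \<comment> \<open>Convergence along the product filter gives closeness for one fixed left endpoint
    and all large right endpoints, which contradicts the oscillation of a single shifted
    \<open>u\<close>.\<close>
  obtain T1 :: real where "P T1"
    using eventually_happens[OF PQ(1)] by auto
  interpret bounded_smooth "\<lambda>x. chirp 1 (x + T1)" 1 "\<lambda>x. chirp' 1 (x + T1)"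
    by (rule bounded_smooth_chirp) simp
  have "filterlim (\<lambda>x. T1 + x) at_top at_top"
    by (rule filterlim_tendsto_add_at_top[OF tendsto_const filterlim_ident])
  from eventually_compose_filterlim[OF PQ(2) this]
  have "\<forall>\<^sub>F x in at_top. dist (u (complex_of_real \<xi>) x) l < 1"
    using eventually_gt_at_top[of 0]
  proof eventually_elim
    case (elim x)
    then show ?case
      using PQ(3)[OF \<open>P T1\<close>, of "T1 + x"] dirac_a_chirp[of 1 T1 "T1 + x" \<xi>] by simp
  qed
  then show False
    using u_chirp_not_eventually_close[OF _ assms] by simp
qed

lemma chirp_in_L2:
  assumes "\<eta> > 0"
  shows "chirp \<eta> \<in> L2_on {0..}" "L2_norm_on {0..} (chirp \<eta>) \<le> 2 * \<eta>"
    and "dirac_chirp \<eta> \<in> L2_on UNIV" "L2_norm_on UNIV (dirac_chirp \<eta>) \<le> 2 * \<eta>"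
proof -
  have c: "continuous_on UNIV (chirp \<eta>)"
    unfolding chirp_def[abs_def] by (intro continuous_intros)
  show "chirp \<eta> \<in> L2_on {0..}" "L2_norm_on {0..} (chirp \<eta>) \<le> 2 * \<eta>"
    by (rule chirp_L2[OF assms _ c]; simp)+
  have d: "continuous_on UNIV (dirac_chirp \<eta>)"
    unfolding dirac_chirp_def[abs_def] by (intro continuous_intros c)
  show "dirac_chirp \<eta> \<in> L2_on UNIV" "L2_norm_on UNIV (dirac_chirp \<eta>) \<le> 2 * \<eta>"
    by (rule chirp_L2[OF assms _ d]; simp add: dirac_chirp_def)+
qed

theorem corollary2p4:
  shows
   "(\<exists>A\<in>L2_on {0..}. \<not> (AE \<xi> in lebesgue.
       (\<exists>l. ((\<lambda>x. krein_A x (complex_of_real \<xi>) A) \<longlongrightarrow> l) at_top) \<and>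
       (\<exists>l. ((\<lambda>x. krein_B x (complex_of_real \<xi>) A) \<longlongrightarrow> l) at_top)))
  \<and> \<not> (\<forall>A\<in>L2_on {0..}. AE \<xi> in lebesgue. krein_M \<xi> A < \<infinity>)
  \<and> \<not> (\<forall>A\<in>L2_on {0..}. AE \<xi> in lebesgue. krein_Mw \<xi> A < \<infinity>)
  \<and> (\<forall>\<delta>0::real. \<delta>0 > 0 \<longrightarrow> (\<forall>\<M>\<in>{krein_M, krein_Mw}. \<not> (\<exists>K::real.
       \<forall>\<mu>::real. \<mu> > 0 \<longrightarrow> (\<forall>A\<in>L2_on {0..}. L2_norm_on {0..} A \<le> \<delta>0 \<longrightarrow>
         emeasure lebesgue {\<xi>. \<M> \<xi> A \<ge> ereal \<mu>}
           \<le> ennreal (K * L2_norm_on {0..} A / \<mu>)))))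
  \<and> (\<exists>q\<in>L2_on UNIV. \<not> (AE \<xi> in lebesgue.
       \<exists>l. ((\<lambda>(T1, T2). dirac_a \<xi> (cutoff T1 T2 q)) \<longlongrightarrow> l) (at_bot \<times>\<^sub>F at_top)))
  \<and> \<not> (\<forall>q\<in>L2_on UNIV. AE \<xi> in lebesgue. dirac_M \<xi> q < \<infinity>)
  \<and> \<not> (\<forall>q\<in>L2_on UNIV. AE \<xi> in lebesgue. dirac_Mw \<xi> q < \<infinity>)
  \<and> (\<forall>\<delta>0::real. \<delta>0 > 0 \<longrightarrow> (\<forall>\<M>\<in>{dirac_M, dirac_Mw}. \<not> (\<exists>K::real.
       \<forall>\<mu>::real. \<mu> > 0 \<longrightarrow> (\<forall>q\<in>L2_on UNIV. L2_norm_on UNIV q \<le> \<delta>0 \<longrightarrow>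
         emeasure lebesgue {\<xi>. \<M> \<xi> q \<ge> ereal \<mu>}
           \<le> ennreal (K * L2_norm_on UNIV q / \<mu>)))))"
proof -
  have krein_inf: "\<not> (\<forall>A\<in>L2_on {0..}. AE \<xi> in lebesgue. \<M> \<xi> A < \<infinity>)" if "\<M> \<in> {krein_M, krein_Mw}" for \<M>
  proof
    assume "\<forall>A\<in>L2_on {0..}. AE \<xi> in lebesgue. \<M> \<xi> A < \<infinity>"
    then have "AE \<xi> in lebesgue. \<M> \<xi> (chirp 1) < \<infinity>" using chirp_in_L2(1)[of 1] by simp
    then show False
      using not_AE_unit_interval[of "\<lambda>\<xi>. \<M> \<xi> (chirp 1) < \<infinity>"] krein_M_chirp(1)[OF _ that, of 1] by simp
  qed
  have dirac_inf: "\<not> (\<forall>q\<in>L2_on UNIV. AE \<xi> in lebesgue. \<M> \<xi> q < \<infinity>)" if "\<M> \<in> {dirac_M, dirac_Mw}" for \<M>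
  proof
    assume "\<forall>q\<in>L2_on UNIV. AE \<xi> in lebesgue. \<M> \<xi> q < \<infinity>"
    then have "AE \<xi> in lebesgue. \<M> \<xi> (dirac_chirp 1) < \<infinity>" using chirp_in_L2(3)[of 1] by simp
    then show False
      using not_AE_unit_interval[of "\<lambda>\<xi>. \<M> \<xi> (dirac_chirp 1) < \<infinity>"] dirac_M_chirp(1)[OF _ that, of 1] by simp
  qed
  have krein_weak: "\<not> (\<exists>K::real. \<forall>\<mu>::real. \<mu> > 0 \<longrightarrow> (\<forall>A\<in>L2_on {0..}. L2_norm_on {0..} A \<le> \<delta>0 \<longrightarrow>
         emeasure lebesgue {\<xi>. \<M> \<xi> A \<ge> ereal \<mu>} \<le> ennreal (K * L2_norm_on {0..} A / \<mu>)))"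
    if "\<delta>0 > 0" "\<M> \<in> {krein_M, krein_Mw}" for \<delta>0 \<M>
  proof
    assume "\<exists>K::real. \<forall>\<mu>::real. \<mu> > 0 \<longrightarrow> (\<forall>A\<in>L2_on {0..}. L2_norm_on {0..} A \<le> \<delta>0 \<longrightarrow>
         emeasure lebesgue {\<xi>. \<M> \<xi> A \<ge> ereal \<mu>} \<le> ennreal (K * L2_norm_on {0..} A / \<mu>))"
    then obtain K where K: "\<And>\<mu> A. \<mu> > 0 \<Longrightarrow> A \<in> L2_on {0..} \<Longrightarrow> L2_norm_on {0..} A \<le> \<delta>0 \<Longrightarrow>
         emeasure lebesgue {\<xi>. \<M> \<xi> A \<ge> ereal \<mu>} \<le> ennreal (K * L2_norm_on {0..} A / \<mu>)"
      by blast
    \<comment> \<open>The norm of the chirp is at most \<open>2 * \<eta>\<close>, so this choice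
      makes it admissible.\<close>
    define \<eta> where "\<eta> = \<delta>0 / 2"
    have \<eta>: "\<eta> > 0" using that by (simp add: \<eta>_def)
    show False
      \<comment> \<open>The potential is fixed, so \<open>K\<close> times its norm serves as the
        constant to be refuted.\<close>
      using no_weak_type_bound[OF krein_M_chirp[OF \<eta> that(2)]] K chirp_in_L2(1,2)[OF \<eta>]
      by (auto simp: \<eta>_def)
  qed
  have dirac_weak: "\<not> (\<exists>K::real. \<forall>\<mu>::real. \<mu> > 0 \<longrightarrow> (\<forall>q\<in>L2_on UNIV. L2_norm_on UNIV q \<le> \<delta>0 \<longrightarrow>
         emeasure lebesgue {\<xi>. \<M> \<xi> q \<ge> ereal \<mu>} \<le> ennreal (K * L2_norm_on UNIV q / \<mu>)))"
    if "\<delta>0 > 0" "\<M> \<in> {dirac_M, dirac_Mw}" for \<delta>0 \<M>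
  proof
    assume "\<exists>K::real. \<forall>\<mu>::real. \<mu> > 0 \<longrightarrow> (\<forall>q\<in>L2_on UNIV. L2_norm_on UNIV q \<le> \<delta>0 \<longrightarrow>
         emeasure lebesgue {\<xi>. \<M> \<xi> q \<ge> ereal \<mu>} \<le> ennreal (K * L2_norm_on UNIV q / \<mu>))"
    then obtain K where K: "\<And>\<mu> q. \<mu> > 0 \<Longrightarrow> q \<in> L2_on UNIV \<Longrightarrow> L2_norm_on UNIV q \<le> \<delta>0 \<Longrightarrow>
         emeasure lebesgue {\<xi>. \<M> \<xi> q \<ge> ereal \<mu>} \<le> ennreal (K * L2_norm_on UNIV q / \<mu>)"
      by blast
    define \<eta> where "\<eta> = \<delta>0 / 2"
    have \<eta>: "\<eta> > 0" using that by (simp add: \<eta>_def)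
    show False
      using no_weak_type_bound[OF dirac_M_chirp[OF \<eta> that(2)]] K chirp_in_L2(3,4)[OF \<eta>]
      by (auto simp: \<eta>_def)
  qed
  have krein_div: "\<exists>A\<in>L2_on {0..}. \<not> (AE \<xi> in lebesgue.
       (\<exists>l. ((\<lambda>x. krein_A x (complex_of_real \<xi>) A) \<longlongrightarrow> l) at_top) \<and>
       (\<exists>l. ((\<lambda>x. krein_B x (complex_of_real \<xi>) A) \<longlongrightarrow> l) at_top))"
    by (rule bexI[OF not_AE_unit_interval chirp_in_L2(1)[OF zero_less_one]])
      (use krein_A_chirp_diverges in blast)
  have dirac_div: "\<exists>q\<in>L2_on UNIV. \<not> (AE \<xi> in lebesgue.
       \<exists>l. ((\<lambda>(T1, T2). dirac_a \<xi> (cutoff T1 T2 q)) \<longlongrightarrow> l) (at_bot \<times>\<^sub>F at_top))"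
    by (rule bexI[OF not_AE_unit_interval chirp_in_L2(3)[OF zero_less_one]])
      (use dirac_a_chirp_diverges in blast)
  show ?thesis
    by (intro conjI krein_div dirac_div krein_inf dirac_inf;
        (intro allI impI ballI krein_weak dirac_weak; assumption | simp))
qed

end
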